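(* Let $1 \le p < \frac{4}{3}$ and let $f \in L^p(\mathbb{R}^2)$. Then, with respect to arclength measure $\sigma$ on the unit circle $\mathbb{S}^1\subset\mathbb{R}^2$, $\sigma$-almost every point $x \in \mathbb{S}^1$ is a Lebesgue point of $\widehat{f}$, and for $\sigma$-almost every $x\in\mathbb{S}^1$ the regularised value of $\widehat{f}$ at $x$ coincides with $\mathcal{R}f(x)$.
   Context: For $1\le p\le 2$ and $f\in L^p(\mathbb{R}^2)$, $\widehat{f}$ denotes the Fourier transform, a locally integrable function on $\mathbb{R}^2$ (an $L^{p'}$ function by Hausdorff–Young). A point $x$ is a Lebesgue point of $\widehat f$ if there is a number $c$ (the regularised value of $\widehat f$ at $x$) with $\lim_{r\to 0}\frac{1}{|B(x,r)|}\int_{B(x,r)}|\widehat f(y)-c|\,\mathrm{d}y=0$. The restriction operator $\mathcal{R}$ is the unique bounded linear operator from $L^p(\mathbb{R}^2)$ (for $1\le p<4/3$) to $L^1(\mathbb{S}^1,\sigma)$ which agrees with $f\mapsto \widehat f|_{\mathbb{S}^1}$ on Schwartz functions $f$. *)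

theory Defs
  imports "HOL-Analysis.Analysis"
begin

definition in_Lp :: "real \<Rightarrow> (real^2 \<Rightarrow> complex) \<Rightarrow> bool" where
  "in_Lp p f \<longleftrightarrow> f \<in> borel_measurable lborel \<and> integrable lborel (\<lambda>x. norm (f x) powr p)"

definition Lp_norm :: "real \<Rightarrow> (real^2 \<Rightarrow> complex) \<Rightarrow> real" where
  "Lp_norm p f = (\<integral>x. norm (f x) powr p \<partial>lborel) powr (1 / p)"

definition fourier_int :: "(real^2 \<Rightarrow> complex) \<Rightarrow> real^2 \<Rightarrow> complex" where
  "fourier_int f \<xi> = (\<integral>x. f x * cis (- 2 * pi * (x \<bullet> \<xi>)) \<partial>lborel)"

text \<open>Schwartz class: f belongs to a family S of everywhere differentiable functions,
  closed under taking partial derivatives, all of whose members are rapidly decreasing.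
  This is exactly: f smooth and (1+|x|)^N |D^alpha f(x)| bounded for all N, alpha.\<close>
definition schwartz :: "(real^2 \<Rightarrow> complex) \<Rightarrow> bool" where
  "schwartz f \<longleftrightarrow> (\<exists>S. f \<in> S \<and> (\<forall>g\<in>S.
      (\<exists>D. (\<forall>x. (g has_derivative D x) (at x)) \<and> (\<forall>i. (\<lambda>x. D x (axis i 1)) \<in> S)) \<and>
      (\<forall>N::nat. \<exists>C. \<forall>x. (1 + norm x) ^ N * norm (g x) \<le> C)))"

text \<open>F is (a representative of) the Fourier transform of f in the sense of
  tempered distributions: int F phi = int f phihat for all Schwartz phi.\<close>
definition is_fourier_transform :: "(real^2 \<Rightarrow> complex) \<Rightarrow> (real^2 \<Rightarrow> complex) \<Rightarrow> bool" where
  "is_fourier_transform f F \<longleftrightarrow> F \<in> borel_measurable lborel \<and>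
     (\<forall>\<phi>. schwartz \<phi> \<longrightarrow> integrable lborel (\<lambda>\<xi>. F \<xi> * \<phi> \<xi>) \<and>
        (\<integral>\<xi>. F \<xi> * \<phi> \<xi> \<partial>lborel) = (\<integral>x. f x * fourier_int \<phi> x \<partial>lborel))"

definition circle_measure :: "(real^2) measure" where
  "circle_measure = distr (restrict_space lborel {0..<2*pi}) borel
       (\<lambda>\<theta>. vector [cos \<theta>, sin \<theta>])"

definition lebesgue_point_value :: "(real^2 \<Rightarrow> complex) \<Rightarrow> real^2 \<Rightarrow> complex \<Rightarrow> bool" where
  "lebesgue_point_value F x c \<longleftrightarrow>
     ((\<lambda>r. ennreal (1 / measure lborel (ball x r)) *
            (\<integral>\<^sup>+ y \<in> ball x r. ennreal (norm (F y - c)) \<partial>lborel)) \<longlongrightarrow> 0) (at_right 0)"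

definition lebesgue_point :: "(real^2 \<Rightarrow> complex) \<Rightarrow> real^2 \<Rightarrow> bool" where
  "lebesgue_point F x \<longleftrightarrow> (\<exists>c. lebesgue_point_value F x c)"

definition restriction_operator ::
    "real \<Rightarrow> ((real^2 \<Rightarrow> complex) \<Rightarrow> (real^2 \<Rightarrow> complex)) \<Rightarrow> bool" where
  "restriction_operator p R \<longleftrightarrow>
     (\<forall>f g a b. in_Lp p f \<longrightarrow> in_Lp p g \<longrightarrow>
        (AE x in circle_measure. R (\<lambda>y. a * f y + b * g y) x = a * R f x + b * R g x)) \<and>
     (\<exists>C. \<forall>f. in_Lp p f \<longrightarrow> integrable circle_measure (R f) \<and>
        (\<integral>x. norm (R f x) \<partial>circle_measure) \<le> C * Lp_norm p f) \<and>
     (\<forall>f. schwartz f \<longrightarrow> (AE x in circle_measure. R f x = fourier_int f x))"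

end

theory Submission
  imports Defs "HOL-Probability.Probability" "HOL-Computational_Algebra.Polynomial"
begin

text \<open>
  The restriction operator controls the values on the circle, so the point is a maximal estimate:
  the averages of \<open>\<bar>F\<bar>\<close> over small discs, maximised over dyadic radii, are small in \<open>L\<^sup>1\<close>
  of the circle when \<open>f\<close> is small in \<open>L\<^sup>p\<close>. Choosing the radius \<open>r(x)\<close> measurably and dualising, this integral
  is \<open>\<integral> f \<cdot> (Fourier transform of h)\<close>, where \<open>\<bar>h\<bar>\<close> equals the average \<open>H\<close> of the normalised indicators of
  the discs \<open>B(x, r(x))\<close> over the circle. The square of the transform of \<open>h\<close> is the transform of \<open>h * h\<close>, and
  \<open>\<bar>h * h\<bar> \<le> H * H\<close> pointwise: positivity removes the unknown phase (Ramos). Testing \<open>H * H\<close> on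
  a set \<open>E\<close> gives the integral of the Hardy-Littlewood maximal function of the indicator of \<open>E\<close> against
  \<open>\<sigma> * \<sigma>\<close>, which is \<open>O(\<bar>E\<bar>\<^sup>1\<^sup>/\<^sup>2)\<close>. So \<open>H * H\<close> is uniformly in weak \<open>L\<^sup>2\<close>, and interpolation
  between \<open>L\<^sup>1\<close> and \<open>L\<^sup>2\<close> puts the transform of \<open>h\<close> in \<open>L\<^sup>s\<close> for every \<open>s > 4\<close>, in particular for the
  exponent conjugate to \<open>p < 4/3\<close>. Schwartz functions are dense in \<open>L\<^sup>p\<close> and have continuous transforms,
  which finishes the proof.
\<close>

section \<open>Lebesgue measure on the plane\<close>

text \<open>The self-convolution of arclength on the unit circle has a density comparable to
  \<open>1 / (\<bar>z\<bar> * sqrt (2 - \<bar>z\<bar>))\<close> on the disc of radius 2. The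
  singularities at the centre and at the rim keep it out of \<open>L\<^sup>2\<close> and leave it in
  weak \<open>L\<^sup>2\<close>. Hence all bounds are tested on sets \<open>E\<close>, and passing
  from weak \<open>L\<^sup>2\<close> to a truncated \<open>L\<^sup>2\<close> bound costs a
  logarithm. That loss is harmless for \<open>s > 4\<close>, which is the condition
  \<open>p < 4/3\<close> for conjugate exponents. A second obstacle is that \<open>F\<close> is
  known only through its pairings with Schwartz functions, while \<open>h\<close> carries the phase
  of \<open>F\<close> and is merely measurable. The duality identity is therefore extended to every
  Borel function dominated by a Gaussian. To stay in this class, only finitely many dyadic radii
  compete at a time: then \<open>h\<close> is bounded with bounded support. The quantitative
  estimates do not depend on the number of radii, so monotone convergence restores the full maximal
  function.\<close>

lemma dyadic_bracket:
  fixes t :: real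
  assumes t: "0 < t" "t \<le> 1"
  obtains j where "(1/2) ^ Suc j < t" "t \<le> (1/2) ^ j"
proof -
  obtain n where "(1/2) ^ n < t" using real_arch_pow_inv[OF t(1), of "1/2"] by auto
  then have "(1/2) ^ Suc n < t" using t(1) by (auto intro: le_less_trans[rotated])
  then have ex: "\<exists>n. (1/2) ^ Suc n < t" by blast
  define j where "j = (LEAST n. (1/2) ^ Suc n < t)"
  have "(1/2) ^ Suc j < t" unfolding j_def by (rule LeastI_ex[OF ex])
  moreover have "t \<le> (1/2) ^ j"
  proof (cases j)
    case (Suc k)
    then have "\<not> (1/2) ^ Suc k < t" using not_less_Least[of k "\<lambda>n. (1/2) ^ Suc n < t"] unfolding j_def by auto
    then show ?thesis using Suc by simp
  qed (use t in simp)
  ultimately show ?thesis by (rule that)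
qed

lemma lborel_distr_reflect:
  fixes z :: "'a::euclidean_space"
  shows "distr lborel borel (\<lambda>y. z - y) = lborel"
  using lborel_affine[of "-1" z] by (simp add: density_1)

lemma lborel_distr_translate:
  fixes z :: "'a::euclidean_space"
  shows "distr lborel borel (\<lambda>y. y + z) = lborel"
  using lborel_distr_plus[of z] by (simp add: add.commute[of _ z])

lemma nn_integral_lborel_translate:
  fixes z :: "'a::euclidean_space"
  assumes [measurable]: "g \<in> borel_measurable borel"
  shows "(\<integral>\<^sup>+y. g (y + z) \<partial>lborel) = (\<integral>\<^sup>+y. g y \<partial>lborel)"
  by (subst (2) lborel_distr_translate[symmetric, of z]) (simp add: nn_integral_distr)

lemma
  fixes z :: "'a::euclidean_space" and g :: "'a \<Rightarrow> 'b::{banach, second_countable_topology}"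
  assumes g: "g \<in> borel_measurable borel"
  shows integral_lborel_translate: "(\<integral>y. g (y + z) \<partial>lborel) = (\<integral>y. g y \<partial>lborel)"
    and integrable_lborel_translate: "integrable lborel (\<lambda>y. g (y + z)) \<longleftrightarrow> integrable lborel g"
    and integral_lborel_reflect: "(\<integral>y. g (z - y) \<partial>lborel) = (\<integral>y. g y \<partial>lborel)"
    and integrable_lborel_reflect: "integrable lborel (\<lambda>y. g (z - y)) \<longleftrightarrow> integrable lborel g"
proof -
  note [measurable] = g
  show "(\<integral>y. g (y + z) \<partial>lborel) = (\<integral>y. g y \<partial>lborel)"
    by (subst (2) lborel_distr_translate[symmetric, of z]) (simp add: integral_distr)
  show "integrable lborel (\<lambda>y. g (y + z)) \<longleftrightarrow> integrable lborel g"
    by (subst (2) lborel_distr_translate[symmetric, of z]) (simp add: integrable_distr_eq)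
  show "(\<integral>y. g (z - y) \<partial>lborel) = (\<integral>y. g y \<partial>lborel)"
    by (subst (2) lborel_distr_reflect[symmetric, of z]) (simp add: integral_distr)
  show "integrable lborel (\<lambda>y. g (z - y)) \<longleftrightarrow> integrable lborel g"
    by (subst (2) lborel_distr_reflect[symmetric, of z]) (simp add: integrable_distr_eq)
qed

text \<open>A measure that gives every box its volume is Lebesgue measure, so it suffices to compare
  areas of boxes. This makes Fubini available for the two coordinates of
  \<open>real^2\<close>.\<close>

lemma lborel_vec2:
  "(lborel :: (real^2) measure) = distr (lborel \<Otimes>\<^sub>M lborel) borel (\<lambda>(a, b). vector [a, b])"
proof (rule lborel_eqI)
  have m: "(\<lambda>(a, b). vector [a, b] :: real^2) \<in> borel_measurable (lborel \<Otimes>\<^sub>M lborel)"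
  proof -
    have "(\<lambda>p. vector [fst p, snd p] :: real^2) = (\<lambda>p. fst p *\<^sub>R axis 1 1 + snd p *\<^sub>R axis 2 1)"
      by (auto simp: vec_eq_iff forall_2 axis_def)
    then show ?thesis unfolding case_prod_beta by (simp only:) simp
  qed
  fix l u :: "real^2" assume lu: "\<And>b. b \<in> Basis \<Longrightarrow> l \<bullet> b \<le> u \<bullet> b"
  then have lu': "l $ 1 \<le> u $ 1" "l $ 2 \<le> u $ 2"
    by (auto simp: axis_inverse inner_axis dest!: spec axis_in_Basis_iff[THEN iffD2] intro: lu[of "axis _ 1", simplified inner_axis, simplified])
  have eq: "(\<lambda>(a, b). vector [a, b] :: real^2) -` box l u \<inter> space (lborel \<Otimes>\<^sub>M lborel)
      = {l $ 1 <..< u $ 1} \<times> {l $ 2 <..< u $ 2}"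
    by (auto simp: mem_box_cart space_pair_measure forall_2)
  have "emeasure (distr (lborel \<Otimes>\<^sub>M lborel) borel (\<lambda>(a, b). vector [a, b] :: real^2)) (box l u)
    = ennreal (u $ 1 - l $ 1) * ennreal (u $ 2 - l $ 2)"
    using lu' by (subst emeasure_distr[OF m]) (simp_all add: eq lborel.emeasure_pair_measure_Times)
  also have "\<dots> = ennreal ((u $ 1 - l $ 1) * (u $ 2 - l $ 2))"
    using lu' by (simp add: ennreal_mult)
  also have "(u $ 1 - l $ 1) * (u $ 2 - l $ 2) = (\<Prod>b\<in>Basis. (u - l) \<bullet> b)"
  proof -
    have B: "(Basis :: (real^2) set) = {axis 1 1, axis 2 1}"
      by (auto simp: Basis_vec_def exhaust_2 UNIV_2)
    show ?thesis unfolding B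
      by (subst prod.insert) (auto simp: inner_axis axis_eq_axis)
  qed
  finally show "emeasure (distr (lborel \<Otimes>\<^sub>M lborel) borel (\<lambda>(a, b). vector [a, b] :: real^2)) (box l u) = (\<Prod>b\<in>Basis. (u - l) \<bullet> b)" .
qed simp

lemma measurable_vector2 [measurable (raw)]:
  assumes [measurable]: "f \<in> borel_measurable M" "g \<in> borel_measurable M"
  shows "(\<lambda>x. vector [f x, g x] :: real^2) \<in> borel_measurable M"
proof -
  have "(\<lambda>x. vector [f x, g x] :: real^2) = (\<lambda>x. f x *\<^sub>R axis 1 1 + g x *\<^sub>R axis 2 1)"
    by (auto simp: vec_eq_iff forall_2 axis_def)
  then show ?thesis by simp
qed

lemma measurable_vec_nth [measurable (raw)]:
  fixes f :: "'a \<Rightarrow> real^'n"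
  assumes "f \<in> borel_measurable M"
  shows "(\<lambda>x. f x $ i) \<in> borel_measurable M"
  using borel_measurable_inner[OF assms borel_measurable_const[of "axis i 1"]]
  by (simp add: inner_axis)

lemma nn_integral_vec2:
  fixes f :: "real^2 \<Rightarrow> ennreal"
  assumes [measurable]: "f \<in> borel_measurable borel"
  shows "(\<integral>\<^sup>+x. f x \<partial>lborel) = (\<integral>\<^sup>+a. \<integral>\<^sup>+b. f (vector [a, b]) \<partial>lborel \<partial>lborel)"
proof -
  have "(\<integral>\<^sup>+x. f x \<partial>lborel) = (\<integral>\<^sup>+p. f (vector [fst p, snd p]) \<partial>(lborel \<Otimes>\<^sub>M lborel))"
    unfolding lborel_vec2 by (subst nn_integral_distr) (simp_all add: case_prod_beta)
  also have "\<dots> = (\<integral>\<^sup>+a. \<integral>\<^sup>+b. f (vector [a, b]) \<partial>lborel \<partial>lborel)"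
    by (subst lborel.nn_integral_fst[symmetric]) simp_all
  finally show ?thesis .
qed

lemma
  fixes u :: "'a::euclidean_space \<Rightarrow> complex" and v :: "'b::euclidean_space \<Rightarrow> complex"
  assumes u: "integrable lborel u" and v: "integrable lborel v"
  shows integrable_lborel_pair_mult: "integrable (lborel \<Otimes>\<^sub>M lborel) (\<lambda>p. u (fst p) * v (snd p))"
    and integral_lborel_pair_mult:
      "(\<integral>p. u (fst p) * v (snd p) \<partial>(lborel \<Otimes>\<^sub>M lborel)) = (\<integral>x. u x \<partial>lborel) * (\<integral>x. v x \<partial>lborel)"
proof -
  have [measurable]: "u \<in> borel_measurable borel" "v \<in> borel_measurable borel"
    using u v by auto
  show I: "integrable (lborel \<Otimes>\<^sub>M lborel) (\<lambda>p. u (fst p) * v (snd p))"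
  proof (rule lborel_pair.Fubini_integrable)
    show "integrable lborel (\<lambda>x. \<integral>y. norm (u (fst (x, y)) * v (snd (x, y))) \<partial>lborel)"
      using u v by (simp add: norm_mult)
  qed (use v in \<open>auto\<close>)
  have "(\<integral>p. u (fst p) * v (snd p) \<partial>(lborel \<Otimes>\<^sub>M lborel)) = (\<integral>x. \<integral>y. u x * v y \<partial>lborel \<partial>lborel)"
    using lborel_pair.integral_fst'[OF I] by simp
  also have "\<dots> = (\<integral>x. u x \<partial>lborel) * (\<integral>x. v x \<partial>lborel)" by simp
  finally show "(\<integral>p. u (fst p) * v (snd p) \<partial>(lborel \<Otimes>\<^sub>M lborel)) = (\<integral>x. u x \<partial>lborel) * (\<integral>x. v x \<partial>lborel)" .
qed

lemma
  fixes u v :: "real \<Rightarrow> complex"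
  assumes u: "integrable lborel u" and v: "integrable lborel v"
  shows integrable_vec2_mult: "integrable lborel (\<lambda>x::real^2. u (x $ 1) * v (x $ 2))"
    and integral_vec2_mult:
      "(\<integral>x. u (x $ 1) * v (x $ 2) \<partial>(lborel :: (real^2) measure)) = (\<integral>x. u x \<partial>lborel) * (\<integral>x. v x \<partial>lborel)"
proof -
  have [measurable]: "u \<in> borel_measurable borel" "v \<in> borel_measurable borel"
    using u v by auto
  have [measurable]: "(\<lambda>x::real^2. u (x $ 1) * v (x $ 2)) \<in> borel_measurable borel"
    by measurable
  show "integrable lborel (\<lambda>x::real^2. u (x $ 1) * v (x $ 2))"
    unfolding lborel_vec2 using integrable_lborel_pair_mult[OF u v]
    by (subst integrable_distr_eq) (simp_all add: case_prod_beta)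
  show "(\<integral>x. u (x $ 1) * v (x $ 2) \<partial>(lborel :: (real^2) measure)) = (\<integral>x. u x \<partial>lborel) * (\<integral>x. v x \<partial>lborel)"
    unfolding lborel_vec2 using integral_lborel_pair_mult[OF u v]
    by (subst integral_distr) (simp_all add: case_prod_beta)
qed

section \<open>The Fourier integral\<close>

lemma cis_measurable [measurable (raw)]:
  assumes [measurable]: "f \<in> borel_measurable M"
  shows "(\<lambda>x. cis (f x)) \<in> borel_measurable M"
  unfolding cis_conv_exp by measurable

lemma integrable_fourier_int:
  fixes f :: "real^2 \<Rightarrow> complex"
  assumes "integrable lborel f"
  shows "integrable lborel (\<lambda>x. f x * cis (- 2 * pi * (x \<bullet> \<xi>)))"
  by (rule Bochner_Integration.integrable_bound[OF assms])
     (use assms in \<open>auto simp: norm_mult\<close>)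

lemma fourier_int_measurable [measurable]:
  fixes f :: "real^2 \<Rightarrow> complex"
  assumes [measurable]: "f \<in> borel_measurable borel"
  shows "fourier_int f \<in> borel_measurable borel"
proof -
  have "(\<lambda>\<xi>. \<integral>x. f x * cis (- 2 * pi * (x \<bullet> \<xi>)) \<partial>lborel) \<in> borel_measurable borel"
    by measurable
  then show ?thesis unfolding fourier_int_def[abs_def] .
qed

lemma norm_fourier_int_le:
  fixes f :: "real^2 \<Rightarrow> complex"
  shows "norm (fourier_int f \<xi>) \<le> (\<integral>x. norm (f x) \<partial>lborel)"
  unfolding fourier_int_def
  by (rule order_trans[OF integral_norm_bound]) (simp add: norm_mult)

lemma continuous_fourier_int:
  fixes f :: "real^2 \<Rightarrow> complex"
  assumes f: "integrable lborel f"
  shows "isCont (fourier_int f) \<xi>"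
proof (subst continuous_at_sequentially, intro allI impI)
  fix u assume u: "u \<longlonglongrightarrow> \<xi>"
  show "(fourier_int f \<circ> u) \<longlonglongrightarrow> fourier_int f \<xi>"
    unfolding comp_def fourier_int_def
  proof (rule integral_dominated_convergence[where w="\<lambda>x. norm (f x)"])
    show "AE x in lborel. (\<lambda>n. f x * cis (- 2 * pi * (x \<bullet> u n))) \<longlonglongrightarrow> f x * cis (- 2 * pi * (x \<bullet> \<xi>))"
      unfolding cis_conv_exp by (intro AE_I2 tendsto_intros u)
  qed (use f in \<open>auto simp: norm_mult\<close>)
qed

lemma
  fixes f g :: "real^2 \<Rightarrow> complex"
  assumes "integrable lborel f" "integrable lborel g"
  shows fourier_int_diff: "fourier_int (\<lambda>x. f x - g x) \<xi> = fourier_int f \<xi> - fourier_int g \<xi>"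
    and fourier_int_add: "fourier_int (\<lambda>x. f x + g x) \<xi> = fourier_int f \<xi> + fourier_int g \<xi>"
  unfolding fourier_int_def
  using integrable_fourier_int[OF assms(1)] integrable_fourier_int[OF assms(2)]
  by (simp_all add: left_diff_distrib distrib_right)

lemma fourier_int_cmult:
  fixes f :: "real^2 \<Rightarrow> complex"
  shows "fourier_int (\<lambda>x. c * f x) \<xi> = c * fourier_int f \<xi>"
  unfolding fourier_int_def by (simp add: mult.assoc)

lemma fourier_int_multiplication:
  fixes f g :: "real^2 \<Rightarrow> complex"
  assumes f: "integrable lborel f" and g: "integrable lborel g"
  shows "(\<integral>\<xi>. fourier_int f \<xi> * g \<xi> \<partial>lborel) = (\<integral>x. f x * fourier_int g x \<partial>lborel)"
proof -
  have [measurable]: "f \<in> borel_measurable borel" "g \<in> borel_measurable borel"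
    using f g by auto
  have I: "integrable (lborel \<Otimes>\<^sub>M lborel) (\<lambda>(x, \<xi>). f x * cis (- 2 * pi * (x \<bullet> \<xi>)) * g \<xi>)"
    by (rule Bochner_Integration.integrable_bound[OF integrable_lborel_pair_mult[OF f g]])
       (auto simp: norm_mult case_prod_beta)
  have "(\<integral>\<xi>. fourier_int f \<xi> * g \<xi> \<partial>lborel)
      = (\<integral>\<xi>. \<integral>x. f x * cis (- 2 * pi * (x \<bullet> \<xi>)) * g \<xi> \<partial>lborel \<partial>lborel)"
    unfolding fourier_int_def by simp
  also have "\<dots> = (\<integral>x. \<integral>\<xi>. f x * cis (- 2 * pi * (x \<bullet> \<xi>)) * g \<xi> \<partial>lborel \<partial>lborel)"
    using lborel_pair.Fubini_integral[OF I] .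
  also have "\<dots> = (\<integral>x. f x * fourier_int g x \<partial>lborel)"
  proof (intro Bochner_Integration.integral_cong refl)
    fix x
    have "(\<integral>\<xi>. f x * cis (- 2 * pi * (x \<bullet> \<xi>)) * g \<xi> \<partial>lborel)
       = (\<integral>\<xi>. f x * (g \<xi> * cis (- 2 * pi * (\<xi> \<bullet> x))) \<partial>lborel)"
      by (simp add: inner_commute mult_ac)
    then show "(\<integral>\<xi>. f x * cis (- 2 * pi * (x \<bullet> \<xi>)) * g \<xi> \<partial>lborel) = f x * fourier_int g x"
      unfolding fourier_int_def by simp
  qed
  finally show ?thesis .
qed

section \<open>Convolution, Gaussians and the Plancherel inequality\<close>

definition fconv :: "(real^2 \<Rightarrow> complex) \<Rightarrow> (real^2 \<Rightarrow> complex) \<Rightarrow> real^2 \<Rightarrow> complex" where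
  "fconv f g z = (\<integral>y. f y * g (z - y) \<partial>lborel)"

lemma fconv_measurable [measurable]:
  assumes [measurable]: "f \<in> borel_measurable borel" "g \<in> borel_measurable borel"
  shows "fconv f g \<in> borel_measurable borel"
proof -
  have "(\<lambda>z. \<integral>y. f y * g (z - y) \<partial>lborel) \<in> borel_measurable borel"
    by measurable
  then show ?thesis unfolding fconv_def[abs_def] .
qed

lemma
  assumes f: "integrable lborel f" and g: "integrable lborel g"
  shows integrable_fconv: "integrable lborel (fconv f g)"
    and fourier_int_fconv: "fourier_int (fconv f g) \<xi> = fourier_int f \<xi> * fourier_int g \<xi>"
proof -
  have [measurable]: "f \<in> borel_measurable borel" "g \<in> borel_measurable borel"
    using f g by auto
  have I: "integrable (lborel \<Otimes>\<^sub>M lborel) (\<lambda>(y, z). f y * g (z - y))"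
  proof (rule lborel_pair.Fubini_integrable)
    have "(\<integral>z. norm (g (z - y)) \<partial>lborel) = (\<integral>z. norm (g z) \<partial>lborel)" for y
      using integral_lborel_translate[of "\<lambda>z. norm (g z)" "-y"] by simp
    then show "integrable lborel (\<lambda>x. \<integral>y. norm (case (x, y) of (y, z) \<Rightarrow> f y * g (z - y)) \<partial>lborel)"
      using f by (simp add: norm_mult)
    have "integrable lborel (\<lambda>z. g (z - y))" for y
      using integrable_lborel_translate[of g "-y"] g by simp
    then show "AE x in lborel. integrable lborel (\<lambda>y. case (x, y) of (y, z) \<Rightarrow> f y * g (z - y))"
      by simp
  qed measurable
  show "integrable lborel (fconv f g)"
    unfolding fconv_def[abs_def] by (rule lborel_pair.integrable_snd[OF I])
  let ?e = "\<lambda>x. cis (- 2 * pi * (x \<bullet> \<xi>))"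
  have I2: "integrable (lborel \<Otimes>\<^sub>M lborel) (\<lambda>(y, z). f y * g (z - y) * ?e z)"
    by (rule Bochner_Integration.integrable_bound[OF I]) (auto simp: norm_mult case_prod_beta)
  have "fourier_int (fconv f g) \<xi> = (\<integral>z. \<integral>y. f y * g (z - y) * ?e z \<partial>lborel \<partial>lborel)"
    unfolding fourier_int_def fconv_def by simp
  also have "\<dots> = (\<integral>y. \<integral>z. f y * g (z - y) * ?e z \<partial>lborel \<partial>lborel)"
    using lborel_pair.Fubini_integral[OF I2] .
  also have "\<dots> = (\<integral>y. f y * ?e y * fourier_int g \<xi> \<partial>lborel)"
  proof (intro Bochner_Integration.integral_cong refl)
    fix y
    have "(\<integral>z. f y * g (z - y) * ?e z \<partial>lborel) = (\<integral>z. f y * g ((z + y) - y) * ?e (z + y) \<partial>lborel)"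
      by (rule integral_lborel_translate[symmetric]) measurable
    also have "\<dots> = (\<integral>z. (f y * ?e y) * (g z * ?e z) \<partial>lborel)"
      by (intro Bochner_Integration.integral_cong refl)
         (simp add: inner_add_left distrib_left cis_mult algebra_simps)
    finally show "(\<integral>z. f y * g (z - y) * ?e z \<partial>lborel) = f y * ?e y * fourier_int g \<xi>"
      unfolding fourier_int_def by simp
  qed
  also have "\<dots> = fourier_int f \<xi> * fourier_int g \<xi>"
    unfolding fourier_int_def by simp
  finally show "fourier_int (fconv f g) \<xi> = fourier_int f \<xi> * fourier_int g \<xi>" .
qed

text \<open>Up to scaling this is the characteristic function of the standard normal distribution:
  the variable is rescaled by \<open>a\<close> and the frequency by \<open>1 / a\<close>.\<close>

lemma gaussian_fourier_real:
  fixes a t :: real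
  assumes a: "a > 0"
  shows "integrable lborel (\<lambda>x. complex_of_real (exp (- (a * x)\<^sup>2 / 2)) * cis (t * x))"
    and "(\<integral>x. complex_of_real (exp (- (a * x)\<^sup>2 / 2)) * cis (t * x) \<partial>lborel)
           = complex_of_real (sqrt (2 * pi) / a * exp (- (t / a)\<^sup>2 / 2))"
proof -
  have cis: "cis r = iexp r" for r by (simp add: cis_conv_exp)
  have J: "integrable lborel (\<lambda>x. complex_of_real (std_normal_density x) * cis (s * x))" for s
  proof (rule Bochner_Integration.integrable_bound[OF integrable_normal_density[of 1 0]])
    show "(\<lambda>x. complex_of_real (std_normal_density x) * cis (s * x)) \<in> borel_measurable lborel"
      unfolding cis by measurable
  qed (auto simp: norm_mult)
  have E: "(\<integral>x. complex_of_real (std_normal_density x) * cis (s * x) \<partial>lborel) = exp (- (s^2) / 2)" for s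
  proof -
    have "char std_normal_distribution s = (\<integral>x. std_normal_density x *\<^sub>R iexp (s * x) \<partial>lborel)"
      unfolding char_def by (subst integral_density) (auto)
    then show ?thesis unfolding cis by (simp add: char_std_normal_distribution scaleR_conv_of_real)
  qed
  have eq: "complex_of_real (exp (- (a * x)\<^sup>2 / 2)) * cis (t * x)
     = sqrt (2 * pi) * (complex_of_real (std_normal_density (0 + a * x)) * cis ((t / a) * (0 + a * x)))" for x
    using a by (simp add: std_normal_density_def flip: of_real_mult)
  show "integrable lborel (\<lambda>x. complex_of_real (exp (- (a * x)\<^sup>2 / 2)) * cis (t * x))"
    unfolding eq using lborel_integrable_real_affine[OF J[of "t/a"], of a 0] a by simp
  have "(\<integral>x. complex_of_real (exp (- (a * x)\<^sup>2 / 2)) * cis (t * x) \<partial>lborel)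
      = sqrt (2 * pi) * (\<integral>x. (complex_of_real (std_normal_density (0 + a * x)) * cis ((t / a) * (0 + a * x))) \<partial>lborel)"
    unfolding eq by simp
  also have "(\<integral>x. (complex_of_real (std_normal_density (0 + a * x)) * cis ((t / a) * (0 + a * x))) \<partial>lborel)
     = (1 / a) *\<^sub>R exp (- ((t/a)^2) / 2)"
    using lborel_integral_real_affine[of a "\<lambda>x. complex_of_real (std_normal_density x) * cis (t / a * x)" 0] a
    by (simp add: E[of "t/a", simplified] scaleR_conv_of_real)

  finally show "(\<integral>x. complex_of_real (exp (- (a * x)\<^sup>2 / 2)) * cis (t * x) \<partial>lborel)
           = complex_of_real (sqrt (2 * pi) / a * exp (- (t / a)\<^sup>2 / 2))"
    by (simp add: scaleR_conv_of_real)
qed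

lemma inner_vec2: "(x::real^2) \<bullet> y = x $ 1 * y $ 1 + x $ 2 * y $ 2"
  by (simp add: inner_vec_def UNIV_2)

lemma gaussian_vec2:
  fixes a :: real
  assumes a: "a > 0"
  shows "integrable lborel (\<lambda>x::real^2. complex_of_real (exp (- a\<^sup>2 * (x \<bullet> x) / 2)))"
    and "fourier_int (\<lambda>x. complex_of_real (exp (- a\<^sup>2 * (x \<bullet> x) / 2))) \<xi>
      = complex_of_real (2 * pi / a\<^sup>2 * exp (- (2 * pi / a)\<^sup>2 * (\<xi> \<bullet> \<xi>) / 2))"
proof -
  let ?g = "\<lambda>x. complex_of_real (exp (- (a * x)\<^sup>2 / 2))"
  have eq: "complex_of_real (exp (- a\<^sup>2 * (x \<bullet> x) / 2)) * cis (- 2 * pi * (x \<bullet> \<xi>))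
    = (?g (x $ 1) * cis (- 2 * pi * \<xi> $ 1 * x $ 1)) * (?g (x $ 2) * cis (- 2 * pi * \<xi> $ 2 * x $ 2))" for x \<xi> :: "real^2"
  proof -
    have "exp (- a\<^sup>2 * (x \<bullet> x) / 2) = exp (- (a * x $ 1)\<^sup>2 / 2) * exp (- (a * x $ 2)\<^sup>2 / 2)"
      by (simp add: exp_add[symmetric] inner_vec2 field_simps power2_eq_square)
    moreover have "cis (- 2 * pi * (x \<bullet> \<xi>)) = cis (- 2 * pi * \<xi> $ 1 * x $ 1) * cis (- 2 * pi * \<xi> $ 2 * x $ 2)"
      by (simp add: cis_mult inner_vec2 algebra_simps)
    ultimately show ?thesis by simp
  qed
  note int = gaussian_fourier_real[OF a]
  show "integrable lborel (\<lambda>x::real^2. complex_of_real (exp (- a\<^sup>2 * (x \<bullet> x) / 2)))"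
    using integrable_vec2_mult[OF int(1)[of "- 2 * pi * (0::real^2) $ 1"] int(1)[of "- 2 * pi * (0::real^2) $ 2"]]
      eq[of _ 0] by simp
  have "fourier_int (\<lambda>x. complex_of_real (exp (- a\<^sup>2 * (x \<bullet> x) / 2))) \<xi>
     = complex_of_real (sqrt (2 * pi) / a * exp (- (- 2 * pi * \<xi> $ 1 / a)\<^sup>2 / 2)) *
       complex_of_real (sqrt (2 * pi) / a * exp (- (- 2 * pi * \<xi> $ 2 / a)\<^sup>2 / 2))"
    unfolding fourier_int_def eq by (subst integral_vec2_mult[OF int(1) int(1)]) (simp only: int(2))
  also have "\<dots> = complex_of_real ((sqrt (2 * pi) * sqrt (2 * pi)) / a\<^sup>2 * (exp (- (- 2 * pi * \<xi> $ 1 / a)\<^sup>2 / 2) * exp (- (- 2 * pi * \<xi> $ 2 / a)\<^sup>2 / 2)))"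
    unfolding of_real_mult[symmetric] of_real_eq_iff by (simp add: power2_eq_square)
  also have "exp (- (- 2 * pi * \<xi> $ 1 / a)\<^sup>2 / 2) * exp (- (- 2 * pi * \<xi> $ 2 / a)\<^sup>2 / 2) = exp (- (2 * pi / a)\<^sup>2 * (\<xi> \<bullet> \<xi>) / 2)"
    using a by (simp add: exp_add[symmetric] inner_vec2 divide_simps power2_eq_square) (simp add: algebra_simps)
  finally show "fourier_int (\<lambda>x. complex_of_real (exp (- a\<^sup>2 * (x \<bullet> x) / 2))) \<xi>
      = complex_of_real (2 * pi / a\<^sup>2 * exp (- (2 * pi / a)\<^sup>2 * (\<xi> \<bullet> \<xi>) / 2))"
    by simp
qed

lemma fourier_int_cnj_reflect:
  "fourier_int (\<lambda>x. cnj (k (- x))) \<xi> = cnj (fourier_int k \<xi>)" if [measurable]: "k \<in> borel_measurable borel"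
proof -
  have "fourier_int (\<lambda>x. cnj (k (- x))) \<xi> = (\<integral>x. cnj (k (0 - x) * cis (- 2 * pi * ((0 - x) \<bullet> \<xi>))) \<partial>lborel)"
    unfolding fourier_int_def by (simp add: cis_cnj)
  also have "\<dots> = cnj (\<integral>x. k (0 - x) * cis (- 2 * pi * ((0 - x) \<bullet> \<xi>)) \<partial>lborel)"
    by (rule Bochner_Integration.integral_cnj)
  also have "\<dots> = cnj (fourier_int k \<xi>)"
    unfolding fourier_int_def
    by (subst integral_lborel_reflect[where g="\<lambda>x. k x * cis (- 2 * pi * (x \<bullet> \<xi>))"]) measurable
  finally show ?thesis .
qed

text \<open>The transform of the autocorrelation \<open>q\<close> of \<open>k\<close> is \<open>\<bar>k^\<bar>\<^sup>2\<close>, while \<open>\<bar>q\<bar>\<close> is bounded by the square of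
  the \<open>L\<^sup>2\<close> norm of \<open>k\<close>; pairing with Gaussians that increase to 1 gives the inequality.\<close>

lemma plancherel_le:
  fixes k :: "real^2 \<Rightarrow> complex"
  assumes k: "integrable lborel k" and k2: "integrable lborel (\<lambda>x. (norm (k x))\<^sup>2)"
  shows "(\<integral>\<^sup>+\<xi>. ennreal ((norm (fourier_int k \<xi>))\<^sup>2) \<partial>lborel) \<le> ennreal (\<integral>x. (norm (k x))\<^sup>2 \<partial>lborel)"
proof -
  have [measurable]: "k \<in> borel_measurable borel" using k by auto
  define q where "q = fconv k (\<lambda>x. cnj (k (- x)))"
  let ?L = "\<integral>x. (norm (k x))\<^sup>2 \<partial>lborel"
  have kt: "integrable lborel (\<lambda>x. cnj (k (- x)))"
    using integrable_lborel_reflect[of k 0] k by simp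
  have q: "integrable lborel q" unfolding q_def by (rule integrable_fconv[OF k kt])
  have qf: "fourier_int q \<xi> = complex_of_real ((norm (fourier_int k \<xi>))\<^sup>2)" for \<xi>
    unfolding q_def by (simp add: fourier_int_fconv[OF k kt] fourier_int_cnj_reflect complex_norm_square[symmetric] del: of_real_power)
  have qb: "norm (q z) \<le> ?L" for z
  proof -
    have kz: "integrable lborel (\<lambda>y. (norm (k (y - z)))\<^sup>2)"
      using integrable_lborel_translate[of "\<lambda>y. (norm (k y))\<^sup>2" "-z"] k2 by simp
    have kz2: "(\<integral>y. (norm (k (y - z)))\<^sup>2 \<partial>lborel) = ?L"
      using integral_lborel_translate[of "\<lambda>y. (norm (k y))\<^sup>2" "-z"] by simp
    have "norm (q z) \<le> (\<integral>y. norm (k y) * norm (k (y - z)) \<partial>lborel)"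
      unfolding q_def fconv_def by (rule order_trans[OF integral_norm_bound]) (simp add: norm_mult)
    \<comment> \<open>The arithmetic-geometric mean inequality replaces Cauchy-Schwarz without loss,
      because by translation invariance both squares integrate to \<open>?L\<close>.\<close>
    also have "\<dots> \<le> (\<integral>y. ((norm (k y))\<^sup>2 + (norm (k (y - z)))\<^sup>2) / 2 \<partial>lborel)"
    proof (rule integral_mono)
      fix y
      show le: "norm (k y) * norm (k (y - z)) \<le> ((norm (k y))\<^sup>2 + (norm (k (y - z)))\<^sup>2) / 2" for y
        using sum_squares_bound[of "norm (k y)" "norm (k (y - z))"] by simp
      show i: "integrable lborel (\<lambda>y. ((norm (k y))\<^sup>2 + (norm (k (y - z)))\<^sup>2) / 2)"
        using k2 kz by simp
      show "integrable lborel (\<lambda>y. norm (k y) * norm (k (y - z)))"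
        by (rule Bochner_Integration.integrable_bound[OF i])
           (measurable, use le in \<open>auto intro: order_trans\<close>)
    qed
    also have "\<dots> = ?L" using k2 kz by (simp add: kz2)
    finally show ?thesis .
  qed
  define g where "g a x = exp (- a\<^sup>2 * (x \<bullet> x) / 2)" for a :: real and x :: "real^2"
  have [measurable]: "g a \<in> borel_measurable borel" for a unfolding g_def by measurable
  have gi: "integrable lborel (\<lambda>x. complex_of_real (g a x))" if "a > 0" for a
    unfolding g_def by (rule gaussian_vec2(1)[OF that])
  have gf: "fourier_int (\<lambda>x. complex_of_real (g a x)) \<xi> = complex_of_real (2 * pi / a\<^sup>2 * g (2 * pi / a) \<xi>)" if "a > 0" for a \<xi>
    unfolding g_def by (rule gaussian_vec2(2)[OF that])
  have gi': "integrable lborel (g a)" if "a > 0" for a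
    using integrable_Re[OF gi[OF that]] by simp
  have gint: "(\<integral>x. g a x \<partial>lborel) = 2 * pi / a\<^sup>2" if "a > 0" for a
  proof -
    have "complex_of_real (\<integral>x. g a x \<partial>lborel) = fourier_int (\<lambda>x. complex_of_real (g a x)) 0"
      unfolding fourier_int_def by simp
    then show ?thesis unfolding gf[OF that] of_real_eq_iff by (simp add: g_def[of _ 0])
  qed
  have key: "(\<integral>\<^sup>+\<xi>. ennreal ((norm (fourier_int k \<xi>))\<^sup>2 * g a \<xi>) \<partial>lborel) \<le> ennreal ?L" if a: "a > 0" for a
  proof -
    let ?b = "2 * pi / a"
    have b: "?b > 0" using a by simp
    have nn: "0 \<le> 2 * pi / a\<^sup>2 * g ?b x" for x by (simp add: g_def)
    have I: "integrable lborel (\<lambda>\<xi>. (norm (fourier_int k \<xi>))\<^sup>2 * g a \<xi>)"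
    proof (rule Bochner_Integration.integrable_bound)
      show "integrable lborel (\<lambda>\<xi>. (\<integral>x. norm (k x) \<partial>lborel)\<^sup>2 * g a \<xi>)"
        using gi'[OF a] by simp
      show "AE x in lborel. norm ((norm (fourier_int k x))\<^sup>2 * g a x) \<le> norm ((LBINT x. norm (k x))\<^sup>2 * g a x)"
        by (auto simp: g_def norm_fourier_int_le abs_mult intro!: power_mono)
    qed measurable
    have "complex_of_real (\<integral>\<xi>. (norm (fourier_int k \<xi>))\<^sup>2 * g a \<xi> \<partial>lborel) = (\<integral>\<xi>. fourier_int q \<xi> * complex_of_real (g a \<xi>) \<partial>lborel)"
      unfolding qf by (subst integral_complex_of_real[symmetric]) simp
    also have "\<dots> = (\<integral>x. q x * complex_of_real (2 * pi / a\<^sup>2 * g ?b x) \<partial>lborel)"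
      by (subst fourier_int_multiplication[OF q gi[OF a]]) (simp only: gf[OF a])
    finally have "norm (complex_of_real (\<integral>\<xi>. (norm (fourier_int k \<xi>))\<^sup>2 * g a \<xi> \<partial>lborel)) = norm (\<integral>x. q x * complex_of_real (2 * pi / a\<^sup>2 * g ?b x) \<partial>lborel)"
      by (rule arg_cong)
    then have "\<bar>\<integral>\<xi>. (norm (fourier_int k \<xi>))\<^sup>2 * g a \<xi> \<partial>lborel\<bar> = norm (\<integral>x. q x * complex_of_real (2 * pi / a\<^sup>2 * g ?b x) \<partial>lborel)"
      by (simp only: norm_of_real)
    also have "\<dots> \<le> (\<integral>x. norm (q x) * (2 * pi / a\<^sup>2 * g ?b x) \<partial>lborel)"
      by (rule order_trans[OF integral_norm_bound]) (simp only: norm_mult norm_of_real abs_of_nonneg[OF nn] order_refl)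
    also have "\<dots> \<le> (\<integral>x. ?L * (2 * pi / a\<^sup>2 * g ?b x) \<partial>lborel)"
    proof (rule integral_mono)
      show i: "integrable lborel (\<lambda>x. ?L * (2 * pi / a\<^sup>2 * g ?b x))" using gi'[OF b] by simp
      show le: "norm (q x) * (2 * pi / a\<^sup>2 * g ?b x) \<le> ?L * (2 * pi / a\<^sup>2 * g ?b x)" for x
        by (rule mult_right_mono[OF qb]) (simp add: g_def)
      show "integrable lborel (\<lambda>x. norm (q x) * (2 * pi / a\<^sup>2 * g ?b x))"
        by (rule Bochner_Integration.integrable_bound[OF i]) (use q le in \<open>auto simp: g_def\<close>)
    qed
    \<comment> \<open>At the dual width \<open>2 * pi / a\<close>, \<open>gint\<close> gives the
      integral \<open>a\<^sup>2 / (2 * pi)\<close>, so the transformed Gaussian has mass 1.\<close>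
    also have "\<dots> = ?L" using gint[OF b] a by (simp add: power2_eq_square field_simps)
    finally have "(\<integral>\<xi>. (norm (fourier_int k \<xi>))\<^sup>2 * g a \<xi> \<partial>lborel) \<le> ?L" by simp
    then show ?thesis
      by (subst nn_integral_eq_integral[OF I]) (auto simp: g_def intro: ennreal_leI)
  qed
  have "(\<integral>\<^sup>+\<xi>. ennreal ((norm (fourier_int k \<xi>))\<^sup>2) \<partial>lborel)
      = (\<integral>\<^sup>+\<xi>. liminf (\<lambda>n. ennreal ((norm (fourier_int k \<xi>))\<^sup>2 * g (1 / Suc n) \<xi>)) \<partial>lborel)"
  proof (intro nn_integral_cong)
    fix \<xi>
    have "(\<lambda>n. ennreal ((norm (fourier_int k \<xi>))\<^sup>2 * exp (- (1 / real (Suc n))\<^sup>2 * (\<xi> \<bullet> \<xi>) / 2)))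
        \<longlonglongrightarrow> ennreal ((norm (fourier_int k \<xi>))\<^sup>2 * exp (- 0\<^sup>2 * (\<xi> \<bullet> \<xi>) / 2))"
      by (intro tendsto_intros LIMSEQ_Suc[OF lim_1_over_n]) simp
    then have "(\<lambda>n. ennreal ((norm (fourier_int k \<xi>))\<^sup>2 * g (1 / Suc n) \<xi>))
        \<longlonglongrightarrow> ennreal ((norm (fourier_int k \<xi>))\<^sup>2)"
      unfolding g_def by simp
    then show "ennreal ((norm (fourier_int k \<xi>))\<^sup>2) = liminf (\<lambda>n. ennreal ((norm (fourier_int k \<xi>))\<^sup>2 * g (1 / Suc n) \<xi>))"
      using lim_imp_Liminf[OF sequentially_bot] by fastforce
  qed
  also have "\<dots> \<le> liminf (\<lambda>n. \<integral>\<^sup>+\<xi>. ennreal ((norm (fourier_int k \<xi>))\<^sup>2 * g (1 / Suc n) \<xi>) \<partial>lborel)"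
    by (rule nn_integral_liminf) measurable
  also have "\<dots> \<le> liminf (\<lambda>n::nat. ennreal ?L)"
    by (intro Liminf_mono always_eventually allI key) simp
  also have "\<dots> = ennreal ?L" by (simp add: Liminf_const)
  finally show ?thesis .
qed

section \<open>Gaussian-dominated functions\<close>

lemma power_le_fact_exp:
  fixes u :: real assumes "u \<ge> 0"
  shows "u ^ m \<le> fact m * exp u"
proof -
  have "(\<Sum>i\<in>{m}. u ^ i /\<^sub>R fact i) \<le> (\<Sum>i. u ^ i /\<^sub>R fact i)"
    using assms by (intro sum_le_suminf summable_exp_generic) auto
  then have "u ^ m / fact m \<le> exp u" by (simp add: exp_def divide_inverse mult.commute)
  then show ?thesis by (simp add: field_simps)
qed

lemma poly_bound_power:
  fixes P :: "real poly"
  shows "\<exists>C n. C \<ge> 0 \<and> (\<forall>t. \<bar>poly P t\<bar> \<le> C * (1 + \<bar>t\<bar>) ^ n)"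
proof (induction P)
  case 0
  show ?case by (intro exI[of _ 0]) simp
next
  case (pCons a P)
  then obtain C n where C: "C \<ge> 0" "\<And>t. \<bar>poly P t\<bar> \<le> C * (1 + \<bar>t\<bar>) ^ n" by blast
  show ?case
  proof (intro exI[of _ "\<bar>a\<bar> + C"] exI[of _ "Suc n"] conjI allI)
    fix t :: real
    have 1: "1 \<le> (1 + \<bar>t\<bar>) ^ Suc n" by (rule one_le_power) simp
    have "\<bar>poly (pCons a P) t\<bar> \<le> \<bar>a\<bar> + \<bar>t\<bar> * \<bar>poly P t\<bar>"
      by (simp add: abs_mult[symmetric] abs_triangle_ineq)
    also have "\<dots> \<le> \<bar>a\<bar> * (1 + \<bar>t\<bar>) ^ Suc n + (1 + \<bar>t\<bar>) * (C * (1 + \<bar>t\<bar>) ^ n)"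
      using 1 C by (intro add_mono mult_mono) (auto simp: mult_le_cancel_left1)
    finally show "\<bar>poly (pCons a P) t\<bar> \<le> (\<bar>a\<bar> + C) * (1 + \<bar>t\<bar>) ^ Suc n"
      by (simp add: algebra_simps)
  qed (use C in simp)
qed

lemma poly_exp_rapid_decay:
  fixes A P :: "real poly"
  assumes A: "\<And>t. t\<^sup>2 \<le> poly A t"
  shows "\<exists>C\<ge>0. \<forall>t. (1 + \<bar>t\<bar>) ^ N * \<bar>poly P t * exp (- poly A t)\<bar> \<le> C"
proof -
  obtain C n where C: "C \<ge> 0" "\<And>t. \<bar>poly P t\<bar> \<le> C * (1 + \<bar>t\<bar>) ^ n"
    using poly_bound_power by blast
  show ?thesis
  proof (intro exI[of _ "C * fact (N + n) * exp 2"] conjI allI)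
    fix t :: real
    \<comment> \<open>The quadratic exponent is traded for a linear one:
      \<open>1 + \<bar>t\<bar> \<le> poly A t + 2\<close>, which is the origin of the factor
      \<open>exp 2\<close>.\<close>
    have "\<bar>t\<bar> - 1 \<le> t\<^sup>2"
      using zero_le_power2[of "\<bar>t\<bar> - 1"] by (simp add: power2_diff)
    then have e: "exp (- poly A t) \<le> exp 2 * exp (- (1 + \<bar>t\<bar>))"
      using A[of t] by (simp add: exp_add[symmetric])
    have "(1 + \<bar>t\<bar>) ^ N * \<bar>poly P t * exp (- poly A t)\<bar>
      \<le> (1 + \<bar>t\<bar>) ^ N * (C * (1 + \<bar>t\<bar>) ^ n * (exp 2 * exp (- (1 + \<bar>t\<bar>))))"
      unfolding abs_mult using C e by (intro mult_left_mono mult_mono) auto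
    also have "\<dots> = C * exp 2 * ((1 + \<bar>t\<bar>) ^ (N + n) * exp (- (1 + \<bar>t\<bar>)))"
      by (simp add: power_add)
    also have "\<dots> \<le> C * exp 2 * (fact (N + n))"
    proof (intro mult_left_mono)
      have "(1 + \<bar>t\<bar>) ^ (N + n) * exp (- (1 + \<bar>t\<bar>)) \<le> fact (N + n) * exp (1 + \<bar>t\<bar>) * exp (- (1 + \<bar>t\<bar>))"
        by (intro mult_right_mono power_le_fact_exp) auto
      then show "(1 + \<bar>t\<bar>) ^ (N + n) * exp (- (1 + \<bar>t\<bar>)) \<le> fact (N + n)"
        unfolding mult.assoc exp_add[symmetric] by simp
    qed (use C in simp)
    finally show "(1 + \<bar>t\<bar>) ^ N * \<bar>poly P t * exp (- poly A t)\<bar> \<le> C * fact (N + n) * exp 2"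
      by (simp add: mult_ac)
  qed (use C in simp)
qed

text \<open>The witnessing family consists of products of two one-variable factors, each a
  polynomial times the fixed exponential. Differentiation replaces the polynomial \<open>P\<close>
  by \<open>pderiv P - P * pderiv A\<close>, so the family is closed under partial
  derivatives.\<close>

lemma schwartz_exp_poly:
  fixes A B :: "real poly"
  assumes A: "\<And>t. t\<^sup>2 \<le> poly A t" and B: "\<And>t. t\<^sup>2 \<le> poly B t"
  shows "schwartz (\<lambda>x. complex_of_real (exp (- poly A (x $ 1) - poly B (x $ 2))))"
proof -
  define e where "e A P t = poly P t * exp (- poly A t)" for A P :: "real poly" and t :: real
  define S where "S = {g. \<exists>P Q. g = (\<lambda>x::real^2. complex_of_real (e A P (x $ 1) * e B Q (x $ 2)))}"
  have de: "(e A P has_field_derivative e A (pderiv P - P * pderiv A) t) (at t)" for A P t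
    unfolding e_def by (auto intro!: derivative_eq_intros simp: algebra_simps)
  have dec: "\<exists>C\<ge>0. \<forall>t. (1 + \<bar>t\<bar>) ^ N * \<bar>e A P t\<bar> \<le> C" if "\<And>t. t\<^sup>2 \<le> poly A t" for A P N
    using poly_exp_rapid_decay[OF that] unfolding e_def .
  show ?thesis
    unfolding schwartz_def
  proof (intro exI[of _ S] conjI ballI allI)
    show "(\<lambda>x. complex_of_real (exp (- poly A (x $ 1) - poly B (x $ 2)))) \<in> S"
      unfolding S_def e_def by (intro CollectI exI[of _ 1] ext) (simp add: exp_diff exp_minus divide_inverse)
  next
    fix g assume "g \<in> S"
    then obtain P Q where g: "g = (\<lambda>x. complex_of_real (e A P (x $ 1) * e B Q (x $ 2)))"
      unfolding S_def by blast
    define P' where "P' = pderiv P - P * pderiv A"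
    define Q' where "Q' = pderiv Q - Q * pderiv B"
    define D where "D x h = complex_of_real (e A P (x $ 1) * (e B Q' (x $ 2) * h $ 2) + e A P' (x $ 1) * h $ 1 * e B Q (x $ 2))"
      for x h :: "real^2"
    show "\<exists>D. (\<forall>x. (g has_derivative D x) (at x)) \<and> (\<forall>i. (\<lambda>x. D x (axis i 1)) \<in> S)"
    proof (intro exI[of _ D] conjI allI)
      fix x :: "real^2"
      have pr: "((\<lambda>x::real^2. x $ i) has_derivative (\<lambda>h. h $ i)) (at x)" for i
        by (rule bounded_linear.has_derivative[OF bounded_linear_vec_nth]) (rule has_derivative_ident)
      have a: "((\<lambda>x::real^2. e A P (x $ 1)) has_derivative (\<lambda>h. e A P' (x $ 1) * h $ 1)) (at x)"
        using has_derivative_compose[OF pr de[of A P "x $ 1", unfolded has_field_derivative_def]] unfolding P'_def .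
      have b: "((\<lambda>x::real^2. e B Q (x $ 2)) has_derivative (\<lambda>h. e B Q' (x $ 2) * h $ 2)) (at x)"
        using has_derivative_compose[OF pr de[of B Q "x $ 2", unfolded has_field_derivative_def]] unfolding Q'_def .
      show "(g has_derivative D x) (at x)"
        unfolding g D_def by (intro has_derivative_of_real has_derivative_mult a b)
    next
      fix i :: 2
      show "(\<lambda>x. D x (axis i 1)) \<in> S"
        using exhaust_2[of i]
      proof
        assume "i = 1"
        then show ?thesis unfolding S_def D_def
          by (intro CollectI exI[of _ P'] exI[of _ Q]) (simp add: axis_def)
      next
        assume "i = 2"
        then show ?thesis unfolding S_def D_def
          by (intro CollectI exI[of _ P] exI[of _ Q']) (simp add: axis_def)
      qed
    qed
    fix N :: nat
    obtain C1 where C1: "C1 \<ge> 0" "\<And>t. (1 + \<bar>t\<bar>) ^ N * \<bar>e A P t\<bar> \<le> C1" using dec[OF A] by blast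
    obtain C2 where C2: "C2 \<ge> 0" "\<And>t. (1 + \<bar>t\<bar>) ^ N * \<bar>e B Q t\<bar> \<le> C2" using dec[OF B] by blast
    show "\<exists>C. \<forall>x. (1 + norm x) ^ N * norm (g x) \<le> C"
    proof (intro exI[of _ "C1 * C2"] allI)
      fix x :: "real^2"
      have "norm x \<le> \<bar>x $ 1\<bar> + \<bar>x $ 2\<bar>"
        using norm_le_l1_cart[of x] by (simp add: UNIV_2)
      moreover have "0 \<le> \<bar>x $ 1\<bar> * \<bar>x $ 2\<bar>" by simp
      \<comment> \<open>The cross term is nonnegative, so the weight is dominated by a product with
        one factor per coordinate.\<close>
      ultimately have "1 + norm x \<le> (1 + \<bar>x $ 1\<bar>) * (1 + \<bar>x $ 2\<bar>)"
        unfolding distrib_left distrib_right by linarith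
      then have "(1 + norm x) ^ N \<le> (1 + \<bar>x $ 1\<bar>) ^ N * (1 + \<bar>x $ 2\<bar>) ^ N"
        unfolding power_mult_distrib[symmetric] by (intro power_mono) auto
      then have "(1 + norm x) ^ N * norm (g x) \<le> ((1 + \<bar>x $ 1\<bar>) ^ N * (1 + \<bar>x $ 2\<bar>) ^ N) * norm (g x)"
        by (rule mult_right_mono) simp
      also have "\<dots> = ((1 + \<bar>x $ 1\<bar>) ^ N * \<bar>e A P (x $ 1)\<bar>) * ((1 + \<bar>x $ 2\<bar>) ^ N * \<bar>e B Q (x $ 2)\<bar>)"
        unfolding g by (simp add: abs_mult norm_mult)
      also have "\<dots> \<le> C1 * C2"
        using C1 C2 by (intro mult_mono) auto
      finally show "(1 + norm x) ^ N * norm (g x) \<le> C1 * C2" .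
    qed
  qed
qed

lemma schwartz_lincomb:
  assumes "schwartz f" "schwartz g"
  shows "schwartz (\<lambda>x. a * f x + g x)"
proof -
  obtain S where S: "f \<in> S" "\<And>g. g \<in> S \<Longrightarrow> \<exists>D. (\<forall>x. (g has_derivative D x) (at x)) \<and> (\<forall>i. (\<lambda>x. D x (axis i 1)) \<in> S)"
    "\<And>g N. g \<in> S \<Longrightarrow> \<exists>C. \<forall>x. (1 + norm x) ^ N * norm (g x) \<le> C"
    using assms(1) unfolding schwartz_def by blast
  obtain T where T: "g \<in> T" "\<And>g. g \<in> T \<Longrightarrow> \<exists>D. (\<forall>x. (g has_derivative D x) (at x)) \<and> (\<forall>i. (\<lambda>x. D x (axis i 1)) \<in> T)"
    "\<And>g N. g \<in> T \<Longrightarrow> \<exists>C. \<forall>x. (1 + norm x) ^ N * norm (g x) \<le> C"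
    using assms(2) unfolding schwartz_def by blast
  define U where "U = {k. \<exists>u\<in>S. \<exists>v\<in>T. k = (\<lambda>x. a * u x + v x)}"
  show ?thesis unfolding schwartz_def
  proof (intro exI[of _ U] conjI ballI allI)
    show "(\<lambda>x. a * f x + g x) \<in> U" unfolding U_def using S(1) T(1) by blast
  next
    fix k assume "k \<in> U"
    then obtain u v where uv: "u \<in> S" "v \<in> T" and k: "k = (\<lambda>x. a * u x + v x)" unfolding U_def by blast
    obtain D where D: "\<And>x. (u has_derivative D x) (at x)" "\<And>i. (\<lambda>x. D x (axis i 1)) \<in> S" using S(2)[OF uv(1)] by blast
    obtain E where E: "\<And>x. (v has_derivative E x) (at x)" "\<And>i. (\<lambda>x. E x (axis i 1)) \<in> T" using T(2)[OF uv(2)] by blast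
    show "\<exists>D. (\<forall>x. (k has_derivative D x) (at x)) \<and> (\<forall>i. (\<lambda>x. D x (axis i 1)) \<in> U)"
    proof (intro exI[of _ "\<lambda>x h. a * D x h + E x h"] conjI allI)
      show "(k has_derivative (\<lambda>h. a * D x h + E x h)) (at x)" for x
        unfolding k by (intro has_derivative_add has_derivative_mult_right D E)
      show "(\<lambda>x. a * D x (axis i 1) + E x (axis i 1)) \<in> U" for i
        unfolding U_def
        by (intro CollectI bexI[of _ "\<lambda>x. D x (axis i 1)"] bexI[of _ "\<lambda>x. E x (axis i 1)"] refl D(2) E(2))
    qed
    fix N
    obtain C1 where C1: "\<And>x. (1 + norm x) ^ N * norm (u x) \<le> C1" using S(3)[OF uv(1)] by blast
    obtain C2 where C2: "\<And>x. (1 + norm x) ^ N * norm (v x) \<le> C2" using T(3)[OF uv(2)] by blast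
    show "\<exists>C. \<forall>x. (1 + norm x) ^ N * norm (k x) \<le> C"
    proof (intro exI[of _ "norm a * C1 + C2"] allI)
      fix x
      have "norm (k x) \<le> norm a * norm (u x) + norm (v x)"
        unfolding k by (metis norm_mult norm_triangle_ineq)
      then have "(1 + norm x) ^ N * norm (k x) \<le> (1 + norm x) ^ N * (norm a * norm (u x) + norm (v x))"
        by (rule mult_left_mono) simp
      also have "\<dots> = norm a * ((1 + norm x) ^ N * norm (u x)) + (1 + norm x) ^ N * norm (v x)"
        by (simp add: algebra_simps)
      also have "\<dots> \<le> norm a * C1 + C2"
        by (intro add_mono mult_left_mono C1 C2) simp
      finally show "(1 + norm x) ^ N * norm (k x) \<le> norm a * C1 + C2" .
    qed
  qed
qed

text \<open>These functions approximate indicators of boxes and replace compactly supported bumps.\<close>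

lemma exp_neg_even_power_tendsto_indicator:
  fixes t :: real
  assumes "\<bar>t\<bar> \<noteq> 1"
  shows "(\<lambda>n. exp (- (t ^ (2 * Suc n)))) \<longlonglongrightarrow> indicator {-1<..<1} t"
proof (cases "\<bar>t\<bar> < 1")
  case True
  then have "t\<^sup>2 < 1" by (simp add: abs_square_less_1)
  then have "(\<lambda>n. (t\<^sup>2) ^ Suc n) \<longlonglongrightarrow> 0" by (intro LIMSEQ_Suc LIMSEQ_realpow_zero) auto
  then have "(\<lambda>n. exp (- ((t\<^sup>2) ^ Suc n))) \<longlonglongrightarrow> exp (- 0)" by (intro tendsto_intros)
  then show ?thesis using True unfolding power_mult by (simp add: indicator_def abs_less_iff)
next
  case False
  then have "1 < \<bar>t\<bar>" using assms by simp
  then have "1 < t\<^sup>2" using one_less_power[of "\<bar>t\<bar>" 2] by simp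
  moreover have "0 < (t\<^sup>2) ^ n" for n using \<open>1 < t\<^sup>2\<close> by (intro zero_less_power[of "t\<^sup>2"]) linarith
  ultimately have "filterlim (\<lambda>n. (t\<^sup>2) ^ n) at_top sequentially"
    by (intro filterlim_at_infinity_imp_filterlim_at_top filterlim_realpow_sequentially_gt1 always_eventually) auto
  then have "filterlim (\<lambda>n. (t\<^sup>2) ^ Suc n) at_top sequentially"
    by (rule filterlim_compose) (rule filterlim_Suc)
  then have "(\<lambda>n. exp (- ((t\<^sup>2) ^ Suc n))) \<longlonglongrightarrow> 0"
    by (intro filterlim_compose[OF exp_at_bot] filterlim_uminus_at_bot[THEN iffD2]) simp
  then show ?thesis using False unfolding power_mult by (auto simp: indicator_def)
qed

text \<open>This is the common majorant for test functions. It vanishes nowhere, so one may divide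
  by it, and it is Schwartz, so \<open>F * gauss\<close> is integrable for every distributional
  transform \<open>F\<close>.\<close>

definition gauss :: "real^2 \<Rightarrow> real" where "gauss x = exp (- (x \<bullet> x))"

lemma gauss_pos [simp]: "gauss x > 0" and gauss_nonneg [simp]: "gauss x \<ge> 0"
  by (simp_all add: gauss_def)

lemma gauss_measurable [measurable]: "gauss \<in> borel_measurable borel"
  unfolding gauss_def[abs_def] by measurable

lemma gauss_vec2: "gauss x = exp (- (x $ 1)\<^sup>2 - (x $ 2)\<^sup>2)"
  unfolding gauss_def by (simp add: inner_vec_def UNIV_2 power2_eq_square)

lemma gauss_le_1: "gauss x \<le> 1"
  by (simp add: gauss_def)

definition gauss_schwartz :: "(real^2 \<Rightarrow> complex) \<Rightarrow> bool" where
  "gauss_schwartz \<phi> \<longleftrightarrow> schwartz \<phi> \<and> \<phi> \<in> borel_measurable borel \<and> (\<exists>c. \<forall>x. norm (\<phi> x) \<le> c * gauss x)"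

lemma gauss_schwartz_exp_poly:
  fixes A B :: "real poly"
  assumes A: "\<And>t. t\<^sup>2 \<le> poly A t" and B: "\<And>t. t\<^sup>2 \<le> poly B t"
  shows "gauss_schwartz (\<lambda>x. complex_of_real (exp (- poly A (x $ 1) - poly B (x $ 2))))"
proof -
  have [measurable]: "(\<lambda>x. poly A x) \<in> borel_measurable borel" for A :: "real poly"
    by (intro borel_measurable_continuous_onI continuous_intros)
  have "norm (complex_of_real (exp (- poly A (x $ 1) - poly B (x $ 2)))) \<le> 1 * gauss x" for x
    using A[of "x $ 1"] B[of "x $ 2"] by (simp add: gauss_vec2 del: of_real_exp)
  moreover have "(\<lambda>x::real^2. complex_of_real (exp (- poly A (x $ 1) - poly B (x $ 2)))) \<in> borel_measurable borel"
    by measurable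
  ultimately show ?thesis
    unfolding gauss_schwartz_def using schwartz_exp_poly[OF A B] by blast
qed

lemma gauss_schwartz_gauss: "gauss_schwartz (\<lambda>x. complex_of_real (gauss x))"
proof -
  have "gauss_schwartz (\<lambda>x. complex_of_real (exp (- poly [:0, 0, 1:] (x $ 1) - poly [:0, 0, 1:] (x $ 2))))"
    by (rule gauss_schwartz_exp_poly) (auto simp: power2_eq_square)
  then show ?thesis by (simp add: gauss_vec2 power2_eq_square)
qed

lemma gauss_schwartz_lincomb:
  assumes "gauss_schwartz u" "gauss_schwartz v"
  shows "gauss_schwartz (\<lambda>x. a * u x + v x)"
proof -
  obtain c1 c2 where b: "\<And>x. norm (u x) \<le> c1 * gauss x" "\<And>x. norm (v x) \<le> c2 * gauss x"
    using assms unfolding gauss_schwartz_def by blast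
  have "norm (a * u x + v x) \<le> (norm a * c1 + c2) * gauss x" for x
  proof -
    have "norm (a * u x + v x) \<le> norm a * norm (u x) + norm (v x)" by (metis norm_mult norm_triangle_ineq)
    also have "\<dots> \<le> norm a * (c1 * gauss x) + c2 * gauss x" using b by (intro add_mono mult_left_mono) auto
    finally show ?thesis by (simp add: algebra_simps)
  qed
  then show ?thesis using assms schwartz_lincomb unfolding gauss_schwartz_def by auto
qed

text \<open>An induction principle: linear combinations and dominated almost everywhere limits lead
  from a class of explicit Schwartz functions to all Borel functions below a multiple of
  \<open>gauss\<close>. It serves twice, to extend the duality identity beyond Schwartz functions
  and to prove density in \<open>L\<^sup>p\<close>.\<close>

lemma gauss_dominated_induct:
  fixes h :: "real^2 \<Rightarrow> complex"
  assumes h [measurable]: "h \<in> borel_measurable borel" and hb: "\<And>x. norm (h x) \<le> c * gauss x"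
    and base: "\<And>A B::real poly. (\<And>t. t\<^sup>2 \<le> poly A t) \<Longrightarrow> (\<And>t. t\<^sup>2 \<le> poly B t) \<Longrightarrow>
        P (\<lambda>x. complex_of_real (exp (- poly A (x $ 1) - poly B (x $ 2))))"
    and lin: "\<And>a f g. P f \<Longrightarrow> P g \<Longrightarrow> P (\<lambda>x. a * f x + g x)"
    and lim: "\<And>u v C. (\<And>n::nat. P (u n)) \<Longrightarrow> (\<And>n x. norm (u n x) \<le> C * gauss x) \<Longrightarrow>
        v \<in> borel_measurable borel \<Longrightarrow> (AE x in lborel. (\<lambda>n. u n x) \<longlonglongrightarrow> v x) \<Longrightarrow> P v"
  shows "P h"
proof -
  let ?I = "\<lambda>A x. indicator A x * complex_of_real (gauss x)"
  have Pg: "P (\<lambda>x. complex_of_real (gauss x))"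
    using base[of "[:0, 0, 1:]" "[:0, 0, 1:]"] by (simp add: gauss_vec2 power2_eq_square)
  have P0: "P (\<lambda>x. 0)" using lin[OF Pg Pg, of "-1"] by simp
  have Psum: "P (\<lambda>x. \<Sum>i\<in>I. a i * f i x)" if "finite I" "\<And>i. i \<in> I \<Longrightarrow> P (f i)" for I :: "'i set" and a f
    using that by (induction I rule: finite_induct) (auto intro: P0 lin)
  have Pbox: "P (?I (box a b))" for a b :: "real^2"
  proof (cases "a $ 1 < b $ 1 \<and> a $ 2 < b $ 2")
    case False
    then have "box a b = {}" by (auto simp: mem_box_cart forall_2)
    then show ?thesis using P0 by simp
  next
    case True
    \<comment> \<open>The affine map \<open>s i\<close> sends the side of the box to
      \<open>{-1<..<1}\<close>. Its even powers tend to 0 inside and to infinity outside, while the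
      extra monomial produces the factor \<open>gauss\<close> and the lower bound that
      \<open>base\<close> demands.\<close>
    define q where "q i n = [: - (a $ i + b $ i) / (b $ i - a $ i), 2 / (b $ i - a $ i) :] ^ (2 * Suc n) + [:0, 0, 1:]" for i :: 2 and n
    define s where "s i t = (2 * t - (a $ i + b $ i)) / (b $ i - a $ i)" for i :: 2 and t :: real
    have q: "poly (q i n) t = s i t ^ (2 * Suc n) + t\<^sup>2" for i n t
      unfolding q_def s_def by (simp add: poly_power diff_divide_distrib power2_eq_square algebra_simps add_divide_distrib)
    have s2: "s i t ^ (2 * Suc n) \<ge> 0" for i n t by (rule zero_le_even_power) simp
    have q2: "t\<^sup>2 \<le> poly (q i n) t" for i n t unfolding q using s2[of i t n] by linarith
    define u where "u n x = complex_of_real (exp (- poly (q 1 n) (x $ 1) - poly (q 2 n) (x $ 2)))" for n and x :: "real^2"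
    have u: "u n x = complex_of_real (exp (- (s 1 (x $ 1) ^ (2 * Suc n))) * exp (- (s 2 (x $ 2) ^ (2 * Suc n))) * gauss x)" for n x
      unfolding u_def q gauss_vec2 by (simp add: exp_add[symmetric] algebra_simps del: of_real_mult of_real_exp)
    show ?thesis
    proof (rule lim[of u 1])
      show "P (u n)" for n unfolding u_def by (rule base[OF q2 q2])
      fix n x
      have "norm (u n x) = exp (- (s 1 (x $ 1) ^ (2 * Suc n))) * exp (- (s 2 (x $ 2) ^ (2 * Suc n))) * gauss x"
        unfolding u by (simp del: of_real_mult of_real_exp add: abs_mult)
      also have "\<dots> \<le> 1 * 1 * gauss x"
        by (intro mult_mono) (use s2 in \<open>auto simp del: power_Suc mult_Suc_right\<close>)
      finally show "norm (u n x) \<le> 1 * gauss x" by simp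
    next
      \<comment> \<open>On the lines that bound the box the even powers stay equal to 1 and the
        limit is wrong; these lines are null sets.\<close>
      have ne: "AE x::real^2 in lborel. x $ i \<noteq> t" for i :: 2 and t
        using AE_lborel_inner_neq[of "axis i (1::real)" t] by (simp add: inner_axis axis_in_Basis_iff)
      show "AE x in lborel. (\<lambda>n. u n x) \<longlonglongrightarrow> ?I (box a b) x"
        using ne[of 1 "a $ 1"] ne[of 2 "a $ 2"] ne[of 1 "b $ 1"] ne[of 2 "b $ 2"]
      proof eventually_elim
        case (elim x)
        have s1: "\<bar>s i (x $ i)\<bar> \<noteq> 1" if "a $ i < b $ i" "x $ i \<noteq> a $ i" "x $ i \<noteq> b $ i" for i
          using that unfolding s_def by (auto simp: abs_if divide_simps split: if_splits)
        have s3: "indicator {-1<..<1} (s i (x $ i)) = (indicator {a $ i <..< b $ i} (x $ i) :: real)" if "a $ i < b $ i" for i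
          using that unfolding s_def indicator_def by (auto simp: divide_simps)
        have "(\<lambda>n. u n x) \<longlonglongrightarrow> complex_of_real (indicator {-1<..<1} (s 1 (x $ 1)) * indicator {-1<..<1} (s 2 (x $ 2)) * gauss x)"
          unfolding u using True elim
          by (intro tendsto_of_real tendsto_mult exp_neg_even_power_tendsto_indicator tendsto_const s1) auto
        also have "complex_of_real (indicator {-1<..<1} (s 1 (x $ 1)) * indicator {-1<..<1} (s 2 (x $ 2)) * gauss x) = ?I (box a b) x"
          unfolding s3[OF True[THEN conjunct1]] s3[OF True[THEN conjunct2]]
          by (auto simp: indicator_def mem_box_cart forall_2)
        finally show ?case .
      qed
    qed measurable
  qed
  \<comment> \<open>This is the pi-lambda argument: boxes are stable under intersection and generate
    the Borel sets, and complements are formed by subtracting from the whole of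
    \<open>gauss\<close>.\<close>
  have Pset: "P (?I A)" if "A \<in> sets borel" for A
  proof -
    let ?B = "range (\<lambda>(a, b). box a b :: (real^2) set)"
    have 1: "Int_stable ?B" by (auto simp: Int_stable_def box_Int_box)
    have 2: "?B \<subseteq> Pow UNIV" by simp
    have 3: "A \<in> sigma_sets UNIV ?B" using that unfolding borel_eq_box by simp
    from 1 2 3 show ?thesis
    proof (induction rule: sigma_sets_induct_disjoint)
      case (basic A) then show ?case using Pbox by auto
    next
      case empty then show ?case using P0 by simp
    next
      case (compl A)
      have "?I (UNIV - A) = (\<lambda>x. (-1) * ?I A x + complex_of_real (gauss x))"
        by (auto simp: indicator_def)
      then show ?case using lin[OF compl(2) Pg, of "-1"] by simp
    next
      case (union A)
      show ?case
      proof (rule lim[of "\<lambda>n x. \<Sum>i<n. 1 * ?I (A i) x" 1])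
        show "P (\<lambda>x. \<Sum>i<n. 1 * ?I (A i) x)" for n using union by (intro Psum) auto
        have eq: "(\<Sum>i<n. 1 * ?I (A i) x) = ?I (\<Union>i<n. A i) x" for n x
        proof -
          have "indicator (\<Union>i<n. A i) x = (\<Sum>i<n. indicator (A i) x :: complex)"
            using union(1) by (intro indicator_UN_disjoint) (auto simp: disjoint_family_on_def)
          then show ?thesis by (simp add: sum_distrib_right)
        qed
        show "norm (\<Sum>i<n. 1 * ?I (A i) x) \<le> 1 * gauss x" for n x
          unfolding eq by (auto simp: indicator_def)
        have "A i \<in> sets borel" for i using union(2) unfolding borel_eq_box by auto
        then show "?I (\<Union>i. A i) \<in> borel_measurable borel" by measurable
        have "(\<lambda>n. indicator (\<Union>i<n. A i) x) \<longlonglongrightarrow> (indicator (\<Union>i. A i) x :: complex)" for x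
          by (rule LIMSEQ_indicator_UN)
        then show "AE x in lborel. (\<lambda>n. \<Sum>i<n. 1 * ?I (A i) x) \<longlonglongrightarrow> ?I (\<Union>i. A i) x"
          unfolding eq by (intro AE_I2 tendsto_intros)
      qed
    qed
  qed
  \<comment> \<open>Division by \<open>gauss\<close> leaves a bounded function. Simple functions
    converge to it with norms at most twice its own, which is the origin of the bound
    \<open>2 * c\<close>.\<close>
  define k where "k x = h x / complex_of_real (gauss x)" for x
  have k: "k \<in> borel_measurable borel" unfolding k_def[abs_def] by measurable
  have kb: "norm (k x) \<le> c" for x
    using hb[of x] unfolding k_def by (simp add: norm_divide divide_le_eq)
  have hk: "h x = k x * complex_of_real (gauss x)" for x
    unfolding k_def using less_imp_neq[OF gauss_pos[of x]] by simp
  obtain F where F: "\<And>i. simple_function borel (F i)" "\<And>x. (\<lambda>i. F i x) \<longlonglongrightarrow> k x" "\<And>i x. dist (F i x) 0 \<le> 2 * dist (k x) 0"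
    using borel_measurable_implies_sequence_metric[OF k, of 0] by auto
  have PF: "P (\<lambda>x. F i x * complex_of_real (gauss x))" for i
  proof -
    have fin: "finite (range (F i))" using F(1)[of i] by (auto simp: simple_function_def)
    have "(\<lambda>x. F i x * complex_of_real (gauss x)) = (\<lambda>x. \<Sum>y\<in>range (F i). y * ?I (F i -` {y}) x)"
    proof
      fix x
      have "(\<Sum>y\<in>range (F i). y * ?I (F i -` {y}) x) = (\<Sum>y\<in>range (F i). if y = F i x then y * complex_of_real (gauss x) else 0)"
        by (intro sum.cong) (auto simp: indicator_def)
      also have "\<dots> = F i x * complex_of_real (gauss x)" using fin by simp
      finally show "F i x * complex_of_real (gauss x) = (\<Sum>y\<in>range (F i). y * ?I (F i -` {y}) x)" ..
    qed
    moreover have "P \<dots>" using fin simple_functionD(2)[OF F(1)[of i]] by (intro Psum Pset) auto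
    ultimately show ?thesis by simp
  qed
  show "P h"
  proof (rule lim[OF PF, where C="2 * c"])
    show "norm (F i x * complex_of_real (gauss x)) \<le> 2 * c * gauss x" for i x
      using F(3)[of i x] kb[of x] by (simp add: norm_mult mult_right_mono)
    show "AE x in lborel. (\<lambda>i. F i x * complex_of_real (gauss x)) \<longlonglongrightarrow> h x"
      unfolding hk by (intro AE_I2 tendsto_intros F)
  qed measurable
qed

section \<open>The sum of two points of the circle\<close>

text \<open>The Taylor remainder of order 3 gives
  \<open>\<bar>sin s - s\<bar> \<le> \<bar>s\<bar> ^ 3 / 6\<close>, and this is at most
  \<open>\<bar>s\<bar> / 2\<close> because \<open>\<bar>s\<bar> \<le> 1.6\<close> and the square of
  1.6 is below 3.\<close>

lemma abs_sin_ge_half: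
  fixes s :: real assumes "\<bar>s\<bar> \<le> pi / 2"
  shows "\<bar>s\<bar> \<le> 2 * \<bar>sin s\<bar>"
proof -
  have "\<bar>sin s - (\<Sum>m<3. sin_coeff m * s ^ m)\<bar> \<le> inverse (fact 3) * \<bar>s\<bar> ^ 3"
    by (rule Maclaurin_sin_bound)
  moreover have "(\<Sum>m<3. sin_coeff m * s ^ m) = s"
    by (simp add: sin_coeff_def eval_nat_numeral)
  moreover have "inverse (fact 3 :: real) = 1 / 6" by (simp add: fact_numeral)
  ultimately have "\<bar>sin s - s\<bar> \<le> \<bar>s\<bar> ^ 3 / 6" by simp
  moreover have "\<bar>s\<bar> ^ 3 \<le> 3 * \<bar>s\<bar>"
  proof -
    have "pi \<le> 32 / 10" using order_trans[OF pi_approx(2), of "32 / 10"] by simp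
    then have "\<bar>s\<bar> \<le> 16 / 10" using assms by linarith
    then have "\<bar>s\<bar>\<^sup>2 \<le> (16 / 10)\<^sup>2" by (rule power_mono) simp
    then have "\<bar>s\<bar>\<^sup>2 \<le> 3" by (simp add: power2_eq_square)
    then have "\<bar>s\<bar>\<^sup>2 * \<bar>s\<bar> \<le> 3 * \<bar>s\<bar>" by (rule mult_right_mono) simp
    then show ?thesis by (simp add: power3_eq_cube power2_eq_square)
  qed
  ultimately show ?thesis by linarith
qed

text \<open>The multiple is the one nearest to \<open>s\<close>, and the modulus of the sine has
  period \<open>pi\<close>. The bound on \<open>s\<close> leaves five candidates, so angle pairs
  with small sine of the difference lie in five strips.\<close>

lemma abs_sin_small_near_multiple:
  fixes s :: real assumes "\<bar>s\<bar> < 2 * pi"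
  shows "\<exists>k\<in>{-2..2::int}. \<bar>s - k * pi\<bar> \<le> 2 * \<bar>sin s\<bar>"
proof -
  define k where "k = round (s / pi)"
  have k1: "\<bar>s / pi - k\<bar> \<le> 1 / 2" unfolding k_def
    using of_int_round_abs_le[of "s / pi"] by (simp add: abs_minus_commute)
  have "s - k * pi = (s / pi - k) * pi" by (simp add: field_simps)
  then have "\<bar>s - k * pi\<bar> = \<bar>s / pi - k\<bar> * pi" by (simp add: abs_mult)
  then have k2: "\<bar>s - k * pi\<bar> \<le> pi / 2" using k1 mult_right_mono[OF k1, of pi] by simp
  have "\<bar>s / pi\<bar> < 2" using assms by (simp add: abs_divide divide_less_eq)
  then have "\<bar>real_of_int k\<bar> < 3" using k1 by linarith
  then have "k \<in> {-2..2}" by auto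
  moreover have "\<bar>sin (s - k * pi)\<bar> = \<bar>sin s\<bar>"
  proof -
    have "sin (k * pi) = 0" by (metis mult.commute sin_int_times_real sin_npi_int)
    moreover have "\<bar>cos (real_of_int k * pi)\<bar> = 1"
      using sin_zero_abs_cos_one[OF calculation] .
    ultimately show ?thesis by (simp add: sin_diff abs_mult)
  qed
  ultimately show ?thesis using abs_sin_ge_half[OF k2] by auto
qed

text \<open>The sum of two unit vectors fixes their inner product, and Lagrange's identity then
  fixes the modulus of their cross product. The common sign \<open>e\<close> fixes the cross product
  itself, which removes the freedom of exchanging the two vectors.\<close>

lemma circle_sum_inj:
  fixes a b c d :: real
  assumes "cos a + cos b = cos c + cos d" "sin a + sin b = sin c + sin d"
    and "\<bar>e\<bar> = 1" "e * sin (a - b) > 0" "e * sin (c - d) > 0"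
    and "a \<in> {0..<2*pi}" "b \<in> {0..<2*pi}" "c \<in> {0..<2*pi}" "d \<in> {0..<2*pi}"
  shows "a = c \<and> b = d"
proof -
  have key: "p = p' \<and> q = q' \<and> r = r' \<and> s = s'"
    if u: "p^2 + q^2 = 1" "r^2 + s^2 = 1" "p'^2 + q'^2 = 1" "r'^2 + s'^2 = 1"
      and z: "p + r = p' + r'" "q + s = q' + s'"
      and pos: "e * (q * r - p * s) > 0" "e * (q' * r' - p' * s') > 0"
    for p q r s p' q' r' s' :: real
  proof -
    have "(p + r)^2 + (q + s)^2 = (p' + r')^2 + (q' + s')^2" using z by simp
    then have dot: "p * r + q * s = p' * r' + q' * s'" using u by (simp add: power2_sum)
    have l: "(q * r - p * s)^2 = (p^2 + q^2) * (r^2 + s^2) - (p * r + q * s)^2" by (simp add: power2_eq_square algebra_simps)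
    have l': "(q' * r' - p' * s')^2 = (p'^2 + q'^2) * (r'^2 + s'^2) - (p' * r' + q' * s')^2" by (simp add: power2_eq_square algebra_simps)
    have "(q * r - p * s)^2 = (q' * r' - p' * s')^2" unfolding l l' u dot by simp
    then have "\<bar>q * r - p * s\<bar> = \<bar>q' * r' - p' * s'\<bar>" by (simp add: power2_eq_iff abs_eq_iff)
    then have cross: "q * r - p * s = q' * r' - p' * s'"
      using pos assms(3) by (auto simp: abs_if split: if_splits)
    define Z W where "Z = p + r" and "W = q + s"
    have Z': "Z = p' + r'" and W': "W = q' + s'" unfolding Z_def W_def using z by auto
    have r: "r = Z - p" "s = W - q" "r' = Z - p'" "s' = W - q'" unfolding Z_def W_def using z by auto
    \<comment> \<open>The difference of the two first vectors is both orthogonal and parallel to the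
      common sum \<open>(Z, W)\<close>. That sum is not 0, since otherwise the cross product would
      vanish.\<close>
    have 1: "Z * (p - p') + W * (q - q') = 0"
      using dot u unfolding r by (simp add: power2_eq_square algebra_simps)
    have 2: "Z * (q - q') - W * (p - p') = 0"
      using cross unfolding r by (simp add: algebra_simps)
    have nz: "Z^2 + W^2 \<noteq> 0"
    proof
      assume "Z^2 + W^2 = 0"
      then have "Z = 0" "W = 0" by (auto simp: sum_power2_eq_zero_iff)
      then have "q * r - p * s = 0" unfolding r by simp
      then show False using pos by simp
    qed
    have "(Z^2 + W^2) * (p - p') = Z * (Z * (p - p') + W * (q - q')) - W * (Z * (q - q') - W * (p - p'))"
      by (simp add: power2_eq_square algebra_simps)
    then have "(Z^2 + W^2) * (p - p') = 0" unfolding 1 2 by simp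
    then have p: "p = p'" using nz by (metis mult_eq_0_iff right_minus_eq)
    have "(Z^2 + W^2) * (q - q') = W * (Z * (p - p') + W * (q - q')) + Z * (Z * (q - q') - W * (p - p'))"
      by (simp add: power2_eq_square algebra_simps)
    then have "(Z^2 + W^2) * (q - q') = 0" unfolding 1 2 by simp
    then have q: "q = q'" using nz by (metis mult_eq_0_iff right_minus_eq)
    show ?thesis using p q z by simp
  qed
  have angle: "x = y" if h: "sin x = sin y" "cos x = cos y" "x \<in> {0..<2*pi}" "y \<in> {0..<2*pi}" for x y :: real
  proof -
    obtain n :: int where n: "x = y + 2 * pi * n" using h sin_cos_eq_iff[of x y] by blast
    have "\<bar>2 * pi * real_of_int n\<bar> < 2 * pi" using h n by auto
    then have "2 * pi * \<bar>real_of_int n\<bar> < 2 * pi * 1" by (simp add: abs_mult)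
    then have "\<bar>real_of_int n\<bar> < 1" by (subst (asm) mult_less_cancel_left_pos) auto
    then show ?thesis using n by simp
  qed
  have "cos a = cos c \<and> sin a = sin c \<and> cos b = cos d \<and> sin b = sin d"
    by (rule key) (use assms in \<open>auto simp: sin_diff mult.commute\<close>)
  then show ?thesis using angle assms by blast
qed

text \<open>The two angles are encoded as one point of \<open>real^2\<close>, so that the change of
  variables theorem applies to a map of the plane to itself.\<close>

definition circle_sum :: "real^2 \<Rightarrow> real^2" where
  "circle_sum t = vector [cos (t $ 1) + cos (t $ 2), sin (t $ 1) + sin (t $ 2)]"

lemma circle_sum_measurable [measurable]: "circle_sum \<in> borel_measurable borel"
  unfolding circle_sum_def[abs_def] by measurable

text \<open>On one sign branch the map is injective and its Jacobian is at least
  \<open>\<delta>\<close>. The change of variables formula therefore bounds \<open>\<delta>\<close>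
  times the measure of the set of angles by the area of its image, which lies in
  \<open>B\<close>.\<close>

lemma circle_sum_transversal_measure:
  assumes B [measurable]: "B \<in> sets borel" and m: "emeasure lborel B = ennreal m" "m \<ge> 0"
    and d: "\<delta> > 0" and e: "\<bar>e\<bar> = 1"
  shows "emeasure lborel {t::real^2. t $ 1 \<in> {0..<2*pi} \<and> t $ 2 \<in> {0..<2*pi} \<and> e * sin (t $ 1 - t $ 2) \<ge> \<delta> \<and> circle_sum t \<in> B}
    \<le> ennreal (m / \<delta>)"
proof -
  define S where "S = {t::real^2. t $ 1 \<in> {0..<2*pi} \<and> t $ 2 \<in> {0..<2*pi} \<and> e * sin (t $ 1 - t $ 2) \<ge> \<delta> \<and> circle_sum t \<in> B}"
  have S [measurable]: "S \<in> sets borel"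
    unfolding S_def by measurable
  have bS: "bounded S"
    by (rule bounded_subset[OF bounded_cbox[of 0 "vector [2*pi, 2*pi]"]])
       (auto simp: S_def mem_box_cart forall_2)
  have fS: "emeasure lborel S < \<infinity>" using emeasure_bounded_finite[OF bS] by simp
  define D where "D t h = (vector [- sin (t $ 1) * h $ 1 - sin (t $ 2) * h $ 2, cos (t $ 1) * h $ 1 + cos (t $ 2) * h $ 2] :: real^2)"
    for t h :: "real^2"
  have der: "(circle_sum has_derivative D t) (at t within S)" for t
  proof -
    have pr: "((\<lambda>x::real^2. x $ i) has_derivative (\<lambda>h. h $ i)) (at t within S)" for i
      by (rule bounded_linear.has_derivative[OF bounded_linear_vec_nth]) (rule has_derivative_ident)
    have "((\<lambda>t. (cos (t $ 1) + cos (t $ 2)) *\<^sub>R axis 1 1 + (sin (t $ 1) + sin (t $ 2)) *\<^sub>R axis 2 1 :: real^2) has_derivative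
      (\<lambda>h. (- sin (t $ 1) * h $ 1 - sin (t $ 2) * h $ 2) *\<^sub>R axis 1 1 + (cos (t $ 1) * h $ 1 + cos (t $ 2) * h $ 2) *\<^sub>R axis 2 1)) (at t within S)"
      by (auto intro!: derivative_eq_intros pr simp: algebra_simps)
    moreover have "circle_sum = (\<lambda>t. (cos (t $ 1) + cos (t $ 2)) *\<^sub>R axis 1 1 + (sin (t $ 1) + sin (t $ 2)) *\<^sub>R axis 2 1)"
      by (auto simp: circle_sum_def vec_eq_iff forall_2 axis_def fun_eq_iff)
    moreover have "D t = (\<lambda>h. (- sin (t $ 1) * h $ 1 - sin (t $ 2) * h $ 2) *\<^sub>R axis 1 1 + (cos (t $ 1) * h $ 1 + cos (t $ 2) * h $ 2) *\<^sub>R axis 2 1)"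
      by (auto simp: D_def vec_eq_iff forall_2 axis_def fun_eq_iff)
    ultimately show ?thesis by simp
  qed
  have det: "\<bar>det (matrix (D t))\<bar> = \<bar>sin (t $ 1 - t $ 2)\<bar>" for t
    by (simp add: det_2 matrix_def D_def axis_def sin_diff) (simp add: abs_if algebra_simps)
  have inj: "inj_on circle_sum S"
  proof (rule inj_onI)
    fix t t' assume t: "t \<in> S" "t' \<in> S" and eq: "circle_sum t = circle_sum t'"
    have "cos (t $ 1) + cos (t $ 2) = cos (t' $ 1) + cos (t' $ 2)" "sin (t $ 1) + sin (t $ 2) = sin (t' $ 1) + sin (t' $ 2)"
      using eq by (auto simp: circle_sum_def vec_eq_iff forall_2)
    then have "t $ 1 = t' $ 1 \<and> t $ 2 = t' $ 2"
      by (rule circle_sum_inj[OF _ _ e]) (use t d in \<open>auto simp: S_def\<close>)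
    then show "t = t'" by (simp add: vec_eq_iff forall_2)
  qed
  have iS: "integrable lborel (\<lambda>t. indicator S t *\<^sub>R \<bar>sin (t $ 1 - t $ 2)\<bar>)"
    by (rule Bochner_Integration.integrable_bound[of _ "indicator S :: _ \<Rightarrow> real"])
       (use fS in \<open>auto simp: indicator_def\<close>)
  have si: "set_integrable lborel S (\<lambda>t. \<bar>sin (t $ 1 - t $ 2)\<bar>)" using iS unfolding set_integrable_def .
  have on: "(\<lambda>t. \<bar>det (matrix (D t))\<bar>) integrable_on S"
    unfolding det by (rule set_borel_integral_eq_integral(1)[OF si])
  have Sl: "S \<in> sets lebesgue" using S by simp
  have img: "circle_sum ` S \<in> lmeasurable"
    using measurable_differentiable_image_eq[OF Sl der inj] on by blast
  have "measure lebesgue (circle_sum ` S) = integral S (\<lambda>t. \<bar>sin (t $ 1 - t $ 2)\<bar>)"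
    using measure_differentiable_image_eq[OF Sl der inj on] unfolding det .
  also have "\<dots> = (\<integral>t. indicator S t *\<^sub>R \<bar>sin (t $ 1 - t $ 2)\<bar> \<partial>lborel)"
    using set_borel_integral_eq_integral(2)[OF si] unfolding set_lebesgue_integral_def by simp
  finally have eq: "measure lebesgue (circle_sum ` S) = (\<integral>t. indicator S t *\<^sub>R \<bar>sin (t $ 1 - t $ 2)\<bar> \<partial>lborel)" .
  have "\<delta> * measure lborel S = (\<integral>t. indicator S t *\<^sub>R \<delta> \<partial>lborel)"
    using fS by simp
  also have "\<dots> \<le> (\<integral>t. indicator S t *\<^sub>R \<bar>sin (t $ 1 - t $ 2)\<bar> \<partial>lborel)"
  proof (rule integral_mono[OF _ iS])
    show "integrable lborel (\<lambda>t. indicator S t *\<^sub>R \<delta>)" using fS by simp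
    fix t
    have "\<delta> \<le> \<bar>sin (t $ 1 - t $ 2)\<bar>" if "t \<in> S"
    proof -
      have "\<delta> \<le> \<bar>e * sin (t $ 1 - t $ 2)\<bar>" using that unfolding S_def by auto
      then show ?thesis using e by (simp add: abs_mult)
    qed
    then show "indicator S t *\<^sub>R \<delta> \<le> indicator S t *\<^sub>R \<bar>sin (t $ 1 - t $ 2)\<bar>"
      by (simp add: indicator_def)
  qed
  also have "\<dots> = measure lebesgue (circle_sum ` S)" using eq by simp
  also have "\<dots> \<le> measure lebesgue B"
  proof (rule measure_mono_fmeasurable)
    show "circle_sum ` S \<subseteq> B" unfolding S_def by auto
    show "circle_sum ` S \<in> sets lebesgue" using img by (rule fmeasurableD)
    show "B \<in> lmeasurable" using m by (intro fmeasurableI) auto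
  qed
  also have "\<dots> = m" using m by (simp add: measure_def)
  finally have "measure lborel S \<le> m / \<delta>" using d by (simp add: field_simps)
  moreover have "emeasure lborel S = ennreal (measure lborel S)"
    using fS by (intro emeasure_eq_ennreal_measure) auto
  ultimately have "emeasure lborel S \<le> ennreal (m / \<delta>)" by (simp add: ennreal_leI)
  then show ?thesis unfolding S_def .
qed

section \<open>Averages over discs\<close>

lemma sets_circle_measure [measurable_cong, simp]: "sets circle_measure = sets borel"
  and space_circle_measure [simp]: "space circle_measure = UNIV"
  by (simp_all add: circle_measure_def)

lemma nn_integral_circle_measure:
  assumes [measurable]: "f \<in> borel_measurable borel"
  shows "(\<integral>\<^sup>+x. f x \<partial>circle_measure) = (\<integral>\<^sup>+t. f (vector [cos t, sin t]) * indicator {0..<2*pi} t \<partial>lborel)"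
proof -
  have "(\<lambda>t. vector [cos t, sin t] :: real^2) \<in> borel_measurable (restrict_space lborel {0..<2*pi})"
    by (rule measurable_restrict_space1) measurable
  then have "(\<integral>\<^sup>+x. f x \<partial>circle_measure) = (\<integral>\<^sup>+t. f (vector [cos t, sin t]) \<partial>restrict_space lborel {0..<2*pi})"
    unfolding circle_measure_def by (subst nn_integral_distr) auto
  also have "\<dots> = (\<integral>\<^sup>+t. f (vector [cos t, sin t]) * indicator {0..<2*pi} t \<partial>lborel)"
    by (subst nn_integral_restrict_space) auto
  finally show ?thesis .
qed

lemma emeasure_circle_measure: "emeasure circle_measure UNIV = ennreal (2 * pi)"
proof -
  have "emeasure circle_measure UNIV = (\<integral>\<^sup>+x. 1 \<partial>circle_measure)" by simp
  also have "\<dots> = (\<integral>\<^sup>+t. indicator {0..<2*pi} t \<partial>lborel)" by (subst nn_integral_circle_measure) auto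
  also have "\<dots> = ennreal (2 * pi)" by simp
  finally show ?thesis .
qed

interpretation circle: finite_measure circle_measure
  by (rule finite_measureI) (simp add: emeasure_circle_measure)

text \<open>The map from two angles to the sum of the two points has Jacobian \<open>\<bar>sin (a - b)\<bar>\<close>; the first term of the
  bound is the measure of the region where the Jacobian is below \<open>\<delta>\<close>.\<close>

lemma circle_sum_measure_delta:
  assumes B [measurable]: "B \<in> sets borel" and m: "emeasure lborel B = ennreal m" "m \<ge> 0"
    and d: "\<delta> > 0"
  shows "(\<integral>\<^sup>+x. \<integral>\<^sup>+y. indicator B (x + y) \<partial>circle_measure \<partial>circle_measure) \<le> ennreal (160 * \<delta> + 2 * m / \<delta>)"
proof -
  let ?J = "{0..<2*pi}"
  define W where "W e = {t::real^2. t $ 1 \<in> ?J \<and> t $ 2 \<in> ?J \<and> e * sin (t $ 1 - t $ 2) \<ge> \<delta> \<and> circle_sum t \<in> B}" for e :: real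
  define V where "V = {t::real^2. t $ 1 \<in> ?J \<and> t $ 2 \<in> ?J \<and> \<bar>sin (t $ 1 - t $ 2)\<bar> < \<delta>}"
  have [measurable]: "W e \<in> sets borel" for e unfolding W_def by measurable
  have [measurable]: "V \<in> sets borel" unfolding V_def by measurable
  have cs: "vector [cos a, sin a] + vector [cos b, sin b] = circle_sum (vector [a, b])" for a b
    by (simp add: circle_sum_def vec_eq_iff forall_2)
  have "(\<integral>\<^sup>+x. \<integral>\<^sup>+y. indicator B (x + y) \<partial>circle_measure \<partial>circle_measure)
     = (\<integral>\<^sup>+a. \<integral>\<^sup>+b. indicator B (circle_sum (vector [a, b])) * indicator ?J b * indicator ?J a \<partial>lborel \<partial>lborel)"
    by (subst nn_integral_circle_measure, measurable, subst nn_integral_circle_measure, measurable)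
       (simp add: cs nn_integral_multc)
  also have "\<dots> = (\<integral>\<^sup>+t. indicator B (circle_sum t) * indicator ?J (t $ 2) * indicator ?J (t $ 1) \<partial>(lborel :: (real^2) measure))"
    by (subst nn_integral_vec2) simp_all
  \<comment> \<open>Angle pairs split into the nearly collinear ones, for which \<open>B\<close> is
    ignored, and the two sign branches on which the map is injective.\<close>
  also have "\<dots> \<le> (\<integral>\<^sup>+t. indicator V t + indicator (W 1) t + indicator (W (-1)) t \<partial>lborel)"
    by (intro nn_integral_mono) (auto simp: indicator_def V_def W_def)
  also have "\<dots> = emeasure lborel V + emeasure lborel (W 1) + emeasure lborel (W (-1))"
    by (simp add: nn_integral_add)
  also have "\<dots> \<le> ennreal (160 * \<delta>) + ennreal (m / \<delta>) + ennreal (m / \<delta>)"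
  proof (intro add_mono)
    show "emeasure lborel (W 1) \<le> ennreal (m / \<delta>)" "emeasure lborel (W (-1)) \<le> ennreal (m / \<delta>)"
      unfolding W_def by (rule circle_sum_transversal_measure[OF B m d]; simp)+
    have "emeasure lborel V = (\<integral>\<^sup>+a. \<integral>\<^sup>+b. indicator V (vector [a, b]) \<partial>lborel \<partial>lborel)"
      by (subst nn_integral_vec2[symmetric]) simp_all
    also have "\<dots> \<le> (\<integral>\<^sup>+a. ennreal (20 * \<delta>) * indicator ?J a \<partial>lborel)"
    proof (rule nn_integral_mono)
      fix a :: real
      \<comment> \<open>Five intervals of length \<open>4 * \<delta>\<close> give
        \<open>20 * \<delta>\<close>; the range of \<open>a\<close> has length
        \<open>2 * pi\<close>, at most 8, and this gives the 160.\<close>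
      let ?K = "\<Union>k\<in>{-2..2::int}. {a - k * pi - 2 * \<delta> .. a - k * pi + 2 * \<delta>}"
      have "(\<integral>\<^sup>+b. indicator V (vector [a, b]) \<partial>lborel) \<le> (\<integral>\<^sup>+b. indicator ?K b * indicator ?J a \<partial>lborel)"
      proof (rule nn_integral_mono)
        fix b
        have "b \<in> ?K" if *: "a \<in> ?J" "b \<in> ?J" "\<bar>sin (a - b)\<bar> < \<delta>"
        proof -
          have "\<bar>a - b\<bar> < 2 * pi" using * by auto
          then obtain k where k: "k \<in> {-2..2::int}" "\<bar>a - b - k * pi\<bar> \<le> 2 * \<bar>sin (a - b)\<bar>"
            using abs_sin_small_near_multiple by blast
          then have "\<bar>a - b - k * pi\<bar> \<le> 2 * \<delta>" using * by linarith
          then have "b \<in> {a - k * pi - 2 * \<delta> .. a - k * pi + 2 * \<delta>}" by auto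
          then show ?thesis using k(1) by blast
        qed
        then show "indicator V (vector [a, b]) \<le> indicator ?K b * (indicator ?J a :: ennreal)"
          by (auto simp: indicator_def V_def)
      qed
      also have "\<dots> = emeasure lborel ?K * indicator ?J a"
        by (subst nn_integral_multc) auto
      also have "emeasure lborel ?K \<le> (\<Sum>k\<in>{-2..2::int}. emeasure lborel {a - k * pi - 2 * \<delta> .. a - k * pi + 2 * \<delta>})"
        by (rule emeasure_subadditive_finite) auto
      also have "\<dots> = (\<Sum>k\<in>{-2..2::int}. ennreal (4 * \<delta>))"
        using d by (intro sum.cong) auto
      also have "\<dots> = ennreal (20 * \<delta>)"
        using d by (subst sum_ennreal) auto
      finally show "(\<integral>\<^sup>+b. indicator V (vector [a, b]) \<partial>lborel) \<le> ennreal (20 * \<delta>) * indicator ?J a"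
        by (simp add: mult_right_mono)
    qed
    also have "\<dots> = ennreal (20 * \<delta>) * ennreal (2 * pi)"
      by (subst nn_integral_cmult) auto
    also have "\<dots> \<le> ennreal (160 * \<delta>)"
      using d pi_less_4 by (subst ennreal_mult[symmetric]) (auto intro!: ennreal_leI)
    finally show "emeasure lborel V \<le> ennreal (160 * \<delta>)" .
  qed
  also have "\<dots> = ennreal (160 * \<delta> + 2 * m / \<delta>)"
    using d m by (simp flip: ennreal_plus)
  finally show ?thesis .
qed

text \<open>The choice \<open>\<delta> = sqrt m\<close> balances the two terms, and 162 is 160 + 2.
  For \<open>m = 0\<close> no positive \<open>\<delta>\<close> balances them, so
  \<open>\<delta>\<close> is sent to 0. This is the dual form of the statement that the
  self-convolution of arclength lies in weak \<open>L\<^sup>2\<close>.\<close>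

lemma circle_sum_measure_sqrt:
  assumes B [measurable]: "B \<in> sets borel" and m: "emeasure lborel B \<le> ennreal m" "m \<ge> 0"
  shows "(\<integral>\<^sup>+x. \<integral>\<^sup>+y. indicator B (x + y) \<partial>circle_measure \<partial>circle_measure) \<le> ennreal (162 * sqrt m)"
proof -
  define l where "l = measure lborel B"
  have l: "emeasure lborel B = ennreal l" "l \<ge> 0" "l \<le> m"
  proof -
    have "emeasure lborel B < \<infinity>" using m(1) by (rule order_le_less_trans) simp
    then show "emeasure lborel B = ennreal l" unfolding l_def by (intro emeasure_eq_ennreal_measure) auto
    then show "l \<le> m" using m by (simp add: l_def)
  qed (simp add: l_def)
  note * = circle_sum_measure_delta[OF B l(1,2)]
  show ?thesis
  proof (cases "m = 0")
    case False
    then have "m > 0" using m by simp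
    then have "160 * sqrt m + 2 * l / sqrt m \<le> 162 * sqrt m"
      using l(3) by (simp add: divide_le_eq)
    then show ?thesis using *[of "sqrt m"] \<open>m > 0\<close> by (auto intro: order_trans ennreal_leI)
  next
    case True
    have "(\<integral>\<^sup>+x. \<integral>\<^sup>+y. indicator B (x + y) \<partial>circle_measure \<partial>circle_measure) \<le> 0 + ennreal e" if "e > 0" for e
      using *[of "e / 160"] True l that by simp
    then have "(\<integral>\<^sup>+x. \<integral>\<^sup>+y. indicator B (x + y) \<partial>circle_measure \<partial>circle_measure) \<le> 0"
      by (rule ennreal_le_epsilon)
    then show ?thesis by simp
  qed
qed

section \<open>Normalised discs and the Hardy-Littlewood maximal function\<close>

definition ball_kernel :: "real \<Rightarrow> real^2 \<Rightarrow> real^2 \<Rightarrow> ennreal" where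
  "ball_kernel r x y = ennreal (if dist x y < r then 1 / (pi * r\<^sup>2) else 0)"

definition ball_avg :: "real \<Rightarrow> (real^2 \<Rightarrow> ennreal) \<Rightarrow> real^2 \<Rightarrow> ennreal" where
  "ball_avg r g x = (\<integral>\<^sup>+y. ball_kernel r x y * g y \<partial>lborel)"

lemma ball_kernel_measurable [measurable (raw)]:
  assumes [measurable]: "r \<in> borel_measurable M" "f \<in> borel_measurable M" "g \<in> borel_measurable M"
  shows "(\<lambda>p. ball_kernel (r p) (f p) (g p)) \<in> borel_measurable M"
  unfolding ball_kernel_def by measurable

lemma ball_avg_measurable [measurable (raw)]:
  assumes [measurable]: "r \<in> borel_measurable M" "f \<in> borel_measurable M" "g \<in> borel_measurable borel"
  shows "(\<lambda>p. ball_avg (r p) g (f p)) \<in> borel_measurable M"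
  unfolding ball_avg_def by measurable

lemma emeasure_ball_vec2: "r \<ge> 0 \<Longrightarrow> emeasure lborel (ball (x::real^2) r) = ennreal (pi * r\<^sup>2)"
  using emeasure_ball[of r x] by (simp add: unit_ball_vol_2)

lemma nn_integral_ball_kernel: "r > 0 \<Longrightarrow> (\<integral>\<^sup>+y. ball_kernel r x y \<partial>lborel) = 1"
proof -
  assume r: "r > 0"
  have "(\<integral>\<^sup>+y. ball_kernel r x y \<partial>lborel) = (\<integral>\<^sup>+y. ennreal (1 / (pi * r\<^sup>2)) * indicator (ball x r) y \<partial>lborel)"
    by (intro nn_integral_cong) (simp add: ball_kernel_def indicator_def)
  also have "\<dots> = ennreal (1 / (pi * r\<^sup>2)) * ennreal (pi * r\<^sup>2)"
    using r by (subst nn_integral_cmult_indicator) (simp_all add: emeasure_ball_vec2)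
  also have "\<dots> = 1" using r by (simp flip: ennreal_mult)
  finally show ?thesis .
qed

lemma ball_avg_indicator:
  assumes [measurable]: "E \<in> sets borel" and r: "r > 0"
  shows "ball_avg r (indicator E) x * ennreal (pi * r\<^sup>2) = emeasure lborel (E \<inter> ball x r)"
proof -
  have "ball_avg r (indicator E) x = (\<integral>\<^sup>+y. ennreal (1 / (pi * r\<^sup>2)) * indicator (E \<inter> ball x r) y \<partial>lborel)"
    unfolding ball_avg_def by (intro nn_integral_cong) (simp add: ball_kernel_def indicator_def)
  also have "\<dots> = ennreal (1 / (pi * r\<^sup>2)) * emeasure lborel (E \<inter> ball x r)"
    by (subst nn_integral_cmult_indicator) simp_all
  finally have "ball_avg r (indicator E) x * ennreal (pi * r\<^sup>2)
     = (ennreal (1 / (pi * r\<^sup>2)) * ennreal (pi * r\<^sup>2)) * emeasure lborel (E \<inter> ball x r)"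
    by (simp add: mult_ac)
  also have "\<dots> = emeasure lborel (E \<inter> ball x r)" using r by (simp flip: ennreal_mult)
  finally show ?thesis .
qed

text \<open>Each point of the set is the centre of an admissible disc in which \<open>E\<close> has
  density above \<open>l\<close>. The Vitali covering lemma, for which the radii need the common
  bound \<open>b\<close>, selects disjoint discs whose fivefold dilates cover the set; 25 is the
  resulting ratio of areas.\<close>

lemma hardy_littlewood_weak:
  fixes R :: "nat \<Rightarrow> real"
  assumes E [measurable]: "E \<in> sets borel" and R: "\<And>i. 0 < R i" "\<And>i. R i \<le> b" and l: "l > 0"
  shows "emeasure lborel {z. \<exists>i. ball_avg (R i) (indicator E) z > ennreal l} \<le> ennreal (25 / l) * emeasure lborel E"
proof -
  define U where "U = {z. \<exists>i. ball_avg (R i) (indicator E) z > ennreal l}"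
  have [measurable]: "U \<in> sets borel" unfolding U_def by measurable
  have "\<forall>z\<in>U. \<exists>i. ball_avg (R i) (indicator E) z > ennreal l" unfolding U_def by blast
  then obtain i where i: "\<And>z. z \<in> U \<Longrightarrow> ball_avg (R (i z)) (indicator E) z > ennreal l" by metis
  define r where "r z = R (i z)" for z
  have r: "r z > 0" "r z \<le> b" for z unfolding r_def using R by auto
  obtain C where C: "countable C" "C \<subseteq> U" "pairwise (\<lambda>i j. disjnt (cball i (r i)) (cball j (r j))) C"
     "U \<subseteq> (\<Union>i\<in>C. cball i (5 * r i))"
  proof (rule Vitali_covering_lemma_cballs[where S=U and K=U and a="\<lambda>z. z" and r=r and B=b])
    show "U \<subseteq> (\<Union>i\<in>U. cball i (r i))" using r by (auto intro!: bexI simp: less_imp_le)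
  qed (use r in auto)
  have big: "emeasure lborel (cball z (5 * r z)) \<le> ennreal (25 / l) * emeasure lborel (E \<inter> ball z (r z))" if "z \<in> U" for z
  proof -
    have "emeasure lborel (cball z (5 * r z)) = ennreal (pi * (5 * r z)\<^sup>2)"
      using emeasure_cball[of "5 * r z" z] r[of z] by (simp add: unit_ball_vol_2)
    also have "\<dots> = ennreal (25 / l) * (ennreal l * ennreal (pi * (r z)\<^sup>2))"
      using l by (simp add: power_mult_distrib field_simps flip: ennreal_mult)
    also have "\<dots> \<le> ennreal (25 / l) * (ball_avg (r z) (indicator E) z * ennreal (pi * (r z)\<^sup>2))"
      using i[OF that] unfolding r_def by (intro mult_left_mono mult_right_mono) auto
    also have "\<dots> = ennreal (25 / l) * emeasure lborel (E \<inter> ball z (r z))"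
      by (simp add: ball_avg_indicator r)
    finally show ?thesis .
  qed
  have "emeasure lborel U = (\<integral>\<^sup>+x. indicator U x \<partial>lborel)" by simp
  \<comment> \<open>Countable subadditivity over the selected centres is expressed as an integral
    against the counting measure on \<open>C\<close>.\<close>
  also have "\<dots> \<le> (\<integral>\<^sup>+x. \<integral>\<^sup>+z. indicator (cball z (5 * r z)) x \<partial>count_space C \<partial>lborel)"
  proof (rule nn_integral_mono)
    fix x
    show "indicator U x \<le> (\<integral>\<^sup>+z. indicator (cball z (5 * r z)) x \<partial>count_space C)"
    proof (cases "x \<in> U")
      case True
      then obtain z where z: "z \<in> C" "x \<in> cball z (5 * r z)" using C by blast
      have "1 = indicator (cball z (5 * r z)) x * emeasure (count_space C) {z}"
        using z by simp
      also have "\<dots> = (\<integral>\<^sup>+w. indicator (cball z (5 * r z)) x * indicator {z} w \<partial>count_space C)"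
        using z by (subst nn_integral_cmult_indicator) auto
      also have "\<dots> \<le> (\<integral>\<^sup>+z. indicator (cball z (5 * r z)) x \<partial>count_space C)"
        by (intro nn_integral_mono) (auto simp: indicator_def)
      finally show ?thesis using True by simp
    qed simp
  qed
  also have "\<dots> = (\<integral>\<^sup>+z. emeasure lborel (cball z (5 * r z)) \<partial>count_space C)"
    by (subst nn_integral_count_space_nn_integral[OF C(1)]) (auto intro!: borel_measurable_indicator)
  also have "\<dots> \<le> (\<integral>\<^sup>+z. ennreal (25 / l) * emeasure lborel (E \<inter> ball z (r z)) \<partial>count_space C)"
    using C(2) by (intro nn_integral_mono big) auto
  also have "\<dots> = ennreal (25 / l) * (\<integral>\<^sup>+z. emeasure lborel (E \<inter> ball z (r z)) \<partial>count_space C)"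
    by (rule nn_integral_cmult) simp
  also have "(\<integral>\<^sup>+z. emeasure lborel (E \<inter> ball z (r z)) \<partial>count_space C) = emeasure lborel (\<Union>z\<in>C. E \<inter> ball z (r z))"
  proof (rule emeasure_UN_countable[symmetric, OF _ C(1)])
    show "disjoint_family_on (\<lambda>z. E \<inter> ball z (r z)) C"
      using C(3) unfolding disjoint_family_on_def pairwise_def disjnt_def
      by (auto simp: subset_iff) (metis disjoint_iff less_imp_le mem_cball)
  qed auto
  also have "\<dots> \<le> emeasure lborel E"
    by (intro emeasure_mono) auto
  finally show ?thesis unfolding U_def by (simp add: mult_left_mono)
qed

text \<open>The radii are twice the powers of 1/2 because the sum of a point from each of two discs
  of radius at most \<open>r\<close> lies within \<open>2 * r\<close> of the sum of the
  centres.\<close>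

definition max_indicator :: "(real^2) set \<Rightarrow> real^2 \<Rightarrow> ennreal" where
  "max_indicator E z = (SUP i::nat. ball_avg (2 / 2 ^ i) (indicator E) z)"

lemma max_indicator_measurable [measurable]:
  assumes [measurable]: "E \<in> sets borel"
  shows "max_indicator E \<in> borel_measurable borel"
  unfolding max_indicator_def[abs_def] by measurable

lemma max_indicator_le_1: "max_indicator E z \<le> 1"
  unfolding max_indicator_def
proof (rule SUP_least)
  fix i :: nat
  have "ball_avg (2 / 2 ^ i) (indicator E) z \<le> (\<integral>\<^sup>+y. ball_kernel (2 / 2 ^ i) z y \<partial>lborel)"
    unfolding ball_avg_def by (intro nn_integral_mono) (auto simp: indicator_def)
  also have "\<dots> = 1" by (rule nn_integral_ball_kernel) simp
  finally show "ball_avg (2 / 2 ^ i) (indicator E) z \<le> 1" .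
qed

text \<open>One term of the series suffices: if the value lies above \<open>(1/2) ^ Suc j\<close>
  and not above \<open>(1/2) ^ j\<close>, the term with index \<open>j\<close> already dominates
  it.\<close>

lemma max_indicator_le_layers:
  "max_indicator E z \<le> (\<Sum>j. ennreal ((1/2) ^ j) * indicator {z. \<exists>i::nat. ball_avg (2 / 2 ^ i) (indicator E) z > ennreal ((1/2) ^ Suc j)} z)"
proof (cases "max_indicator E z = 0")
  case False
  define t where "t = enn2real (max_indicator E z)"
  have t: "max_indicator E z = ennreal t" unfolding t_def
    using max_indicator_le_1[of E z] by (intro ennreal_enn2real[symmetric]) (auto simp: le_less_trans)
  have t01: "0 < t" "t \<le> 1"
    using False max_indicator_le_1[of E z] unfolding t by (auto simp: ennreal_eq_0_iff)
  obtain j where j: "(1/2) ^ Suc j < t" and j2: "t \<le> (1/2) ^ j" using dyadic_bracket[OF t01] .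
  define f where "f = (\<lambda>j. ennreal ((1/2) ^ j) * indicator {z. \<exists>i::nat. ball_avg (2 / 2 ^ i) (indicator E) z > ennreal ((1/2) ^ Suc j)} z)"
  have "ennreal ((1/2) ^ Suc j) < max_indicator E z" unfolding t using j t01 by (intro ennreal_lessI) auto
  then have "\<exists>i::nat. ball_avg (2 / 2 ^ i) (indicator E) z > ennreal ((1/2) ^ Suc j)"
    unfolding max_indicator_def less_SUP_iff by blast
  then have "f j = ennreal ((1/2) ^ j)" unfolding f_def by simp
  then have "max_indicator E z \<le> f j" unfolding t using j2 by (simp add: ennreal_leI)
  also have "\<dots> = sum f {j}" by simp
  also have "\<dots> \<le> suminf f" by (rule sum_le_suminf) (auto intro: summableI)
  finally show ?thesis unfolding f_def .
qed simp

text \<open>The layer \<open>U j\<close> has measure at most \<open>50 * 2 ^ j * m\<close>, whose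
  square root grows more slowly than the weight \<open>(1/2) ^ j\<close> decays. The ratio
  \<open>sqrt 2 / 2\<close> is rounded up to 3/4, whose geometric series sums to 4; with
  \<open>sqrt 50 \<le> 8\<close> the constant becomes 162 * 8 * 4.\<close>

lemma circle_sum_maximal:
  assumes E [measurable]: "E \<in> sets borel" and m: "emeasure lborel E \<le> ennreal m" "m \<ge> 0"
  shows "(\<integral>\<^sup>+x. \<integral>\<^sup>+y. max_indicator E (x + y) \<partial>circle_measure \<partial>circle_measure) \<le> ennreal (5184 * sqrt m)"
proof -
  define U where "U j = {z. \<exists>i::nat. ball_avg (2 / 2 ^ i) (indicator E) z > ennreal ((1/2) ^ Suc j)}" for j :: nat
  have [measurable]: "U j \<in> sets borel" for j unfolding U_def by measurable
  have Um: "emeasure lborel (U j) \<le> ennreal (50 * 2 ^ j * m)" for j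
  proof -
    have "emeasure lborel (U j) \<le> ennreal (25 / (1/2) ^ Suc j) * emeasure lborel E"
      unfolding U_def by (rule hardy_littlewood_weak[where b=2]) (auto simp: divide_le_eq)
    also have "\<dots> \<le> ennreal (25 / (1/2) ^ Suc j) * ennreal m"
      using m by (intro mult_left_mono) auto
    also have "\<dots> = ennreal (50 * 2 ^ j * m)"
      using m by (simp add: power_one_over flip: ennreal_mult)
    finally show ?thesis .
  qed
  have tm: "ennreal ((1/2) ^ j) * (\<integral>\<^sup>+x. \<integral>\<^sup>+y. indicator (U j) (x + y) \<partial>circle_measure \<partial>circle_measure)
     \<le> ennreal (1296 * sqrt m * (3/4) ^ j)" for j
  proof -
    have "ennreal ((1/2) ^ j) * (\<integral>\<^sup>+x. \<integral>\<^sup>+y. indicator (U j) (x + y) \<partial>circle_measure \<partial>circle_measure)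
       \<le> ennreal ((1/2) ^ j) * ennreal (162 * sqrt (50 * 2 ^ j * m))"
      using m by (intro mult_left_mono circle_sum_measure_sqrt Um) auto
    also have "\<dots> = ennreal ((1/2) ^ j * (162 * sqrt (50 * 2 ^ j * m)))"
      using m by (simp flip: ennreal_mult)
    also have "\<dots> \<le> ennreal (1296 * sqrt m * (3/4) ^ j)"
    proof (rule ennreal_leI)
      have s50: "sqrt 50 \<le> 8" by (rule real_le_lsqrt) auto
      have s2: "sqrt 2 \<le> 3/2" by (rule real_le_lsqrt) (auto simp: power2_eq_square)
      have "(1/2) ^ j * (162 * sqrt (50 * 2 ^ j * m)) = 162 * sqrt 50 * sqrt m * (sqrt 2 / 2) ^ j"
        by (simp add: real_sqrt_mult real_sqrt_power power_divide)
      also have "\<dots> \<le> 162 * 8 * sqrt m * (3/4) ^ j"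
        using s50 s2 m by (intro mult_mono power_mono) auto
      finally show "(1/2) ^ j * (162 * sqrt (50 * 2 ^ j * m)) \<le> 1296 * sqrt m * (3/4) ^ j" by simp
    qed
    finally show ?thesis .
  qed
  have "(\<integral>\<^sup>+x. \<integral>\<^sup>+y. max_indicator E (x + y) \<partial>circle_measure \<partial>circle_measure)
    \<le> (\<integral>\<^sup>+x. \<integral>\<^sup>+y. (\<Sum>j. ennreal ((1/2) ^ j) * indicator (U j) (x + y)) \<partial>circle_measure \<partial>circle_measure)"
    unfolding U_def by (intro nn_integral_mono max_indicator_le_layers)
  also have "\<dots> = (\<Sum>j. ennreal ((1/2) ^ j) * (\<integral>\<^sup>+x. \<integral>\<^sup>+y. indicator (U j) (x + y) \<partial>circle_measure \<partial>circle_measure))"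
    by (subst nn_integral_suminf, measurable)+ (simp add: nn_integral_cmult)
  also have "\<dots> \<le> (\<Sum>j. ennreal (1296 * sqrt m * (3/4) ^ j))"
    by (intro suminf_le tm summableI)
  also have "\<dots> = ennreal (\<Sum>j. 1296 * sqrt m * (3/4) ^ j)"
    using m by (intro suminf_ennreal2) (auto intro!: summable_mult summable_geometric)
  also have "(\<Sum>j. 1296 * sqrt m * (3/4) ^ j) = 5184 * sqrt m"
    by (subst suminf_mult) (auto intro!: summable_geometric simp: suminf_geometric)
  finally show ?thesis .
qed

section \<open>The kernel of a measurable choice of radii\<close>

lemma nn_integral_lborel_circle_swap:
  assumes "(\<lambda>(y, x). f y x) \<in> borel_measurable (borel \<Otimes>\<^sub>M borel)"
  shows "(\<integral>\<^sup>+y. \<integral>\<^sup>+x. f y x \<partial>circle_measure \<partial>(lborel :: (real^2) measure)) = (\<integral>\<^sup>+x. \<integral>\<^sup>+y. f y x \<partial>lborel \<partial>circle_measure)"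
proof -
  interpret P: pair_sigma_finite "lborel :: (real^2) measure" circle_measure ..
  show ?thesis by (rule P.Fubini'[symmetric]) (use assms in measurable)
qed

text \<open>For \<open>z\<close> in the smaller disc, the larger disc translated by \<open>z\<close>
  lies in the disc of radius \<open>2 * r\<close> about the sum of the centres. The factor 4 is the
  ratio of areas, and the outer kernel has mass 1.\<close>

lemma ball_kernel_conv_le:
  assumes [measurable]: "E \<in> sets borel" and r: "0 < r'" "r' \<le> r"
  shows "(\<integral>\<^sup>+z. ball_kernel r' x' z * (\<integral>\<^sup>+y. ball_kernel r x y * indicator E (z + y) \<partial>lborel) \<partial>lborel)
    \<le> 4 * ball_avg (2 * r) (indicator E) (x + x')"
proof -
  have "(\<integral>\<^sup>+z. ball_kernel r' x' z * (\<integral>\<^sup>+y. ball_kernel r x y * indicator E (z + y) \<partial>lborel) \<partial>lborel)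
    \<le> (\<integral>\<^sup>+z. ball_kernel r' x' z * (4 * ball_avg (2 * r) (indicator E) (x + x')) \<partial>lborel)"
  proof (rule nn_integral_mono)
    fix z
    show "ball_kernel r' x' z * (\<integral>\<^sup>+y. ball_kernel r x y * indicator E (z + y) \<partial>lborel)
      \<le> ball_kernel r' x' z * (4 * ball_avg (2 * r) (indicator E) (x + x'))"
    proof (cases "dist x' z < r'")
      case True
      have "(\<integral>\<^sup>+y. ball_kernel r x y * indicator E (z + y) \<partial>lborel)
        = (\<integral>\<^sup>+y. ball_kernel r x ((y + z) - z) * indicator E (y + z) \<partial>lborel)"
        by (simp add: add.commute)
      also have "\<dots> = (\<integral>\<^sup>+y. ball_kernel r x (y - z) * indicator E y \<partial>lborel)"
        by (rule nn_integral_lborel_translate) measurable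
      also have "\<dots> \<le> (\<integral>\<^sup>+y. 4 * (ball_kernel (2 * r) (x + x') y * indicator E y) \<partial>lborel)"
      proof (rule nn_integral_mono)
        fix y
        have "dist (x + x') y \<le> dist x (y - z) + dist x' z"
          using norm_triangle_ineq[of "x - (y - z)" "x' - z"] by (simp add: dist_norm algebra_simps)
        then have "dist (x + x') y < 2 * r" if "dist x (y - z) < r" using that True r by linarith
        moreover have "ennreal (1 / (pi * r\<^sup>2)) = 4 * ennreal (1 / (pi * (2 * r)\<^sup>2))"
          by (simp add: power_mult_distrib flip: ennreal_numeral ennreal_mult)
        ultimately have "ball_kernel r x (y - z) \<le> 4 * ball_kernel (2 * r) (x + x') y"
          unfolding ball_kernel_def by auto
        then show "ball_kernel r x (y - z) * indicator E y \<le> 4 * (ball_kernel (2 * r) (x + x') y * indicator E y)"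
          by (simp add: indicator_def)
      qed
      also have "\<dots> = 4 * ball_avg (2 * r) (indicator E) (x + x')"
        unfolding ball_avg_def by (rule nn_integral_cmult) measurable
      finally show ?thesis by (rule mult_left_mono) simp
    qed (simp add: ball_kernel_def)
  qed
  also have "\<dots> = 4 * ball_avg (2 * r) (indicator E) (x + x')"
    using r by (subst nn_integral_multc) (simp_all add: nn_integral_ball_kernel)
  finally show ?thesis .
qed

text \<open>This is the function \<open>H\<close> for the radius \<open>1 / 2 ^ i x\<close>.
  Encoding the radius by its exponent makes the choice a map into a countable space. Arclength is
  not normalised, so the total mass is \<open>2 * pi\<close>.\<close>

definition circ_kernel :: "(real^2 \<Rightarrow> nat) \<Rightarrow> real^2 \<Rightarrow> ennreal" where
  "circ_kernel i y = (\<integral>\<^sup>+x. ball_kernel (1 / 2 ^ i x) x y \<partial>circle_measure)"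

lemma circ_kernel_measurable [measurable]:
  assumes [measurable]: "i \<in> borel \<rightarrow>\<^sub>M count_space UNIV"
  shows "circ_kernel i \<in> borel_measurable borel"
  unfolding circ_kernel_def[abs_def] by measurable

text \<open>Fubini moves the two integrals over the circle outside. What remains for a pair
  \<open>x\<close>, \<open>x'\<close> is a double average of \<open>E\<close> over two discs, and
  the larger of them yields one of the averages in \<open>max_indicator\<close> at
  \<open>x + x'\<close>. The radii have disappeared from this bound, so it is uniform in
  \<open>i\<close>. The constant is 4 * 5184.\<close>

lemma circ_kernel_selfconv:
  assumes [measurable]: "i \<in> borel \<rightarrow>\<^sub>M count_space UNIV" "E \<in> sets borel"
    and m: "emeasure lborel E \<le> ennreal m" "m \<ge> 0"
  shows "(\<integral>\<^sup>+z. (\<integral>\<^sup>+y. circ_kernel i y * circ_kernel i (z - y) \<partial>lborel) * indicator E z \<partial>lborel) \<le> ennreal (20736 * sqrt m)"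
proof -
  let ?H = "circ_kernel i"
  define k where "k x y = ball_kernel (1 / 2 ^ i x) x y" for x y
  have k [measurable]: "(\<lambda>p. k (f p) (g p)) \<in> borel_measurable M" if [measurable]: "f \<in> borel_measurable M" "g \<in> borel_measurable M" for f g and M :: "'z measure"
    unfolding k_def by measurable
  have H: "?H y = (\<integral>\<^sup>+x. k x y \<partial>circle_measure)" for y unfolding circ_kernel_def k_def ..
  have "(\<integral>\<^sup>+z. (\<integral>\<^sup>+y. ?H y * ?H (z - y) \<partial>lborel) * indicator E z \<partial>lborel)
    = (\<integral>\<^sup>+z. \<integral>\<^sup>+y. ?H y * ?H (z - y) * indicator E z \<partial>lborel \<partial>lborel)"
    by (simp add: nn_integral_multc)
  also have "\<dots> = (\<integral>\<^sup>+y. \<integral>\<^sup>+z. ?H y * ?H (z - y) * indicator E z \<partial>lborel \<partial>lborel)"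
    by (rule lborel_pair.Fubini') measurable
  also have "\<dots> = (\<integral>\<^sup>+y. \<integral>\<^sup>+z. ?H y * ?H z * indicator E (z + y) \<partial>lborel \<partial>lborel)"
  proof (rule nn_integral_cong)
    fix y
    have "(\<integral>\<^sup>+z. ?H y * ?H ((z + y) - y) * indicator E (z + y) \<partial>lborel) = (\<integral>\<^sup>+z. ?H y * ?H (z - y) * indicator E z \<partial>lborel)"
      by (rule nn_integral_lborel_translate[where g="\<lambda>z. ?H y * ?H (z - y) * indicator E z"]) measurable
    then show "(\<integral>\<^sup>+z. ?H y * ?H (z - y) * indicator E z \<partial>lborel) = (\<integral>\<^sup>+z. ?H y * ?H z * indicator E (z + y) \<partial>lborel)"
      by simp
  qed
  also have "\<dots> = (\<integral>\<^sup>+y. \<integral>\<^sup>+x. k x y * (\<integral>\<^sup>+z. ?H z * indicator E (z + y) \<partial>lborel) \<partial>circle_measure \<partial>lborel)"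
    by (simp add: nn_integral_multc nn_integral_cmult H mult.assoc)
  also have "\<dots> = (\<integral>\<^sup>+x. \<integral>\<^sup>+y. k x y * (\<integral>\<^sup>+z. ?H z * indicator E (z + y) \<partial>lborel) \<partial>lborel \<partial>circle_measure)"
    by (rule nn_integral_lborel_circle_swap) measurable
  also have "\<dots> = (\<integral>\<^sup>+x. \<integral>\<^sup>+y. \<integral>\<^sup>+x'. k x y * (\<integral>\<^sup>+z. k x' z * indicator E (z + y) \<partial>lborel) \<partial>circle_measure \<partial>lborel \<partial>circle_measure)"
  proof (intro nn_integral_cong)
    fix x y
    have "(\<integral>\<^sup>+z. ?H z * indicator E (z + y) \<partial>lborel) = (\<integral>\<^sup>+z. \<integral>\<^sup>+x'. k x' z * indicator E (z + y) \<partial>circle_measure \<partial>lborel)"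
      by (simp add: H nn_integral_multc)
    also have "\<dots> = (\<integral>\<^sup>+x'. \<integral>\<^sup>+z. k x' z * indicator E (z + y) \<partial>lborel \<partial>circle_measure)"
      by (rule nn_integral_lborel_circle_swap) measurable
    finally show "k x y * (\<integral>\<^sup>+z. ?H z * indicator E (z + y) \<partial>lborel) = (\<integral>\<^sup>+x'. k x y * (\<integral>\<^sup>+z. k x' z * indicator E (z + y) \<partial>lborel) \<partial>circle_measure)"
      by (simp add: nn_integral_cmult)
  qed
  also have "\<dots> = (\<integral>\<^sup>+x. \<integral>\<^sup>+x'. \<integral>\<^sup>+y. k x y * (\<integral>\<^sup>+z. k x' z * indicator E (z + y) \<partial>lborel) \<partial>lborel \<partial>circle_measure \<partial>circle_measure)"
    by (intro nn_integral_cong nn_integral_lborel_circle_swap) measurable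
  also have "\<dots> \<le> (\<integral>\<^sup>+x. \<integral>\<^sup>+x'. 4 * max_indicator E (x + x') \<partial>circle_measure \<partial>circle_measure)"
  proof (intro nn_integral_mono)
    fix x x' :: "real^2"
    have M: "4 * ball_avg (2 * (1 / 2 ^ n)) (indicator E) z \<le> 4 * max_indicator E z" for n z
      unfolding max_indicator_def by (intro mult_left_mono SUP_upper2[of n]) auto
    show "(\<integral>\<^sup>+y. k x y * (\<integral>\<^sup>+z. k x' z * indicator E (z + y) \<partial>lborel) \<partial>lborel) \<le> 4 * max_indicator E (x + x')"
    \<comment> \<open>\<open>ball_kernel_conv_le\<close> needs the larger disc inside. In the second
      case the larger disc is the outer one, and the order of integration is exchanged
      first.\<close>
    proof (cases "(1::real) / 2 ^ i x \<le> 1 / 2 ^ i x'")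
      case True
      have "(\<integral>\<^sup>+y. k x y * (\<integral>\<^sup>+z. k x' z * indicator E (z + y) \<partial>lborel) \<partial>lborel) \<le> 4 * ball_avg (2 * (1 / 2 ^ i x')) (indicator E) (x' + x)"
        using ball_kernel_conv_le[OF assms(2) _ True, of x x'] unfolding k_def by (simp add: add.commute)
      also have "\<dots> \<le> 4 * max_indicator E (x + x')" using M[of "i x'"] by (simp add: add.commute)
      finally show ?thesis .
    next
      case False
      then have le: "(1::real) / 2 ^ i x' \<le> 1 / 2 ^ i x" by simp
      have "(\<integral>\<^sup>+y. k x y * (\<integral>\<^sup>+z. k x' z * indicator E (z + y) \<partial>lborel) \<partial>lborel)
        = (\<integral>\<^sup>+y. \<integral>\<^sup>+z. k x y * k x' z * indicator E (z + y) \<partial>lborel \<partial>lborel)"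
        by (simp add: nn_integral_cmult mult.assoc)
      also have "\<dots> = (\<integral>\<^sup>+z. \<integral>\<^sup>+y. k x y * k x' z * indicator E (z + y) \<partial>lborel \<partial>lborel)"
        by (rule lborel_pair.Fubini') measurable
      also have "\<dots> = (\<integral>\<^sup>+z. k x' z * (\<integral>\<^sup>+y. k x y * indicator E (z + y) \<partial>lborel) \<partial>lborel)"
        by (simp add: nn_integral_cmult[symmetric] mult_ac)
      also have "\<dots> \<le> 4 * ball_avg (2 * (1 / 2 ^ i x)) (indicator E) (x + x')"
        using ball_kernel_conv_le[OF assms(2) _ le, of x' x] unfolding k_def by simp
      also have "\<dots> \<le> 4 * max_indicator E (x + x')" by (rule M)
      finally show ?thesis .
    qed
  qed
  also have "\<dots> = 4 * (\<integral>\<^sup>+x. \<integral>\<^sup>+x'. max_indicator E (x + x') \<partial>circle_measure \<partial>circle_measure)"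
    by (simp add: nn_integral_cmult)
  also have "\<dots> \<le> 4 * ennreal (5184 * sqrt m)"
    by (intro mult_left_mono circle_sum_maximal m) auto
  also have "\<dots> = ennreal (20736 * sqrt m)"
    using m by (simp flip: ennreal_numeral ennreal_mult)
  finally show ?thesis .
qed

lemma nn_integral_circ_kernel:
  assumes [measurable]: "i \<in> borel \<rightarrow>\<^sub>M count_space UNIV"
  shows "(\<integral>\<^sup>+y. circ_kernel i y \<partial>lborel) = ennreal (2 * pi)"
proof -
  have "(\<integral>\<^sup>+y. circ_kernel i y \<partial>lborel) = (\<integral>\<^sup>+x. \<integral>\<^sup>+y. ball_kernel (1 / 2 ^ i x) x y \<partial>lborel \<partial>circle_measure)"
    unfolding circ_kernel_def by (rule nn_integral_lborel_circle_swap) measurable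
  also have "\<dots> = ennreal (2 * pi)"
    by (simp add: nn_integral_ball_kernel emeasure_circle_measure)
  finally show ?thesis .
qed

text \<open>The cutoff \<open>N\<close> bounds the radii from below, so the kernel is bounded; discs
  of radius at most 1 centred on the unit circle lie within distance 2 of the origin. These bounds
  provide the domination by \<open>gauss\<close>.\<close>

lemma circ_kernel_le:
  assumes [measurable]: "i \<in> borel \<rightarrow>\<^sub>M count_space UNIV" and i: "\<And>x. i x \<le> N"
  shows "circ_kernel i y \<le> ennreal (2 * 4 ^ N)"
    and "2 \<le> norm y \<Longrightarrow> circ_kernel i y = 0"
proof -
  have "circ_kernel i y \<le> (\<integral>\<^sup>+x. ennreal (4 ^ N / pi) \<partial>circle_measure)"
    unfolding circ_kernel_def
  proof (intro nn_integral_mono)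
    fix x
    have "(2::real) ^ i x \<le> 2 ^ N" using i by (intro power_increasing) auto
    then have "((2::real) ^ i x)\<^sup>2 \<le> (2 ^ N)\<^sup>2" by (intro power_mono) auto
    also have "\<dots> = (4::real) ^ N" by (simp add: power_mult[symmetric] mult.commute[of N]) (simp add: power_mult)
    finally have "1 / (pi * (1 / 2 ^ i x)\<^sup>2) \<le> 4 ^ N / pi" by (simp add: power_divide divide_right_mono)
    then show "ball_kernel (1 / 2 ^ i x) x y \<le> ennreal (4 ^ N / pi)"
      unfolding ball_kernel_def by (intro ennreal_leI) auto
  qed
  also have "\<dots> = ennreal (2 * 4 ^ N)"
    by (simp add: emeasure_circle_measure flip: ennreal_mult)
  finally show "circ_kernel i y \<le> ennreal (2 * 4 ^ N)" .
  assume y: "2 \<le> norm y"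
  have "circ_kernel i y = (\<integral>\<^sup>+t. ball_kernel (1 / 2 ^ i (vector [cos t, sin t])) (vector [cos t, sin t]) y * indicator {0..<2*pi} t \<partial>lborel)"
    unfolding circ_kernel_def by (rule nn_integral_circle_measure) measurable
  also have "\<dots> = (\<integral>\<^sup>+(t::real). 0 \<partial>lborel)"
  proof (intro nn_integral_cong)
    fix t :: real
    let ?x = "vector [cos t, sin t] :: real^2"
    have "norm ?x = 1" by (simp add: norm_vec_def L2_set_def UNIV_2)
    then have "1 \<le> dist ?x y" using y norm_triangle_ineq2[of y ?x] by (simp add: dist_norm norm_minus_commute)
    moreover have "(1::real) / 2 ^ i ?x \<le> 1" by simp
    ultimately have "\<not> dist ?x y < 1 / 2 ^ i ?x" by linarith
    then show "ball_kernel (1 / 2 ^ i ?x) ?x y * indicator {0..<2*pi} t = 0" by (simp add: ball_kernel_def)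
  qed
  finally show "circ_kernel i y = 0" by simp
qed

section \<open>Fourier decay\<close>

text \<open>The last assumption says that \<open>k\<close> lies in weak \<open>L\<^sup>2\<close>, in dual form.\<close>

locale weak_kernel =
  fixes k :: "real^2 \<Rightarrow> complex" and D :: real
  assumes k: "integrable lborel k"
    and D: "D \<ge> 1"
    and L: "(\<integral>z. norm (k z) \<partial>lborel) \<le> D\<^sup>2"
    and weak: "\<And>E m. E \<in> sets borel \<Longrightarrow> m \<ge> 0 \<Longrightarrow> emeasure lborel E \<le> ennreal m \<Longrightarrow>
        (\<integral>\<^sup>+z. ennreal (norm (k z)) * indicator E z \<partial>lborel) \<le> ennreal (D * sqrt m)"
begin

lemma k_meas [measurable]: "k \<in> borel_measurable borel"
  using k by auto

text \<open>The weak bound is tested on the superlevel set itself, which gives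
  \<open>A * m \<le> D * sqrt m\<close>. Integrability of \<open>k\<close> first shows that the
  measure is finite; only then can \<open>sqrt m\<close> be cancelled.\<close>

lemma superlevel:
  assumes A: "A > 0"
  shows "emeasure lborel {z. norm (k z) > A} \<le> ennreal (D\<^sup>2 / A\<^sup>2)"
    and "(\<integral>\<^sup>+z. ennreal (norm (k z)) * indicator {z. norm (k z) > A} z \<partial>lborel) \<le> ennreal (D\<^sup>2 / A)"
proof -
  let ?E = "{z. norm (k z) > A}"
  have [measurable]: "?E \<in> sets borel" by measurable
  have le: "ennreal A * emeasure lborel ?E \<le> (\<integral>\<^sup>+z. ennreal (norm (k z)) * indicator ?E z \<partial>lborel)"
    by (subst nn_integral_cmult_indicator[symmetric]) (auto intro!: nn_integral_mono ennreal_leI simp: indicator_def)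
  also have "\<dots> \<le> (\<integral>\<^sup>+z. ennreal (norm (k z)) \<partial>lborel)"
    by (intro nn_integral_mono) (simp add: indicator_def)
  also have "\<dots> < \<infinity>" using k by (simp add: integrable_iff_bounded)
  finally have fin: "emeasure lborel ?E < \<infinity>" using A by (auto simp: ennreal_mult_less_top)
  define m where "m = measure lborel ?E"
  have m: "emeasure lborel ?E = ennreal m" "m \<ge> 0"
    using fin by (auto simp: m_def emeasure_eq_ennreal_measure)
  have w: "(\<integral>\<^sup>+z. ennreal (norm (k z)) * indicator ?E z \<partial>lborel) \<le> ennreal (D * sqrt m)"
    by (rule weak) (simp_all add: m)
  have "ennreal (A * m) \<le> ennreal (D * sqrt m)"
    using order_trans[OF le w] A m by (simp add: ennreal_mult)
  then have "A * m \<le> D * sqrt m" using D m by (simp add: ennreal_le_iff)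
  then have "sqrt m * (A * sqrt m) \<le> sqrt m * D" using m by (simp add: mult_ac)
  then have s: "A * sqrt m \<le> D" if "m > 0" using that by simp
  then have s: "sqrt m \<le> D / A" using A D m by (cases "m > 0") (auto simp: field_simps)
  then have "(sqrt m)\<^sup>2 \<le> (D / A)\<^sup>2" using m by (intro power_mono) auto
  then show "emeasure lborel ?E \<le> ennreal (D\<^sup>2 / A\<^sup>2)" unfolding m
    using m by (intro ennreal_leI) (simp add: power_divide)
  have "D * sqrt m \<le> D * (D / A)" using s D by (intro mult_left_mono) auto
  then show "(\<integral>\<^sup>+z. ennreal (norm (k z)) * indicator ?E z \<partial>lborel) \<le> ennreal (D\<^sup>2 / A)"
    by (intro order_trans[OF w] ennreal_leI) (simp add: power2_eq_square)
qed

text \<open>Below height 1 the square is at most the modulus, which is covered by the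
  \<open>L\<^sup>1\<close> bound. Each further dyadic layer adds at most
  \<open>4 * D\<^sup>2\<close>, whatever its height; the growth in \<open>n\<close> is the logarithm
  lost by weak \<open>L\<^sup>2\<close>.\<close>

lemma sublevel_square:
  "(\<integral>\<^sup>+z. ennreal ((norm (k z))\<^sup>2) * indicator {z. norm (k z) \<le> 2 ^ n} z \<partial>lborel) \<le> ennreal (D\<^sup>2 * (1 + 4 * real n))"
proof (induction n)
  case 0
  have "(\<integral>\<^sup>+z. ennreal ((norm (k z))\<^sup>2) * indicator {z. norm (k z) \<le> 2 ^ 0} z \<partial>lborel) \<le> (\<integral>\<^sup>+z. ennreal (norm (k z)) \<partial>lborel)"
    by (intro nn_integral_mono) (auto simp: indicator_def power2_eq_square mult_left_le intro!: ennreal_leI)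
  also have "\<dots> = ennreal (\<integral>z. norm (k z) \<partial>lborel)"
    using k by (intro nn_integral_eq_integral) auto
  also have "\<dots> \<le> ennreal (D\<^sup>2)" by (intro ennreal_leI L)
  finally show ?case by simp
next
  case (Suc n)
  have "(\<integral>\<^sup>+z. ennreal ((norm (k z))\<^sup>2) * indicator {z. norm (k z) \<le> 2 ^ Suc n} z \<partial>lborel)
    \<le> (\<integral>\<^sup>+z. ennreal ((norm (k z))\<^sup>2) * indicator {z. norm (k z) \<le> 2 ^ n} z + ennreal ((2 ^ Suc n)\<^sup>2) * indicator {z. norm (k z) > 2 ^ n} z \<partial>lborel)"
  proof (intro nn_integral_mono)
    fix z
    show "ennreal ((norm (k z))\<^sup>2) * indicator {z. norm (k z) \<le> 2 ^ Suc n} z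
      \<le> ennreal ((norm (k z))\<^sup>2) * indicator {z. norm (k z) \<le> 2 ^ n} z + ennreal ((2 ^ Suc n)\<^sup>2) * indicator {z. norm (k z) > 2 ^ n} z"
      by (cases "norm (k z) \<le> 2 ^ n") (auto simp: indicator_def not_le intro!: ennreal_leI power_mono simp del: power_Suc)
  qed
  also have "\<dots> = (\<integral>\<^sup>+z. ennreal ((norm (k z))\<^sup>2) * indicator {z. norm (k z) \<le> 2 ^ n} z \<partial>lborel)
     + ennreal ((2 ^ Suc n)\<^sup>2) * emeasure lborel {z. norm (k z) > 2 ^ n}"
    by (subst nn_integral_add) (auto simp: nn_integral_cmult_indicator)
  also have "\<dots> \<le> ennreal (D\<^sup>2 * (1 + 4 * real n)) + ennreal ((2 ^ Suc n)\<^sup>2) * ennreal (D\<^sup>2 / (2 ^ n)\<^sup>2)"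
    by (intro add_mono Suc mult_left_mono superlevel) auto
  also have "\<dots> = ennreal (D\<^sup>2 * (1 + 4 * real (Suc n)))"
    using D by (simp add: power_mult_distrib algebra_simps flip: ennreal_mult ennreal_plus)
  finally show ?case .
qed

text \<open>Split \<open>k\<close> at height \<open>2\<^sup>n\<close>: the large part has a small \<open>L\<^sup>1\<close> norm, so only the transform of the small part
  can exceed the level, and Plancherel applies to it.\<close>

lemma fourier_superlevel:
  "emeasure lborel {\<xi>. norm (fourier_int k \<xi>) > 2 * D\<^sup>2 / 2 ^ n} \<le> ennreal (4 ^ n / D\<^sup>2 * (1 + 4 * real n))"
proof -
  let ?E = "{z. norm (k z) \<le> 2 ^ n}"
  define u where "u z = k z * indicator ?E z" for z
  define v where "v z = k z * indicator {z. norm (k z) > 2 ^ n} z" for z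
  have [measurable]: "?E \<in> sets borel" "u \<in> borel_measurable borel" "v \<in> borel_measurable borel"
    unfolding u_def[abs_def] v_def[abs_def] by measurable
  have u: "integrable lborel u"
    by (rule Bochner_Integration.integrable_bound[OF k]) (auto simp: u_def indicator_def)
  have v: "integrable lborel v"
    by (rule Bochner_Integration.integrable_bound[OF k]) (auto simp: v_def indicator_def)
  have uv: "k = (\<lambda>z. u z + v z)" by (auto simp: u_def v_def indicator_def fun_eq_iff)
  have fuv: "fourier_int k \<xi> = fourier_int u \<xi> + fourier_int v \<xi>" for \<xi>
    by (subst uv) (rule fourier_int_add[OF u v])
  have u2: "(\<integral>\<^sup>+z. ennreal ((norm (u z))\<^sup>2) \<partial>lborel) \<le> ennreal (D\<^sup>2 * (1 + 4 * real n))"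
  proof -
    have "(\<integral>\<^sup>+z. ennreal ((norm (u z))\<^sup>2) \<partial>lborel) = (\<integral>\<^sup>+z. ennreal ((norm (k z))\<^sup>2) * indicator ?E z \<partial>lborel)"
      by (intro nn_integral_cong) (auto simp: u_def indicator_def)
    then show ?thesis using sublevel_square[of n] by simp
  qed
  have u2i: "integrable lborel (\<lambda>z. (norm (u z))\<^sup>2)"
    by (rule integrableI_bounded) (use u2 in \<open>auto intro: le_less_trans\<close>)
  have pl: "(\<integral>\<^sup>+\<xi>. ennreal ((norm (fourier_int u \<xi>))\<^sup>2) \<partial>lborel) \<le> ennreal (D\<^sup>2 * (1 + 4 * real n))"
    using plancherel_le[OF u u2i] u2 by (simp add: nn_integral_eq_integral[OF u2i] order_trans)
  have vb: "norm (fourier_int v \<xi>) \<le> D\<^sup>2 / 2 ^ n" for \<xi>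
  proof -
    have "ennreal (\<integral>z. norm (v z) \<partial>lborel) = (\<integral>\<^sup>+z. ennreal (norm (v z)) \<partial>lborel)"
      using v by (intro nn_integral_eq_integral[symmetric]) auto
    also have "\<dots> = (\<integral>\<^sup>+z. ennreal (norm (k z)) * indicator {z. norm (k z) > 2 ^ n} z \<partial>lborel)"
      by (intro nn_integral_cong) (auto simp: v_def indicator_def)
    also have "\<dots> \<le> ennreal (D\<^sup>2 / 2 ^ n)" by (rule superlevel) simp
    finally have "(\<integral>z. norm (v z) \<partial>lborel) \<le> D\<^sup>2 / 2 ^ n" by (simp add: ennreal_le_iff)
    then show ?thesis using norm_fourier_int_le[of v \<xi>] by linarith
  qed
  let ?S = "{\<xi>. norm (fourier_int k \<xi>) > 2 * D\<^sup>2 / 2 ^ n}"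
  let ?c = "(2 ^ n / D\<^sup>2)\<^sup>2"
  have [measurable]: "?S \<in> sets borel" by measurable
  have "emeasure lborel ?S = (\<integral>\<^sup>+\<xi>. indicator ?S \<xi> \<partial>lborel)" by simp
  also have "\<dots> \<le> (\<integral>\<^sup>+\<xi>. ennreal ?c * ennreal ((norm (fourier_int u \<xi>))\<^sup>2) \<partial>lborel)"
  proof (intro nn_integral_mono)
    fix \<xi>
    show "indicator ?S \<xi> \<le> ennreal ?c * ennreal ((norm (fourier_int u \<xi>))\<^sup>2)"
    proof (cases "\<xi> \<in> ?S")
      case True
      then have "D\<^sup>2 / 2 ^ n \<le> norm (fourier_int u \<xi>)"
        using fuv[of \<xi>] vb[of \<xi>] norm_triangle_ineq[of "fourier_int u \<xi>" "fourier_int v \<xi>"] by simp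
      then have "1 \<le> (2 ^ n / D\<^sup>2) * norm (fourier_int u \<xi>)" using D by (simp add: field_simps)
      then have "1\<^sup>2 \<le> ((2 ^ n / D\<^sup>2) * norm (fourier_int u \<xi>))\<^sup>2" by (intro power_mono) auto
      then have "1 \<le> ?c * (norm (fourier_int u \<xi>))\<^sup>2" by (simp only: power_mult_distrib one_power2)
      then have "ennreal 1 \<le> ennreal (?c * (norm (fourier_int u \<xi>))\<^sup>2)" by (rule ennreal_leI)
      then show ?thesis using True by (simp add: ennreal_mult')
    qed simp
  qed
  also have "\<dots> = ennreal ?c * (\<integral>\<^sup>+\<xi>. ennreal ((norm (fourier_int u \<xi>))\<^sup>2) \<partial>lborel)"
    by (rule nn_integral_cmult) measurable
  also have "\<dots> \<le> ennreal ?c * ennreal (D\<^sup>2 * (1 + 4 * real n))" by (intro mult_left_mono pl) simp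
  also have "\<dots> = ennreal (4 ^ n / D\<^sup>2 * (1 + 4 * real n))"
  proof -
    have "(2::real) ^ n * 2 ^ n = 4 ^ n" by (simp flip: power_mult_distrib)
    then have "?c * (D\<^sup>2 * (1 + 4 * real n)) = 4 ^ n / D\<^sup>2 * (1 + 4 * real n)"
      using D by (simp add: power2_eq_square divide_simps)
    then show ?thesis by (simp flip: ennreal_mult)
  qed
  finally show ?thesis .
qed

text \<open>Halving the level multiplies the measure bound by 4, up to a linear factor, and the
  power by \<open>2 powr (- t)\<close>. The ratio \<open>4 * 2 powr (- t)\<close> is below 1 exactly
  for \<open>t > 2\<close>, and the linear factor turns the geometric series into its derivative.
  The 9 comes from \<open>1 + 4 * (n + 1) \<le> 9 * (n + 1)\<close>.\<close>

lemma fourier_powr_integral: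
  assumes t: "t > 2"
  shows "(\<integral>\<^sup>+\<xi>. ennreal (norm (fourier_int k \<xi>) powr t) \<partial>lborel)
     \<le> ennreal ((2 * D\<^sup>2) powr t * (4 / D\<^sup>2) * 9 * (1 / (1 - 4 * 2 powr (- t))\<^sup>2))"
proof -
  define q where "q = 4 * 2 powr (- t)"
  have q: "0 \<le> q" "q < 1"
  proof -
    have "2 powr (- t) < 2 powr (- 2 :: real)" using t by (intro powr_less_mono) auto
    then show "q < 1" by (simp add: q_def powr_minus powr_numeral)
  qed (simp add: q_def)
  define l where "l n = 2 * D\<^sup>2 / 2 ^ n" for n :: nat
  have l: "l n > 0" for n using D by (simp add: l_def)
  define S where "S n = {\<xi>. norm (fourier_int k \<xi>) > l n}" for n
  have [measurable]: "S n \<in> sets borel" for n unfolding S_def by measurable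
  have pt: "ennreal (norm (fourier_int k \<xi>) powr t) \<le> (\<Sum>n. ennreal (l n powr t) * indicator (S (Suc n)) \<xi>)" for \<xi>
  proof (cases "fourier_int k \<xi> = 0")
    case False
    define w where "w = norm (fourier_int k \<xi>)"
    have w: "w > 0" using False by (simp add: w_def)
    \<comment> \<open>The transform is bounded by the \<open>L\<^sup>1\<close> norm, so the levels
      \<open>l n\<close> start above its supremum and every nonzero value falls between two of
      them.\<close>
    have "w \<le> D\<^sup>2" unfolding w_def using norm_fourier_int_le[of k \<xi>] L by linarith
    then have "0 < w / (2 * D\<^sup>2)" "w / (2 * D\<^sup>2) \<le> 1" using w D by auto
    then obtain n where "(1/2) ^ Suc n < w / (2 * D\<^sup>2)" "w / (2 * D\<^sup>2) \<le> (1/2) ^ n" using dyadic_bracket by blast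
    then have j: "l (Suc n) < w" and wn: "w \<le> l n"
      using D by (simp_all add: l_def field_simps power_one_over)
    define f where "f = (\<lambda>n. ennreal (l n powr t) * indicator (S (Suc n)) \<xi>)"
    have "ennreal (w powr t) \<le> ennreal (l n powr t)" using wn w t by (intro ennreal_leI powr_mono2) auto
    also have "\<dots> = f n" using j by (simp add: f_def S_def w_def)
    also have "\<dots> = sum f {n}" by simp
    also have "\<dots> \<le> suminf f" by (rule sum_le_suminf) (auto intro: summableI)
    finally show ?thesis unfolding f_def w_def .
  qed (use t in simp)
  define c where "c = (2 * D\<^sup>2) powr t * (4 / D\<^sup>2) * 9"
  have c0: "c \<ge> 0" by (simp add: c_def)
  have tm: "ennreal (l n powr t) * emeasure lborel (S (Suc n)) \<le> ennreal (c * (real (Suc n) * q ^ n))" for n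
  proof -
    have "ennreal (l n powr t) * emeasure lborel (S (Suc n)) \<le> ennreal (l n powr t) * ennreal (4 ^ Suc n / D\<^sup>2 * (1 + 4 * real (Suc n)))"
      unfolding S_def l_def by (rule mult_left_mono, rule fourier_superlevel, simp)
    also have "\<dots> = ennreal (l n powr t * (4 ^ Suc n / D\<^sup>2 * (1 + 4 * real (Suc n))))"
      by (rule ennreal_mult'[symmetric]) simp
    also have "\<dots> \<le> ennreal (c * (real (Suc n) * q ^ n))"
    proof (rule ennreal_leI)
      have "l n powr t = (2 * D\<^sup>2) powr t * (2 powr (- t)) ^ n"
      proof -
        have "(2 ^ n :: real) powr t = (2 powr t) ^ n"
          by (simp add: powr_realpow[symmetric] powr_powr mult.commute)
        moreover have "l n powr t = (2 * D\<^sup>2) powr t / (2 ^ n) powr t"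
          unfolding l_def by (rule powr_divide)
        ultimately show ?thesis by (simp add: powr_minus divide_inverse power_inverse)
      qed
      then have "l n powr t * (4 ^ Suc n / D\<^sup>2 * (1 + 4 * real (Suc n))) = (2 * D\<^sup>2) powr t * (4 / D\<^sup>2) * (1 + 4 * real (Suc n)) * q ^ n"
        by (simp add: q_def power_mult_distrib)
      also have "\<dots> \<le> (2 * D\<^sup>2) powr t * (4 / D\<^sup>2) * (9 * real (Suc n)) * q ^ n"
        using q by (intro mult_right_mono mult_left_mono) auto
      also have "\<dots> = c * (real (Suc n) * q ^ n)" unfolding c_def by (simp only: mult_ac)
      finally show "l n powr t * (4 ^ Suc n / D\<^sup>2 * (1 + 4 * real (Suc n))) \<le> c * (real (Suc n) * q ^ n)" .
    qed
    finally show ?thesis .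
  qed
  have sums: "(\<lambda>n. c * (real (Suc n) * q ^ n)) sums (c * (1 / (1 - q)\<^sup>2))"
    using geometric_deriv_sums[of q] q by (intro sums_mult) auto
  have "(\<integral>\<^sup>+\<xi>. ennreal (norm (fourier_int k \<xi>) powr t) \<partial>lborel) \<le> (\<integral>\<^sup>+\<xi>. (\<Sum>n. ennreal (l n powr t) * indicator (S (Suc n)) \<xi>) \<partial>lborel)"
    by (intro nn_integral_mono pt)
  also have "\<dots> = (\<Sum>n. ennreal (l n powr t) * emeasure lborel (S (Suc n)))"
    by (subst nn_integral_suminf) (auto simp: nn_integral_cmult_indicator)
  also have "\<dots> \<le> (\<Sum>n. ennreal (c * (real (Suc n) * q ^ n)))"
    by (intro suminf_le tm summableI)
  also have "\<dots> = ennreal (\<Sum>n. c * (real (Suc n) * q ^ n))"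
    using c0 q sums by (intro suminf_ennreal2) (auto simp: sums_iff)
  also have "(\<Sum>n. c * (real (Suc n) * q ^ n)) = c * (1 / (1 - q)\<^sup>2)" using sums by (simp add: sums_iff)
  finally show ?thesis unfolding c_def q_def by (simp add: mult_ac)
qed

end

text \<open>The transform of \<open>k = fconv h h\<close> is the square of that of \<open>h\<close>,
  so the exponent \<open>s\<close> for \<open>h\<close> becomes \<open>s / 2 > 2\<close> for
  \<open>k\<close>. The constant depends on \<open>s\<close> alone, not on the choice of radii or on
  the phase of \<open>h\<close>.\<close>

lemma fourier_circ_kernel_powr:
  fixes s :: real
  assumes s: "s > 4"
  shows "\<exists>C\<ge>0. \<forall>i N h. i \<in> borel \<rightarrow>\<^sub>M count_space UNIV \<longrightarrow> (\<forall>x. i x \<le> N) \<longrightarrow> h \<in> borel_measurable borel \<longrightarrow>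
     (\<forall>y. ennreal (norm (h y)) \<le> circ_kernel i y) \<longrightarrow>
     (\<integral>\<^sup>+\<xi>. ennreal (norm (fourier_int h \<xi>) powr s) \<partial>lborel) \<le> ennreal C"
proof -
  \<comment> \<open>The number is the constant of \<open>circ_kernel_selfconv\<close>. It also
    exceeds \<open>2 * pi\<close>, so that \<open>D\<^sup>2\<close> bounds the total mass of the
    convolution.\<close>
  define D :: real where "D = 20736"
  define C where "C = (2 * D\<^sup>2) powr (s / 2) * (4 / D\<^sup>2) * 9 * (1 / (1 - 4 * 2 powr (- (s / 2)))\<^sup>2)"
  show ?thesis
  proof (intro exI[of _ C] conjI allI impI)
    show "0 \<le> C" by (simp add: C_def)
    fix i N and h :: "real^2 \<Rightarrow> complex"
    assume i [measurable]: "i \<in> borel \<rightarrow>\<^sub>M count_space UNIV" and N: "\<forall>x. i x \<le> N"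
      and hm [measurable]: "h \<in> borel_measurable borel" and hb: "\<forall>y. ennreal (norm (h y)) \<le> circ_kernel i y"
    have hi: "(\<integral>\<^sup>+y. ennreal (norm (h y)) \<partial>lborel) \<le> ennreal (2 * pi)"
      using nn_integral_mono[of lborel "\<lambda>y. ennreal (norm (h y))" "circ_kernel i"] hb
      by (simp add: nn_integral_circ_kernel[OF i])
    have h: "integrable lborel h"
      by (rule integrableI_bounded) (use hi in \<open>auto intro: le_less_trans\<close>)
    define k where "k = fconv h h"
    have km [measurable]: "k \<in> borel_measurable borel" unfolding k_def by measurable
    have kint: "integrable lborel k" unfolding k_def by (rule integrable_fconv[OF h h])
    have kb: "ennreal (norm (k z)) \<le> (\<integral>\<^sup>+y. circ_kernel i y * circ_kernel i (z - y) \<partial>lborel)" for z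
    proof -
      \<comment> \<open>Where the product is not integrable, the Bochner integral is 0 and the bound
        is trivial.\<close>
      have "ennreal (norm (k z)) \<le> (\<integral>\<^sup>+y. ennreal (norm (h y * h (z - y))) \<partial>lborel)"
        unfolding k_def fconv_def 
        by (cases "integrable lborel (\<lambda>y. h y * h (z - y))")
           (auto intro: integral_norm_bound_ennreal simp: not_integrable_integral_eq)
      also have "\<dots> \<le> (\<integral>\<^sup>+y. circ_kernel i y * circ_kernel i (z - y) \<partial>lborel)"
        using hb by (intro nn_integral_mono) (simp add: norm_mult ennreal_mult mult_mono)
      finally show ?thesis .
    qed
    interpret weak_kernel k D
    proof
      show "integrable lborel k" by fact
      show "1 \<le> D" by (simp add: D_def)
      have "ennreal (\<integral>z. norm (k z) \<partial>lborel) = (\<integral>\<^sup>+z. ennreal (norm (k z)) \<partial>lborel)"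
        using kint by (intro nn_integral_eq_integral[symmetric]) auto
      also have "\<dots> \<le> (\<integral>\<^sup>+z. (\<integral>\<^sup>+y. circ_kernel i y * circ_kernel i (z - y) \<partial>lborel) \<partial>lborel)"
        by (intro nn_integral_mono kb)
      also have "\<dots> = (\<integral>\<^sup>+y. (\<integral>\<^sup>+z. circ_kernel i y * circ_kernel i (z - y) \<partial>lborel) \<partial>lborel)"
        by (rule lborel_pair.Fubini') measurable
      also have "\<dots> = (\<integral>\<^sup>+y. circ_kernel i y * ennreal (2 * pi) \<partial>lborel)"
      proof (intro nn_integral_cong)
        fix y
        have "(\<integral>\<^sup>+z. circ_kernel i (z + - y) \<partial>lborel) = (\<integral>\<^sup>+z. circ_kernel i z \<partial>lborel)"
          by (rule nn_integral_lborel_translate) measurable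
        then show "(\<integral>\<^sup>+z. circ_kernel i y * circ_kernel i (z - y) \<partial>lborel) = circ_kernel i y * ennreal (2 * pi)"
          by (subst nn_integral_cmult) (auto simp: nn_integral_circ_kernel[OF i])
      qed
      also have "\<dots> = ennreal (2 * pi) * ennreal (2 * pi)"
        by (subst nn_integral_multc) (auto simp: nn_integral_circ_kernel[OF i])
      also have "\<dots> = ennreal ((2 * pi)\<^sup>2)" by (simp add: power2_eq_square flip: ennreal_mult)
      also have "\<dots> \<le> ennreal (D\<^sup>2)"
        using pi_less_4 by (intro ennreal_leI power_mono) (auto simp: D_def)
      finally show "(\<integral>z. norm (k z) \<partial>lborel) \<le> D\<^sup>2" by (simp add: ennreal_le_iff)
      fix E and m :: real
      assume E [measurable]: "E \<in> sets (borel :: (real^2) measure)" and m: "0 \<le> m" "emeasure lborel E \<le> ennreal m"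
      have "(\<integral>\<^sup>+z. ennreal (norm (k z)) * indicator E z \<partial>lborel) \<le> (\<integral>\<^sup>+z. (\<integral>\<^sup>+y. circ_kernel i y * circ_kernel i (z - y) \<partial>lborel) * indicator E z \<partial>lborel)"
        by (intro nn_integral_mono mult_right_mono kb) simp
      also have "\<dots> \<le> ennreal (20736 * sqrt m)"
        by (rule circ_kernel_selfconv[OF i E m(2,1)])
      finally show "(\<integral>\<^sup>+z. ennreal (norm (k z)) * indicator E z \<partial>lborel) \<le> ennreal (D * sqrt m)"
        by (simp add: D_def)
    qed
    have "norm (fourier_int h \<xi>) powr s = norm (fourier_int k \<xi>) powr (s / 2)" for \<xi>
    proof -
      have "norm (fourier_int k \<xi>) = norm (fourier_int h \<xi>) * norm (fourier_int h \<xi>)"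
        unfolding k_def fourier_int_fconv[OF h h] norm_mult ..
      then show ?thesis by (simp add: powr_mult powr_add[symmetric])
    qed
    then show "(\<integral>\<^sup>+\<xi>. ennreal (norm (fourier_int h \<xi>) powr s) \<partial>lborel) \<le> ennreal C"
      using fourier_powr_integral[of "s / 2"] s unfolding C_def by simp
  qed
qed

section \<open>Duality and density\<close>

lemma integrable_gauss: "integrable lborel gauss"
proof -
  have "integrable lborel (\<lambda>x::real^2. Re (complex_of_real (exp (- (sqrt 2)\<^sup>2 * (x \<bullet> x) / 2))))"
    by (rule integrable_Re[OF gaussian_vec2(1)]) simp
  then show ?thesis by (simp add: gauss_def[abs_def])
qed

lemma gauss_dominated_integrable:
  fixes h :: "real^2 \<Rightarrow> complex"
  assumes [measurable]: "h \<in> borel_measurable borel" and b: "AE x in lborel. norm (h x) \<le> c * gauss x"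
  shows "integrable lborel h" and "integrable lborel (\<lambda>x. (norm (h x))\<^sup>2)"
proof -
  have g: "integrable lborel (\<lambda>x. c * gauss x)" "integrable lborel (\<lambda>x. c\<^sup>2 * gauss x)"
    using integrable_gauss by auto
  show "integrable lborel h"
    by (rule Bochner_Integration.integrable_bound[OF g(1)]) (use b in \<open>auto elim: order_trans[rotated]\<close>)
  show "integrable lborel (\<lambda>x. (norm (h x))\<^sup>2)"
  proof (rule Bochner_Integration.integrable_bound[OF g(2)])
    show "AE x in lborel. norm ((norm (h x))\<^sup>2) \<le> norm (c\<^sup>2 * gauss x)"
      using b
    proof eventually_elim
      case (elim x)
      have "(norm (h x))\<^sup>2 \<le> (c * gauss x)\<^sup>2" using elim by (intro power_mono) auto
      also have "\<dots> = c\<^sup>2 * (gauss x * gauss x)" by (simp add: power2_eq_square mult_ac)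
      also have "\<dots> \<le> c\<^sup>2 * gauss x" by (intro mult_left_mono mult_left_le gauss_le_1) auto
      finally show ?case by simp
    qed
  qed measurable
qed

lemma integrable_mult_gauss_dominated:
  fixes F u :: "real^2 \<Rightarrow> complex"
  assumes [measurable]: "F \<in> borel_measurable borel" "u \<in> borel_measurable borel"
    and FG: "integrable lborel (\<lambda>x. F x * complex_of_real (gauss x))"
    and b: "AE x in lborel. norm (u x) \<le> c * gauss x"
  shows "integrable lborel (\<lambda>x. F x * u x)"
proof (rule Bochner_Integration.integrable_bound)
  show "integrable lborel (\<lambda>x. complex_of_real c * (F x * complex_of_real (gauss x)))" using FG by simp
  show "AE x in lborel. norm (F x * u x) \<le> norm (complex_of_real c * (F x * complex_of_real (gauss x)))"
    using b
  proof eventually_elim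
    case (elim x)
    have "norm (F x) * norm (u x) \<le> norm (F x) * (\<bar>c\<bar> * gauss x)"
      using elim by (intro mult_left_mono order_trans[OF elim] mult_right_mono) auto
    then show ?case by (simp add: norm_mult mult_ac)
  qed
qed measurable

text \<open>This replaces the Hausdorff-Young inequality. Where \<open>\<bar>f\<bar> > 1\<close>,
  \<open>\<bar>f\<bar>\<close> is at most its power \<open>p\<close> and the transform is bounded by
  the \<open>L\<^sup>1\<close> norm of \<open>d\<close>. Elsewhere the square of
  \<open>\<bar>f\<bar>\<close> is at most its power \<open>p\<close>, and a weighted mean inequality
  leads to Plancherel. The parameter \<open>\<eta>\<close> makes the bound small when
  \<open>d\<close> is small in both norms.\<close>

lemma Lp_fourier_pairing:
  fixes f d :: "real^2 \<Rightarrow> complex"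
  assumes p: "1 \<le> p" "p \<le> 2" and f: "in_Lp p f"
    and d: "integrable lborel d" "integrable lborel (\<lambda>x. (norm (d x))\<^sup>2)" and e: "\<eta> > 0"
  shows "(\<integral>\<^sup>+x. ennreal (norm (f x * fourier_int d x)) \<partial>lborel)
    \<le> ennreal ((\<integral>x. norm (f x) powr p \<partial>lborel) * ((\<integral>x. norm (d x) \<partial>lborel) + \<eta>) + (\<integral>x. (norm (d x))\<^sup>2 \<partial>lborel) / \<eta>)"
proof -
  have [measurable]: "f \<in> borel_measurable borel" "d \<in> borel_measurable borel"
    using f d by (auto simp: in_Lp_def)
  have fi: "integrable lborel (\<lambda>x. norm (f x) powr p)" using f by (simp add: in_Lp_def)
  let ?B = "\<integral>x. norm (f x) powr p \<partial>lborel" and ?L = "\<integral>x. norm (d x) \<partial>lborel"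
  have pt: "norm (f x * fourier_int d x) \<le> norm (f x) powr p * (?L + \<eta>) + (1 / \<eta>) * (norm (fourier_int d x))\<^sup>2" for x
  proof (cases "norm (f x) > 1")
    case True
    then have "norm (f x) powr 1 \<le> norm (f x) powr p" using p by (intro powr_mono) auto
    then have "norm (f x) * norm (fourier_int d x) \<le> norm (f x) powr p * ?L"
      using True by (intro mult_mono norm_fourier_int_le) auto
    moreover have "0 \<le> norm (f x) powr p * \<eta> + (1 / \<eta>) * (norm (fourier_int d x))\<^sup>2" using e by simp
    ultimately show ?thesis unfolding norm_mult distrib_left by linarith
  next
    case False
    have "(norm (f x))\<^sup>2 \<le> norm (f x) powr p"
    proof (cases "f x = 0")
      case nz: False
      have "norm (f x) powr 2 \<le> norm (f x) powr p" using False nz p by (intro powr_mono') auto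
      then show ?thesis using nz by (simp add: powr_numeral)
    qed simp
    then have 1: "\<eta> * (norm (f x))\<^sup>2 \<le> \<eta> * norm (f x) powr p" using e by (intro mult_left_mono) auto
    have "0 \<le> (\<eta> * norm (f x) - norm (fourier_int d x))\<^sup>2" by simp
    then have "2 * (\<eta> * (norm (f x) * norm (fourier_int d x))) \<le> \<eta>\<^sup>2 * (norm (f x))\<^sup>2 + (norm (fourier_int d x))\<^sup>2"
      by (simp add: power2_diff power_mult_distrib mult_ac)
    also have "\<dots> = \<eta> * (\<eta> * (norm (f x))\<^sup>2 + (1 / \<eta>) * (norm (fourier_int d x))\<^sup>2)"
      using e by (simp add: field_simps power2_eq_square)
    finally have "\<eta> * (2 * (norm (f x) * norm (fourier_int d x))) \<le> \<eta> * (\<eta> * (norm (f x))\<^sup>2 + (1 / \<eta>) * (norm (fourier_int d x))\<^sup>2)"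
      by (simp add: mult_ac)
    then have "2 * (norm (f x) * norm (fourier_int d x)) \<le> \<eta> * (norm (f x))\<^sup>2 + (1 / \<eta>) * (norm (fourier_int d x))\<^sup>2"
      using e by (simp only: mult_le_cancel_left_pos)
    moreover have "0 \<le> norm (f x) * norm (fourier_int d x)" "0 \<le> norm (f x) powr p * ?L" by auto
    ultimately show ?thesis using 1 unfolding norm_mult distrib_left by (simp only: mult.commute[of "norm (f x) powr p" \<eta>])
  qed
  have "(\<integral>\<^sup>+x. ennreal (norm (f x * fourier_int d x)) \<partial>lborel)
    \<le> (\<integral>\<^sup>+x. ennreal (norm (f x) powr p * (?L + \<eta>)) + ennreal (1 / \<eta>) * ennreal ((norm (fourier_int d x))\<^sup>2) \<partial>lborel)"
    using e by (intro nn_integral_mono) (use pt in \<open>auto intro!: ennreal_leI simp flip: ennreal_mult ennreal_plus\<close>)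
  also have "\<dots> = (\<integral>\<^sup>+x. ennreal (norm (f x) powr p * (?L + \<eta>)) \<partial>lborel) + ennreal (1 / \<eta>) * (\<integral>\<^sup>+x. ennreal ((norm (fourier_int d x))\<^sup>2) \<partial>lborel)"
    by (subst nn_integral_add) (auto simp: nn_integral_cmult)
  also have "\<dots> \<le> ennreal (?B * (?L + \<eta>)) + ennreal (1 / \<eta>) * ennreal (\<integral>x. (norm (d x))\<^sup>2 \<partial>lborel)"
  proof (intro add_mono mult_left_mono plancherel_le d)
    have "(\<integral>\<^sup>+x. ennreal (norm (f x) powr p * (?L + \<eta>)) \<partial>lborel) = ennreal (\<integral>x. norm (f x) powr p * (?L + \<eta>) \<partial>lborel)"
      using fi e by (intro nn_integral_eq_integral) auto
    then show "(\<integral>\<^sup>+x. ennreal (norm (f x) powr p * (?L + \<eta>)) \<partial>lborel) \<le> ennreal (?B * (?L + \<eta>))"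
      by simp
  qed simp
  also have "\<dots> = ennreal (?B * (?L + \<eta>) + (\<integral>x. (norm (d x))\<^sup>2 \<partial>lborel) / \<eta>)"
    using e by (simp flip: ennreal_mult ennreal_plus)
  finally show ?thesis .
qed

lemma Lp_fourier_pairing_integrable:
  fixes f d :: "real^2 \<Rightarrow> complex"
  assumes p: "1 \<le> p" "p \<le> 2" and f: "in_Lp p f"
    and d: "integrable lborel d" "integrable lborel (\<lambda>x. (norm (d x))\<^sup>2)"
  shows "integrable lborel (\<lambda>x. f x * fourier_int d x)"
proof -
  have [measurable]: "f \<in> borel_measurable borel" "d \<in> borel_measurable borel"
    using f d by (auto simp: in_Lp_def)
  show ?thesis
    by (rule integrableI_bounded) (use Lp_fourier_pairing[OF p f d, of 1] in \<open>auto intro: le_less_trans\<close>)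
qed

lemma fourier_transform_gauss_integrable:
  assumes "is_fourier_transform f F"
  shows "integrable lborel (\<lambda>x. F x * complex_of_real (gauss x))"
  using assms gauss_schwartz_gauss by (auto simp: is_fourier_transform_def gauss_schwartz_def)

text \<open>The identity defines \<open>F\<close> on Schwartz functions only, but the dual function
  of the maximal estimate is merely Borel. Linear combinations and dominated limits preserve the
  identity, so \<open>gauss_dominated_induct\<close> applies.\<close>

lemma fourier_transform_dual:
  fixes f F h :: "real^2 \<Rightarrow> complex"
  assumes p: "1 \<le> p" "p \<le> 2" and f: "in_Lp p f" and F: "is_fourier_transform f F"
    and h: "h \<in> borel_measurable borel" "\<And>x. norm (h x) \<le> c * gauss x"
  shows "(\<integral>\<xi>. F \<xi> * h \<xi> \<partial>lborel) = (\<integral>x. f x * fourier_int h x \<partial>lborel)"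
proof -
  have [measurable]: "F \<in> borel_measurable borel" "f \<in> borel_measurable borel"
    using F f by (auto simp: is_fourier_transform_def in_Lp_def)
  note FG = fourier_transform_gauss_integrable[OF F]
  \<comment> \<open>The Gaussian bound is required almost everywhere only, because that is all a
    limit almost everywhere inherits.\<close>
  define P where "P h \<longleftrightarrow> h \<in> borel_measurable borel \<and> (\<exists>c. AE x in lborel. norm (h x) \<le> c * gauss x) \<and>
     (\<integral>\<xi>. F \<xi> * h \<xi> \<partial>lborel) = (\<integral>x. f x * fourier_int h x \<partial>lborel)" for h
  have Fh: "integrable lborel (\<lambda>x. F x * u x)"
    if "u \<in> borel_measurable borel" "AE x in lborel. norm (u x) \<le> c * gauss x" for u c
    using integrable_mult_gauss_dominated[OF _ _ FG] that by simp
  have "P h"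
  proof (rule gauss_dominated_induct[OF h])
    fix A B :: "real poly"
    assume A: "\<And>t. t\<^sup>2 \<le> poly A t" and B: "\<And>t. t\<^sup>2 \<le> poly B t"
    let ?u = "\<lambda>x::real^2. complex_of_real (exp (- poly A (x $ 1) - poly B (x $ 2)))"
    have u: "gauss_schwartz ?u" by (rule gauss_schwartz_exp_poly[OF A B])
    then have "(\<integral>\<xi>. F \<xi> * ?u \<xi> \<partial>lborel) = (\<integral>x. f x * fourier_int ?u x \<partial>lborel)"
      using F by (auto simp: is_fourier_transform_def gauss_schwartz_def)
    with u show "P ?u" unfolding P_def gauss_schwartz_def by (blast intro: AE_I2)
  next
    fix a u v assume u: "P u" and v: "P v"
    obtain c1 c2 where b: "AE x in lborel. norm (u x) \<le> c1 * gauss x" "AE x in lborel. norm (v x) \<le> c2 * gauss x"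
      using u v unfolding P_def by blast
    have [measurable]: "u \<in> borel_measurable borel" "v \<in> borel_measurable borel" using u v unfolding P_def by auto
    note ui = gauss_dominated_integrable[OF _ b(1)] and vi = gauss_dominated_integrable[OF _ b(2)]
    have "AE x in lborel. norm (a * u x + v x) \<le> (norm a * c1 + c2) * gauss x"
      using b
    proof eventually_elim
      case (elim x)
      have "norm (a * u x + v x) \<le> norm a * norm (u x) + norm (v x)" by (metis norm_mult norm_triangle_ineq)
      also have "\<dots> \<le> norm a * (c1 * gauss x) + c2 * gauss x" using elim by (intro add_mono mult_left_mono) auto
      finally show ?case by (simp add: algebra_simps)
    qed
    moreover have "(\<integral>\<xi>. F \<xi> * (a * u \<xi> + v \<xi>) \<partial>lborel) = a * (\<integral>\<xi>. F \<xi> * u \<xi> \<partial>lborel) + (\<integral>\<xi>. F \<xi> * v \<xi> \<partial>lborel)"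
    proof -
      have "(\<integral>\<xi>. F \<xi> * (a * u \<xi> + v \<xi>) \<partial>lborel) = (\<integral>\<xi>. a * (F \<xi> * u \<xi>) + F \<xi> * v \<xi> \<partial>lborel)"
        by (simp add: algebra_simps)
      also have "\<dots> = a * (\<integral>\<xi>. F \<xi> * u \<xi> \<partial>lborel) + (\<integral>\<xi>. F \<xi> * v \<xi> \<partial>lborel)"
        using Fh[OF _ b(1)] Fh[OF _ b(2)] by (subst Bochner_Integration.integral_add) auto
      finally show ?thesis .
    qed
    moreover have "(\<integral>x. f x * fourier_int (\<lambda>x. a * u x + v x) x \<partial>lborel) = a * (\<integral>x. f x * fourier_int u x \<partial>lborel) + (\<integral>x. f x * fourier_int v x \<partial>lborel)"
    proof -
      have "(\<integral>x. f x * fourier_int (\<lambda>x. a * u x + v x) x \<partial>lborel) = (\<integral>x. a * (f x * fourier_int u x) + f x * fourier_int v x \<partial>lborel)"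
        using ui vi by (subst fourier_int_add) (auto simp: fourier_int_cmult algebra_simps)
      also have "\<dots> = a * (\<integral>x. f x * fourier_int u x \<partial>lborel) + (\<integral>x. f x * fourier_int v x \<partial>lborel)"
        using Lp_fourier_pairing_integrable[OF p f ui] Lp_fourier_pairing_integrable[OF p f vi]
        by (subst Bochner_Integration.integral_add) auto
      finally show ?thesis .
    qed
    ultimately show "P (\<lambda>x. a * u x + v x)" using u v unfolding P_def by auto
  next
    fix u v C
    assume u: "\<And>n::nat. P (u n)" and b: "\<And>n x. norm (u n x) \<le> C * gauss x"
      and v [measurable]: "v \<in> borel_measurable borel" and lim: "AE x in lborel. (\<lambda>n. u n x) \<longlonglongrightarrow> v x"
    have [measurable]: "u n \<in> borel_measurable borel" for n using u unfolding P_def by auto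
    have vb: "AE x in lborel. norm (v x) \<le> C * gauss x"
      using lim
    proof eventually_elim
      case (elim x)
      show ?case by (rule tendsto_upperbound[OF tendsto_norm[OF elim]]) (auto simp: b)
    qed
    have gi: "integrable lborel (\<lambda>x. 2 * C * gauss x)" "integrable lborel (\<lambda>x. 4 * C\<^sup>2 * gauss x)" using integrable_gauss by auto
    have ui: "integrable lborel (u n)" "integrable lborel (\<lambda>x. (norm (u n x))\<^sup>2)" for n
      by (rule gauss_dominated_integrable[OF _ AE_I2[OF b]]; simp)+
    note vi = gauss_dominated_integrable[OF v vb]
    define d where "d n x = u n x - v x" for n x
    have [measurable]: "d n \<in> borel_measurable borel" for n unfolding d_def[abs_def] by measurable
    have db: "AE x in lborel. norm (d n x) \<le> (2 * C) * gauss x" for n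
      using vb
    proof eventually_elim
      case (elim x)
      show ?case using norm_triangle_ineq4[of "u n x" "v x"] b[of n x] elim unfolding d_def by linarith
    qed
    have di: "integrable lborel (d n)" "integrable lborel (\<lambda>x. (norm (d n x))\<^sup>2)" for n
      by (rule gauss_dominated_integrable[OF _ db]; simp)+
    have fd: "fourier_int (d n) x = fourier_int (u n) x - fourier_int v x" for n x
      unfolding d_def[abs_def] by (rule fourier_int_diff[OF ui(1) vi(1)])
    have dl: "AE x in lborel. (\<lambda>n. d n x) \<longlonglongrightarrow> 0"
      using lim by eventually_elim (simp add: d_def LIM_zero_iff)
    have l1: "(\<lambda>n. \<integral>x. norm (d n x) \<partial>lborel) \<longlonglongrightarrow> (\<integral>(x::real^2). 0 \<partial>lborel)"
    proof (rule integral_dominated_convergence[OF _ _ gi(1)])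
      show "AE x in lborel. (\<lambda>n. norm (d n x)) \<longlonglongrightarrow> 0"
        using dl by eventually_elim (rule tendsto_norm_zero)
    qed (use db in auto)
    have l2: "(\<lambda>n. \<integral>x. (norm (d n x))\<^sup>2 \<partial>lborel) \<longlonglongrightarrow> (\<integral>(x::real^2). 0 \<partial>lborel)"
    proof (rule integral_dominated_convergence[OF _ _ gi(2)])
      show "AE x in lborel. (\<lambda>n. (norm (d n x))\<^sup>2) \<longlonglongrightarrow> 0"
        using dl by eventually_elim (auto intro!: tendsto_eq_intros)
      show "AE x in lborel. norm ((norm (d n x))\<^sup>2) \<le> 4 * C\<^sup>2 * gauss x" for n
        using db[of n]
      proof eventually_elim
        case (elim x)
        have "(norm (d n x))\<^sup>2 \<le> (2 * C * gauss x)\<^sup>2" using elim by (intro power_mono) auto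
        also have "\<dots> = 4 * C\<^sup>2 * (gauss x * gauss x)" by (simp add: power2_eq_square mult_ac)
        also have "\<dots> \<le> 4 * C\<^sup>2 * gauss x" by (intro mult_left_mono mult_left_le gauss_le_1) auto
        finally show ?case by simp
      qed
    qed auto
    have L: "(\<lambda>n. \<integral>\<xi>. F \<xi> * u n \<xi> \<partial>lborel) \<longlonglongrightarrow> (\<integral>\<xi>. F \<xi> * v \<xi> \<partial>lborel)"
    proof (rule integral_dominated_convergence[where w="\<lambda>x. \<bar>C\<bar> * norm (F x * complex_of_real (gauss x))"])
      show "AE x in lborel. (\<lambda>n. F x * u n x) \<longlonglongrightarrow> F x * v x"
        using lim by eventually_elim (intro tendsto_intros)
      show "AE x in lborel. norm (F x * u n x) \<le> \<bar>C\<bar> * norm (F x * complex_of_real (gauss x))" for n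
      proof (rule AE_I2)
        fix x
        have "norm (F x) * norm (u n x) \<le> norm (F x) * (\<bar>C\<bar> * gauss x)"
          by (intro mult_left_mono order_trans[OF b] mult_right_mono) auto
        then show "norm (F x * u n x) \<le> \<bar>C\<bar> * norm (F x * complex_of_real (gauss x))" by (simp add: norm_mult mult_ac)
      qed
    qed (use FG in auto)
    \<comment> \<open>On this side the limit comes from \<open>Lp_fourier_pairing\<close> for the
      differences \<open>d n\<close>, which tend to 0 in \<open>L\<^sup>1\<close> and in
      \<open>L\<^sup>2\<close>. First \<open>\<eta>\<close> is fixed so that
      \<open>B * \<eta> < e\<close>, then \<open>n\<close> is taken large.\<close>
    have R: "(\<lambda>n. \<integral>x. f x * fourier_int (u n) x \<partial>lborel) \<longlonglongrightarrow> (\<integral>x. f x * fourier_int v x \<partial>lborel)"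
    proof (rule LIMSEQ_I)
      fix e :: real assume e: "e > 0"
      define B where "B = (\<integral>x. norm (f x) powr p \<partial>lborel)"
      have B: "B \<ge> 0" by (simp add: B_def)
      define \<eta> where "\<eta> = e / (2 * (B + 1))"
      have eta: "\<eta> > 0" using e B by (simp add: \<eta>_def)
      have "(\<lambda>n. B * ((\<integral>x. norm (d n x) \<partial>lborel) + \<eta>) + (\<integral>x. (norm (d n x))\<^sup>2 \<partial>lborel) / \<eta>) \<longlonglongrightarrow> B * (0 + \<eta>) + 0 / \<eta>"
        using l1 l2 eta by (intro tendsto_intros) auto
      moreover have "B * (0 + \<eta>) + 0 / \<eta> < e"
        using e B unfolding \<eta>_def by (simp add: divide_less_eq)
      ultimately have "eventually (\<lambda>n. B * ((\<integral>x. norm (d n x) \<partial>lborel) + \<eta>) + (\<integral>x. (norm (d n x))\<^sup>2 \<partial>lborel) / \<eta> < e) sequentially"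
        by (rule order_tendstoD)
      then obtain N where N: "\<And>n. n \<ge> N \<Longrightarrow> B * ((\<integral>x. norm (d n x) \<partial>lborel) + \<eta>) + (\<integral>x. (norm (d n x))\<^sup>2 \<partial>lborel) / \<eta> < e"
        unfolding eventually_sequentially by blast
      have "norm ((\<integral>x. f x * fourier_int (u n) x \<partial>lborel) - (\<integral>x. f x * fourier_int v x \<partial>lborel)) < e" if "n \<ge> N" for n
      proof -
        have "(\<integral>x. f x * fourier_int (u n) x \<partial>lborel) - (\<integral>x. f x * fourier_int v x \<partial>lborel) = (\<integral>x. f x * fourier_int (u n) x - f x * fourier_int v x \<partial>lborel)"
          using Lp_fourier_pairing_integrable[OF p f ui] Lp_fourier_pairing_integrable[OF p f vi] by simp
        also have "\<dots> = (\<integral>x. f x * fourier_int (d n) x \<partial>lborel)"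
          unfolding fd by (simp add: right_diff_distrib)
        finally have eq: "(\<integral>x. f x * fourier_int (u n) x \<partial>lborel) - (\<integral>x. f x * fourier_int v x \<partial>lborel) = (\<integral>x. f x * fourier_int (d n) x \<partial>lborel)" .
        have "ennreal (norm (\<integral>x. f x * fourier_int (d n) x \<partial>lborel)) \<le> (\<integral>\<^sup>+x. ennreal (norm (f x * fourier_int (d n) x)) \<partial>lborel)"
          by (rule integral_norm_bound_ennreal[OF Lp_fourier_pairing_integrable[OF p f di]])
        also have "\<dots> \<le> ennreal (B * ((\<integral>x. norm (d n x) \<partial>lborel) + \<eta>) + (\<integral>x. (norm (d n x))\<^sup>2 \<partial>lborel) / \<eta>)"
          unfolding B_def by (rule Lp_fourier_pairing[OF p f di eta])
        finally have "norm (\<integral>x. f x * fourier_int (d n) x \<partial>lborel) \<le> B * ((\<integral>x. norm (d n x) \<partial>lborel) + \<eta>) + (\<integral>x. (norm (d n x))\<^sup>2 \<partial>lborel) / \<eta>"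
          using B eta by (subst (asm) ennreal_le_iff) (auto intro!: add_nonneg_nonneg mult_nonneg_nonneg)
        then show ?thesis unfolding eq using N[OF that] by simp
      qed
      then show "\<exists>N. \<forall>n\<ge>N. norm ((\<integral>x. f x * fourier_int (u n) x \<partial>lborel) - (\<integral>x. f x * fourier_int v x \<partial>lborel)) < e" by blast
    qed
    have "(\<lambda>n. \<integral>\<xi>. F \<xi> * u n \<xi> \<partial>lborel) = (\<lambda>n. \<integral>x. f x * fourier_int (u n) x \<partial>lborel)"
      using u unfolding P_def by auto
    then have "(\<integral>\<xi>. F \<xi> * v \<xi> \<partial>lborel) = (\<integral>x. f x * fourier_int v x \<partial>lborel)"
      using LIMSEQ_unique[OF L] R by simp
    then show "P v" unfolding P_def using v vb by blast
  qed
  then show ?thesis unfolding P_def by blast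
qed

section \<open>Density of Schwartz functions\<close>

lemma norm_add_powr_le:
  fixes a b :: complex
  assumes "p > 0"
  shows "norm (a + b) powr p \<le> 2 powr p * (norm a powr p + norm b powr p)"
proof -
  have "norm (a + b) \<le> 2 * max (norm a) (norm b)" using norm_triangle_ineq[of a b] by linarith
  then have "norm (a + b) powr p \<le> (2 * max (norm a) (norm b)) powr p" using assms by (intro powr_mono2) auto
  also have "\<dots> = 2 powr p * max (norm a) (norm b) powr p" by (simp add: powr_mult)
  also have "\<dots> \<le> 2 powr p * (norm a powr p + norm b powr p)"
    by (intro mult_left_mono) (auto simp: max_def)
  finally show ?thesis .
qed

lemma nn_integral_norm_add_powr_le:
  fixes a b :: "'a \<Rightarrow> complex"
  assumes [measurable]: "a \<in> borel_measurable M" "b \<in> borel_measurable M" and p: "p > 0"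
  shows "(\<integral>\<^sup>+x. ennreal (norm (a x + b x) powr p) \<partial>M)
     \<le> ennreal (2 powr p) * ((\<integral>\<^sup>+x. ennreal (norm (a x) powr p) \<partial>M) + (\<integral>\<^sup>+x. ennreal (norm (b x) powr p) \<partial>M))"
proof -
  have "(\<integral>\<^sup>+x. ennreal (norm (a x + b x) powr p) \<partial>M)
    \<le> (\<integral>\<^sup>+x. ennreal (2 powr p) * (ennreal (norm (a x) powr p) + ennreal (norm (b x) powr p)) \<partial>M)"
    by (intro nn_integral_mono)
       (use norm_add_powr_le[OF p] in \<open>auto intro!: ennreal_leI simp flip: ennreal_mult ennreal_plus\<close>)
  also have "\<dots> = ennreal (2 powr p) * ((\<integral>\<^sup>+x. ennreal (norm (a x) powr p) \<partial>M) + (\<integral>\<^sup>+x. ennreal (norm (b x) powr p) \<partial>M))"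
    by (subst nn_integral_cmult) (auto simp: nn_integral_add)
  finally show ?thesis .
qed

text \<open>Approximation is measured by the integral of the power \<open>p\<close>, without the
  root; \<open>norm_add_powr_le\<close> then does the work of the triangle inequality at the price
  of a factor \<open>2 powr p\<close>.\<close>

definition schwartz_approx :: "real \<Rightarrow> (real^2 \<Rightarrow> complex) \<Rightarrow> bool" where
  "schwartz_approx p h \<longleftrightarrow> (\<forall>e>0. \<exists>\<phi>. gauss_schwartz \<phi> \<and>
     (\<integral>\<^sup>+x. ennreal (norm (h x - \<phi> x) powr p) \<partial>lborel) \<le> ennreal e)"

lemma schwartz_approx_limit:
  assumes [measurable]: "v \<in> borel_measurable borel" "\<And>n::nat. u n \<in> borel_measurable borel" and p: "1 \<le> p"
    and l: "(\<lambda>n. \<integral>\<^sup>+x. ennreal (norm (v x - u n x) powr p) \<partial>lborel) \<longlonglongrightarrow> 0"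
    and u: "\<And>n. schwartz_approx p (u n)"
  shows "schwartz_approx p v"
  unfolding schwartz_approx_def
proof (intro allI impI)
  fix e :: real assume e: "e > 0"
  define K where "K = 2 powr p * 2"
  have K: "K > 0" unfolding K_def by simp
  have eK: "e / K > 0" using e K by simp
  have "eventually (\<lambda>n. (\<integral>\<^sup>+x. ennreal (norm (v x - u n x) powr p) \<partial>lborel) < ennreal (e / K)) sequentially"
    using l eK by (intro order_tendstoD) auto
  then obtain n where n: "(\<integral>\<^sup>+x. ennreal (norm (v x - u n x) powr p) \<partial>lborel) < ennreal (e / K)"
    by (auto dest: eventually_happens)
  obtain \<phi> where \<phi>: "gauss_schwartz \<phi>" "(\<integral>\<^sup>+x. ennreal (norm (u n x - \<phi> x) powr p) \<partial>lborel) \<le> ennreal (e / K)"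
    using u[of n] eK unfolding schwartz_approx_def by blast
  have [measurable]: "\<phi> \<in> borel_measurable borel" using \<phi> unfolding gauss_schwartz_def by auto
  have "(\<integral>\<^sup>+x. ennreal (norm (v x - \<phi> x) powr p) \<partial>lborel) = (\<integral>\<^sup>+x. ennreal (norm ((v x - u n x) + (u n x - \<phi> x)) powr p) \<partial>lborel)"
    by simp
  also have "\<dots> \<le> ennreal (2 powr p) * ((\<integral>\<^sup>+x. ennreal (norm (v x - u n x) powr p) \<partial>lborel) + (\<integral>\<^sup>+x. ennreal (norm (u n x - \<phi> x) powr p) \<partial>lborel))"
    using p by (intro nn_integral_norm_add_powr_le) auto
  also have "\<dots> \<le> ennreal (2 powr p) * (ennreal (e / K) + ennreal (e / K))"
    using \<phi> n by (intro mult_left_mono add_mono) auto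
  also have "\<dots> = ennreal (K * (e / K))"
    using eK unfolding K_def by (simp flip: ennreal_mult ennreal_plus)
  also have "K * (e / K) = e" using K by simp
  finally show "\<exists>\<phi>. gauss_schwartz \<phi> \<and> (\<integral>\<^sup>+x. ennreal (norm (v x - \<phi> x) powr p) \<partial>lborel) \<le> ennreal e"
    using \<phi> by blast
qed

text \<open>The same induction as for duality. In the limit step dominated convergence applies
  because \<open>gauss powr p \<le> gauss\<close> for \<open>p \<ge> 1\<close>.\<close>

lemma schwartz_approx_dominated:
  fixes h :: "real^2 \<Rightarrow> complex"
  assumes p: "1 \<le> p" and h: "h \<in> borel_measurable borel" "\<And>x. norm (h x) \<le> c * gauss x"
  shows "schwartz_approx p h"
proof -
  define P where "P h \<longleftrightarrow> h \<in> borel_measurable borel \<and> schwartz_approx p h" for h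
  have "P h"
  proof (rule gauss_dominated_induct[OF h])
    fix A B :: "real poly"
    assume A: "\<And>t. t\<^sup>2 \<le> poly A t" and B: "\<And>t. t\<^sup>2 \<le> poly B t"
    let ?u = "\<lambda>x::real^2. complex_of_real (exp (- poly A (x $ 1) - poly B (x $ 2)))"
    have "gauss_schwartz ?u" by (rule gauss_schwartz_exp_poly[OF A B])
    then show "P ?u" unfolding P_def schwartz_approx_def using p
      by (intro conjI allI impI exI[of _ ?u]) (auto simp: gauss_schwartz_def)
  next
    fix a u v assume u: "P u" and v: "P v"
    have [measurable]: "u \<in> borel_measurable borel" "v \<in> borel_measurable borel" using u v unfolding P_def by auto
    show "P (\<lambda>x. a * u x + v x)" unfolding P_def schwartz_approx_def
    proof (intro conjI allI impI)
      fix e :: real assume e: "e > 0"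
      define K where "K = 2 powr p * (norm a powr p + 1)"
      have K: "K > 0" unfolding K_def by (intro mult_pos_pos add_nonneg_pos) auto
      have eK: "e / K > 0" using e K by simp
      obtain \<phi> where \<phi>: "gauss_schwartz \<phi>" "(\<integral>\<^sup>+x. ennreal (norm (u x - \<phi> x) powr p) \<partial>lborel) \<le> ennreal (e / K)"
        using u eK unfolding P_def schwartz_approx_def by blast
      obtain \<psi> where \<psi>: "gauss_schwartz \<psi>" "(\<integral>\<^sup>+x. ennreal (norm (v x - \<psi> x) powr p) \<partial>lborel) \<le> ennreal (e / K)"
        using v eK unfolding P_def schwartz_approx_def by blast
      have [measurable]: "\<phi> \<in> borel_measurable borel" "\<psi> \<in> borel_measurable borel" using \<phi> \<psi> unfolding gauss_schwartz_def by auto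
      show "\<exists>\<phi>. gauss_schwartz \<phi> \<and> (\<integral>\<^sup>+x. ennreal (norm (a * u x + v x - \<phi> x) powr p) \<partial>lborel) \<le> ennreal e"
      proof (intro exI[of _ "\<lambda>x. a * \<phi> x + \<psi> x"] conjI gauss_schwartz_lincomb \<phi> \<psi>)
        have "(\<integral>\<^sup>+x. ennreal (norm (a * u x + v x - (a * \<phi> x + \<psi> x)) powr p) \<partial>lborel)
          = (\<integral>\<^sup>+x. ennreal (norm (a * (u x - \<phi> x) + (v x - \<psi> x)) powr p) \<partial>lborel)"
          by (simp add: algebra_simps)
        also have "\<dots> \<le> ennreal (2 powr p) * ((\<integral>\<^sup>+x. ennreal (norm (a * (u x - \<phi> x)) powr p) \<partial>lborel) + (\<integral>\<^sup>+x. ennreal (norm (v x - \<psi> x) powr p) \<partial>lborel))"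
          using p by (intro nn_integral_norm_add_powr_le) auto
        also have "(\<integral>\<^sup>+x. ennreal (norm (a * (u x - \<phi> x)) powr p) \<partial>lborel) = ennreal (norm a powr p) * (\<integral>\<^sup>+x. ennreal (norm (u x - \<phi> x) powr p) \<partial>lborel)"
          by (subst nn_integral_cmult[symmetric]) (auto simp: norm_mult powr_mult ennreal_mult)
        also have "ennreal (2 powr p) * (ennreal (norm a powr p) * (\<integral>\<^sup>+x. ennreal (norm (u x - \<phi> x) powr p) \<partial>lborel) + (\<integral>\<^sup>+x. ennreal (norm (v x - \<psi> x) powr p) \<partial>lborel))
          \<le> ennreal (2 powr p) * (ennreal (norm a powr p) * ennreal (e / K) + ennreal (e / K))"
          using \<phi> \<psi> by (intro mult_left_mono add_mono) auto
        also have "\<dots> = ennreal (K * (e / K))"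
        proof -
          have "2 powr p * (y * w + w) = 2 powr p * (y + 1) * w" for y w by (simp add: algebra_simps)
          from this[of "norm a powr p" "e / K"] have "2 powr p * (norm a powr p * (e / K) + e / K) = K * (e / K)" unfolding K_def .
          then show ?thesis using eK by (simp only: ennreal_mult'[symmetric] ennreal_plus[symmetric] powr_ge_zero mult_nonneg_nonneg less_imp_le)
        qed
        also have "K * (e / K) = e" using K by simp
        finally show "(\<integral>\<^sup>+x. ennreal (norm (a * u x + v x - (a * \<phi> x + \<psi> x)) powr p) \<partial>lborel) \<le> ennreal e" .
      qed
    qed measurable
  next
    fix u v C
    assume u: "\<And>n::nat. P (u n)" and b: "\<And>n x. norm (u n x) \<le> C * gauss x"
      and v [measurable]: "v \<in> borel_measurable borel" and lim: "AE x in lborel. (\<lambda>n. u n x) \<longlonglongrightarrow> v x"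
    have [measurable]: "u n \<in> borel_measurable borel" for n using u unfolding P_def by auto
    have C: "C \<ge> 0" using order_trans[OF norm_ge_zero b[of 0 0]] by (simp add: gauss_def)
    have l: "(\<lambda>n. \<integral>\<^sup>+x. ennreal (norm (v x - u n x) powr p) \<partial>lborel) \<longlonglongrightarrow> (\<integral>\<^sup>+(x::real^2). 0 \<partial>lborel)"
    proof (rule nn_integral_dominated_convergence[where w="\<lambda>x. ennreal ((2 * C) powr p * gauss x)"])
      show "(\<integral>\<^sup>+x. ennreal ((2 * C) powr p * gauss x) \<partial>lborel) < \<infinity>"
        using integrable_gauss by (subst nn_integral_eq_integral) auto
      show "AE x in lborel. ennreal (norm (v x - u n x) powr p) \<le> ennreal ((2 * C) powr p * gauss x)" for n
        using lim
      proof eventually_elim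
        case (elim x)
        have "norm (v x) \<le> C * gauss x" by (rule tendsto_upperbound[OF tendsto_norm[OF elim]]) (auto simp: b)
        then have "norm (v x - u n x) \<le> (2 * C) * gauss x" using norm_triangle_ineq4[of "v x" "u n x"] b[of n x] by linarith
        then have "norm (v x - u n x) powr p \<le> ((2 * C) * gauss x) powr p" using p by (intro powr_mono2) auto
        also have "\<dots> = (2 * C) powr p * gauss x powr p" using C by (simp add: powr_mult)
        also have "\<dots> \<le> (2 * C) powr p * gauss x powr 1"
          using p gauss_le_1[of x] by (intro mult_left_mono powr_mono') auto
        finally show ?case by (intro ennreal_leI) simp
      qed
      show "AE x in lborel. (\<lambda>n. ennreal (norm (v x - u n x) powr p)) \<longlonglongrightarrow> 0"
        using lim
      proof eventually_elim
        case (elim x)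
        have "(\<lambda>n. norm (v x - u n x)) \<longlonglongrightarrow> norm (v x - v x)" by (intro tendsto_intros elim)
        then have "(\<lambda>n. norm (v x - u n x) powr p) \<longlonglongrightarrow> 0 powr p"
          using p by (intro tendsto_powr2) (auto intro!: tendsto_intros always_eventually)
        then have "(\<lambda>n. ennreal (norm (v x - u n x) powr p)) \<longlonglongrightarrow> ennreal (0 powr p)" by (rule tendsto_ennrealI)
        then show ?case by simp
      qed
    qed auto
    have "schwartz_approx p v"
      by (rule schwartz_approx_limit[of v u]) (use u l p in \<open>auto simp: P_def\<close>)
    then show "P v" unfolding P_def using v by blast
  qed
  then show ?thesis unfolding P_def by blast
qed

text \<open>The truncations keep \<open>f\<close> where it is at most \<open>n * gauss\<close>.
  Since \<open>gauss\<close> is positive, at each point they equal \<open>f\<close> from some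
  \<open>n\<close> on, and the power of \<open>f\<close> itself is the majorant.\<close>

lemma schwartz_approx_Lp:
  fixes f :: "real^2 \<Rightarrow> complex"
  assumes p: "1 \<le> p" and f: "in_Lp p f"
  shows "schwartz_approx p f"
proof -
  have [measurable]: "f \<in> borel_measurable borel" using f by (simp add: in_Lp_def)
  define u where "u n x = (if norm (f x) \<le> real n * gauss x then f x else 0)" for n x
  have [measurable]: "u n \<in> borel_measurable borel" for n unfolding u_def[abs_def] by measurable
  have ub: "norm (u n x) \<le> real n * gauss x" for n x unfolding u_def by auto
  have l: "(\<lambda>n. \<integral>\<^sup>+x. ennreal (norm (f x - u n x) powr p) \<partial>lborel) \<longlonglongrightarrow> (\<integral>\<^sup>+(x::real^2). 0 \<partial>lborel)"
  proof (rule nn_integral_dominated_convergence[where w="\<lambda>x. ennreal (norm (f x) powr p)"])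
    show "(\<integral>\<^sup>+x. ennreal (norm (f x) powr p) \<partial>lborel) < \<infinity>"
      using f unfolding in_Lp_def by (subst nn_integral_eq_integral) auto
    show "AE x in lborel. ennreal (norm (f x - u n x) powr p) \<le> ennreal (norm (f x) powr p)" for n
      by (auto simp: u_def)
    show "AE x in lborel. (\<lambda>n. ennreal (norm (f x - u n x) powr p)) \<longlonglongrightarrow> 0"
    proof (rule AE_I2)
      fix x
      obtain N :: nat where N: "norm (f x) / gauss x \<le> real N" using real_arch_simple by blast
      have "f x - u n x = 0" if "n \<ge> N" for n
      proof -
        have "norm (f x) / gauss x \<le> real n" using N that by simp
        then have "norm (f x) \<le> real n * gauss x" by (simp add: divide_le_eq)
        then show ?thesis unfolding u_def by simp
      qed
      then have "eventually (\<lambda>n. ennreal (norm (f x - u n x) powr p) = 0) sequentially"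
        unfolding eventually_sequentially by (intro exI[of _ N]) auto
      then show "(\<lambda>n. ennreal (norm (f x - u n x) powr p)) \<longlonglongrightarrow> 0" by (rule tendsto_eventually)
    qed
  qed auto
  have "schwartz_approx p (u n)" for n by (rule schwartz_approx_dominated[OF p _ ub]) simp
  then show ?thesis using l p by (intro schwartz_approx_limit[of f u]) auto
qed

section \<open>Maximal restriction and Lebesgue points\<close>

lemma ball_avg_mono: "(\<And>y. g y \<le> h y) \<Longrightarrow> ball_avg r g x \<le> ball_avg r h x"
  unfolding ball_avg_def by (intro nn_integral_mono mult_left_mono) auto

text \<open>A supremum over countably many radii is measurable; by
  \<open>ball_avg_le_dyadic_max\<close> it controls all radii up to 1.\<close>

definition dyadic_max :: "(real^2 \<Rightarrow> complex) \<Rightarrow> real^2 \<Rightarrow> ennreal" where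
  "dyadic_max F x = (SUP n::nat. ball_avg (1 / 2 ^ n) (\<lambda>y. ennreal (norm (F y))) x)"

lemma dyadic_max_measurable [measurable]:
  assumes [measurable]: "F \<in> borel_measurable borel"
  shows "dyadic_max F \<in> borel_measurable borel"
  unfolding dyadic_max_def[abs_def] by measurable

text \<open>The maximal function is linearised by selecting a best radius at every point, and the
  modulus of \<open>F\<close> is absorbed in the phase of \<open>h\<close>. The bound
  \<open>B\<close> is required uniformly in the cutoff, so it survives the monotone limit.\<close>

lemma dyadic_max_dual:
  fixes F g :: "real^2 \<Rightarrow> complex"
  assumes F [measurable]: "F \<in> borel_measurable borel"
    and FG: "integrable lborel (\<lambda>x. F x * complex_of_real (gauss x))"
    and dual: "\<And>h c. h \<in> borel_measurable borel \<Longrightarrow> (\<And>x. norm (h x) \<le> c * gauss x) \<Longrightarrow>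
        (\<integral>\<xi>. F \<xi> * h \<xi> \<partial>lborel) = (\<integral>x. g x * fourier_int h x \<partial>lborel)"
    and B: "\<And>i N h. i \<in> borel \<rightarrow>\<^sub>M count_space UNIV \<Longrightarrow> (\<And>x. i x \<le> N) \<Longrightarrow> h \<in> borel_measurable borel \<Longrightarrow>
        (\<And>y. ennreal (norm (h y)) \<le> circ_kernel i y) \<Longrightarrow>
        (\<integral>\<^sup>+x. ennreal (norm (g x * fourier_int h x)) \<partial>lborel) \<le> B"
  shows "(\<integral>\<^sup>+x. dyadic_max F x \<partial>circle_measure) \<le> B"
proof -
  define a where "a n x = ball_avg (1 / 2 ^ n) (\<lambda>y. ennreal (norm (F y))) x" for n x
  have [measurable]: "a n \<in> borel_measurable borel" for n unfolding a_def[abs_def] by measurable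
  have fin: "(\<integral>\<^sup>+x. (SUP n\<in>{..N}. a n x) \<partial>circle_measure) \<le> B" for N
  proof -
    \<comment> \<open>The least maximiser is a definite choice among finitely many radii, and this
      makes the selection measurable.\<close>
    define i where "i x = (LEAST n. n \<le> N \<and> (\<forall>m\<in>{..N}. a m x \<le> a n x))" for x
    have i [measurable]: "i \<in> borel \<rightarrow>\<^sub>M count_space UNIV" unfolding i_def by measurable
    have ex: "\<exists>n. n \<le> N \<and> (\<forall>m\<in>{..N}. a m x \<le> a n x)" for x
    proof -
      have "Max ((\<lambda>m. a m x) ` {..N}) \<in> (\<lambda>m. a m x) ` {..N}" by (rule Max_in) auto
      then obtain n where n: "Max ((\<lambda>m. a m x) ` {..N}) = a n x" "n \<in> {..N}" by (rule imageE)
      have "a m x \<le> a n x" if "m \<in> {..N}" for m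
        unfolding n(1)[symmetric] using that by (intro Max_ge) auto
      then show ?thesis using n(2) by (intro exI[of _ n]) auto
    qed
    have i2: "i x \<le> N" "\<And>m. m \<le> N \<Longrightarrow> a m x \<le> a (i x) x" for x
      using LeastI_ex[OF ex[of x]] unfolding i_def by auto
    let ?H = "circ_kernel i"
    define H where "H y = enn2real (?H y)" for y
    have [measurable]: "H \<in> borel_measurable borel" unfolding H_def[abs_def] by measurable
    have Hle: "?H y \<le> ennreal (2 * 4 ^ N)" for y by (rule circ_kernel_le(1)[OF i i2(1)])
    have H: "?H y = ennreal (H y)" for y unfolding H_def
      using Hle[of y] by (intro ennreal_enn2real[symmetric]) (auto intro: le_less_trans)
    have H0: "H y \<ge> 0" "H y \<le> 2 * 4 ^ N" for y
      using Hle[of y] unfolding H by (auto simp: H_def ennreal_le_iff)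
    \<comment> \<open>The conjugate phase makes \<open>F * h\<close> equal to
      \<open>\<bar>F\<bar> * H\<close>; where \<open>F\<close> vanishes, \<open>sgn\<close> is 0 and
      the equation still holds.\<close>
    define h where "h y = cnj (sgn (F y)) * complex_of_real (H y)" for y
    have hm [measurable]: "h \<in> borel_measurable borel"
    proof -
      have [measurable]: "(\<lambda>y. cnj (F y)) \<in> borel_measurable borel"
        by (rule measurable_compose[OF F borel_measurable_continuous_onI]) (intro continuous_intros)
      have "h = (\<lambda>y. cnj (F y) / complex_of_real (norm (F y)) * complex_of_real (H y))"
        unfolding h_def[abs_def] by (simp add: sgn_eq)
      moreover have "\<dots> \<in> borel_measurable borel" by measurable
      ultimately show ?thesis by (simp only:)
    qed
    have hn: "norm (h y) \<le> H y" for y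
      using H0[of y] by (auto simp: h_def norm_mult norm_sgn)
    have Fh: "F y * h y = complex_of_real (norm (F y) * H y)" for y
    proof (cases "F y = 0")
      case False
      have "F y * cnj (sgn (F y)) = (F y * cnj (F y)) / complex_of_real (norm (F y))" by (simp add: sgn_eq)
      also have "\<dots> = complex_of_real (norm (F y))"
        using False by (simp add: complex_norm_square[symmetric] power2_eq_square)
      finally show ?thesis unfolding h_def by (simp add: mult.assoc[symmetric])
    qed simp
    \<comment> \<open>The function \<open>h\<close> vanishes for \<open>norm y \<ge> 2\<close>, and
      on the remaining disc \<open>gauss\<close> is at least \<open>exp (-4)\<close>.\<close>
    have hg: "norm (h y) \<le> (2 * 4 ^ N * exp 4) * gauss y" for y
    proof (cases "2 \<le> norm y")
      case True
      then have "H y = 0" unfolding H_def using circ_kernel_le(2)[OF i i2(1)] by simp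
      then show ?thesis by (simp add: h_def)
    next
      case False
      then have "norm y * norm y \<le> 2 * 2" by (intro mult_mono) auto
      then have "y \<bullet> y \<le> 4" by (simp add: power2_norm_eq_inner[symmetric] power2_eq_square)
      then have "1 \<le> exp 4 * gauss y" unfolding gauss_def exp_add[symmetric] by simp
      then have "2 * 4 ^ N * 1 \<le> 2 * 4 ^ N * (exp 4 * gauss y)" by (intro mult_left_mono) auto
      moreover have "norm (h y) \<le> 2 * 4 ^ N * 1" using hn[of y] H0(2)[of y] by simp
      ultimately show ?thesis by (simp only: mult.assoc)
    qed
    have "(\<integral>\<^sup>+x. (SUP n\<in>{..N}. a n x) \<partial>circle_measure) \<le> (\<integral>\<^sup>+x. a (i x) x \<partial>circle_measure)"
      by (intro nn_integral_mono SUP_least i2) auto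
    also have "\<dots> = (\<integral>\<^sup>+x. \<integral>\<^sup>+y. ball_kernel (1 / 2 ^ i x) x y * ennreal (norm (F y)) \<partial>lborel \<partial>circle_measure)"
      unfolding a_def ball_avg_def ..
    also have "\<dots> = (\<integral>\<^sup>+y. \<integral>\<^sup>+x. ball_kernel (1 / 2 ^ i x) x y * ennreal (norm (F y)) \<partial>circle_measure \<partial>lborel)"
      by (rule nn_integral_lborel_circle_swap[symmetric]) measurable
    also have "\<dots> = (\<integral>\<^sup>+y. ?H y * ennreal (norm (F y)) \<partial>lborel)"
      unfolding circ_kernel_def by (simp add: nn_integral_multc)
    also have "\<dots> = (\<integral>\<^sup>+y. ennreal (norm (F y) * H y) \<partial>lborel)"
      using H0 by (simp add: H ennreal_mult mult.commute)
    also have "\<dots> = ennreal (\<integral>y. norm (F y) * H y \<partial>lborel)"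
    proof (rule nn_integral_eq_integral)
      have "integrable lborel (\<lambda>y. norm (F y * h y))"
        by (intro integrable_norm integrable_mult_gauss_dominated[OF F hm FG AE_I2[OF hg]])
      then show "integrable lborel (\<lambda>y. norm (F y) * H y)"
        unfolding Fh using H0 by (simp add: abs_mult del: of_real_mult)
    qed (use H0 in auto)
    also have "(\<integral>y. norm (F y) * H y \<partial>lborel) = norm (\<integral>y. F y * h y \<partial>lborel)"
    proof -
      have "(\<integral>y. F y * h y \<partial>lborel) = complex_of_real (\<integral>y. norm (F y) * H y \<partial>lborel)"
        unfolding Fh by (rule integral_complex_of_real)
      moreover have "0 \<le> (\<integral>y. norm (F y) * H y \<partial>lborel)" by (intro Bochner_Integration.integral_nonneg) (simp add: H0)
      ultimately show ?thesis by simp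
    qed
    also have "(\<integral>y. F y * h y \<partial>lborel) = (\<integral>x. g x * fourier_int h x \<partial>lborel)"
      by (rule dual[OF hm hg])
    also have "ennreal (norm (\<integral>x. g x * fourier_int h x \<partial>lborel)) \<le> (\<integral>\<^sup>+x. ennreal (norm (g x * fourier_int h x)) \<partial>lborel)"
      by (cases "integrable lborel (\<lambda>x. g x * fourier_int h x)")
         (auto intro: integral_norm_bound_ennreal simp: not_integrable_integral_eq)
    also have "\<dots> \<le> B"
    proof (rule B[OF i i2(1) hm])
      show "ennreal (norm (h y)) \<le> ?H y" for y unfolding H by (intro ennreal_leI hn)
    qed
    finally show ?thesis .
  qed
  have "(\<integral>\<^sup>+x. dyadic_max F x \<partial>circle_measure) = (\<integral>\<^sup>+x. (SUP N. SUP n\<in>{..N}. a n x) \<partial>circle_measure)"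
  proof (rule nn_integral_cong)
    fix x
    have "(SUP n. a n x) = (SUP N. SUP n\<in>{..N}. a n x)"
    proof (rule antisym)
      show "(SUP n. a n x) \<le> (SUP N. SUP n\<in>{..N}. a n x)"
      proof (rule SUP_least)
        fix n
        have "a n x \<le> (SUP k\<in>{..n}. a k x)" by (rule SUP_upper) simp
        also have "\<dots> \<le> (SUP N. SUP n\<in>{..N}. a n x)" by (rule SUP_upper) simp
        finally show "a n x \<le> (SUP N. SUP n\<in>{..N}. a n x)" .
      qed
      show "(SUP N. SUP n\<in>{..N}. a n x) \<le> (SUP n. a n x)"
        by (intro SUP_least SUP_upper) auto
    qed
    then show "dyadic_max F x = (SUP N. SUP n\<in>{..N}. a n x)" unfolding dyadic_max_def a_def .
  qed
  also have "\<dots> = (SUP N. \<integral>\<^sup>+x. (SUP n\<in>{..N}. a n x) \<partial>circle_measure)"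
  proof (rule nn_integral_monotone_convergence_SUP)
    show "incseq (\<lambda>N x. SUP n\<in>{..N}. a n x)"
      by (auto intro!: incseq_SucI le_funI SUP_subset_mono)
  qed measurable
  also have "\<dots> \<le> B" by (intro SUP_least fin)
  finally show ?thesis .
qed

text \<open>Since \<open>\<delta>\<close> depends only on \<open>p\<close> and \<open>e\<close>, it
  can be fixed before \<open>f\<close> is approximated. For \<open>p = 1\<close> the conjugate
  exponent is infinite and the trivial bound \<open>2 * pi\<close> for the transform suffices; for
  \<open>p > 1\<close> Young's inequality is combined with
  \<open>fourier_circ_kernel_powr\<close>.\<close>

lemma dyadic_max_small:
  fixes p :: real
  assumes p: "1 \<le> p" "p < 4 / 3" and e: "e > 0"
  shows "\<exists>\<delta>>0. \<forall>F g. F \<in> borel_measurable borel \<longrightarrow> integrable lborel (\<lambda>x. F x * complex_of_real (gauss x)) \<longrightarrow>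
      (\<forall>h c. h \<in> borel_measurable borel \<longrightarrow> (\<forall>x. norm (h x) \<le> c * gauss x) \<longrightarrow>
        (\<integral>\<xi>. F \<xi> * h \<xi> \<partial>lborel) = (\<integral>x. g x * fourier_int h x \<partial>lborel)) \<longrightarrow>
      g \<in> borel_measurable borel \<longrightarrow> (\<integral>\<^sup>+x. ennreal (norm (g x) powr p) \<partial>lborel) \<le> ennreal \<delta> \<longrightarrow>
      (\<integral>\<^sup>+x. dyadic_max F x \<partial>circle_measure) \<le> ennreal e"
proof -
  have "\<exists>\<delta>>0. \<forall>g i N h. g \<in> borel_measurable borel \<longrightarrow> (\<integral>\<^sup>+x. ennreal (norm (g x) powr p) \<partial>lborel) \<le> ennreal \<delta> \<longrightarrow>
      i \<in> borel \<rightarrow>\<^sub>M count_space UNIV \<longrightarrow> (\<forall>x. i x \<le> N) \<longrightarrow> h \<in> borel_measurable borel \<longrightarrow>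
      (\<forall>y. ennreal (norm (h y)) \<le> circ_kernel i y) \<longrightarrow>
      (\<integral>\<^sup>+x. ennreal (norm (g x * fourier_int h x)) \<partial>lborel) \<le> ennreal e"
  proof (cases "p = 1")
    case True
    show ?thesis
    proof (intro exI[of _ "e / (2 * pi)"] conjI allI impI)
      fix g :: "real^2 \<Rightarrow> complex" and i N and h :: "real^2 \<Rightarrow> complex"
      assume [measurable]: "g \<in> borel_measurable borel" and g: "(\<integral>\<^sup>+x. ennreal (norm (g x) powr p) \<partial>lborel) \<le> ennreal (e / (2 * pi))"
        and i: "i \<in> borel \<rightarrow>\<^sub>M count_space UNIV" and [measurable]: "h \<in> borel_measurable borel"
        and hb: "\<forall>y. ennreal (norm (h y)) \<le> circ_kernel i y"
      have "(\<integral>\<^sup>+y. ennreal (norm (h y)) \<partial>lborel) \<le> ennreal (2 * pi)"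
        using nn_integral_mono[of lborel "\<lambda>y. ennreal (norm (h y))" "circ_kernel i"] hb
        by (simp add: nn_integral_circ_kernel[OF i])
      then have "(\<integral>y. norm (h y) \<partial>lborel) \<le> 2 * pi"
        by (subst integral_eq_nn_integral) (auto intro!: enn2real_leI)
      then have "norm (fourier_int h x) \<le> 2 * pi" for x using norm_fourier_int_le[of h x] by linarith
      then have "(\<integral>\<^sup>+x. ennreal (norm (g x * fourier_int h x)) \<partial>lborel) \<le> (\<integral>\<^sup>+x. ennreal (2 * pi) * ennreal (norm (g x) powr p) \<partial>lborel)"
        using True by (intro nn_integral_mono) (auto simp: norm_mult mult.commute[of "2 * pi"] intro!: ennreal_leI mult_left_mono simp flip: ennreal_mult)
      also have "\<dots> = ennreal (2 * pi) * (\<integral>\<^sup>+x. ennreal (norm (g x) powr p) \<partial>lborel)" by (rule nn_integral_cmult) measurable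
      also have "\<dots> \<le> ennreal (2 * pi) * ennreal (e / (2 * pi))" by (intro mult_left_mono g) simp
      also have "\<dots> = ennreal e" using e by (simp flip: ennreal_mult)
      finally show "(\<integral>\<^sup>+x. ennreal (norm (g x * fourier_int h x)) \<partial>lborel) \<le> ennreal e" .
    qed (use e in simp)
  next
    case False
    then have p1: "p > 1" using p by simp
    \<comment> \<open>This is the exponent conjugate to \<open>p\<close>; it exceeds 4 exactly
      because \<open>p < 4/3\<close>.\<close>
    define s where "s = p / (p - 1)"
    have s: "s > 4" using p1 p unfolding s_def by (simp add: less_divide_eq)
    have ps: "1 / p + 1 / s = 1" using p1 unfolding s_def by (simp add: field_simps)
    obtain C where C: "C \<ge> 0" "\<And>i N h. i \<in> borel \<rightarrow>\<^sub>M count_space UNIV \<Longrightarrow> (\<forall>x. i x \<le> N) \<Longrightarrow> h \<in> borel_measurable borel \<Longrightarrow>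
     (\<forall>y. ennreal (norm (h y)) \<le> circ_kernel i y) \<Longrightarrow>
     (\<integral>\<^sup>+\<xi>. ennreal (norm (fourier_int h \<xi>) powr s) \<partial>lborel) \<le> ennreal C"
      using fourier_circ_kernel_powr[OF s] by blast
    \<comment> \<open>The scale in Young's inequality is chosen so that the term with the transform
      is at most \<open>e / 2\<close>; \<open>C + 1\<close> avoids division by 0. Then
      \<open>d\<close> is chosen so that the other term is at most \<open>e / 2\<close>.\<close>
    define l where "l = (e / (2 * (C + 1))) powr (1 / s)"
    have l: "l > 0" using e C by (simp add: l_def)
    have ls: "l powr s = e / (2 * (C + 1))" using e C s by (simp add: l_def powr_powr)
    have "e / (2 * k) * k = e / 2" if "k > 0" for k :: real using that by simp
    then have "l powr s * (C + 1) = e / 2" unfolding ls using C(1) by (simp only: add_nonneg_pos zero_less_one)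
    moreover have "l powr s * C \<le> l powr s * (C + 1)" by (intro mult_left_mono) auto
    ultimately have lC: "l powr s * C \<le> e / 2" by simp
    define d where "d = l powr p * (e / 2)"
    have d: "d > 0" using l e by (simp add: d_def)
    show ?thesis
    proof (intro exI[of _ d] conjI allI impI d)
      fix g :: "real^2 \<Rightarrow> complex" and i N and h :: "real^2 \<Rightarrow> complex"
      assume [measurable]: "g \<in> borel_measurable borel" and g: "(\<integral>\<^sup>+x. ennreal (norm (g x) powr p) \<partial>lborel) \<le> ennreal d"
        and i: "i \<in> borel \<rightarrow>\<^sub>M count_space UNIV" "\<forall>x. i x \<le> N" and hm [measurable]: "h \<in> borel_measurable borel"
        and hb: "\<forall>y. ennreal (norm (h y)) \<le> circ_kernel i y"
      have pt: "norm (g x * fourier_int h x) \<le> l powr (- p) * norm (g x) powr p + l powr s * norm (fourier_int h x) powr s" for x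
      proof -
        have "norm (g x * fourier_int h x) = (norm (g x) / l) * (l * norm (fourier_int h x))" using l by (simp add: norm_mult)
        also have "\<dots> \<le> (norm (g x) / l) powr p / p + (l * norm (fourier_int h x)) powr s / s"
          using p1 s l ps by (intro Youngs_inequality) auto
        also have "\<dots> \<le> (norm (g x) / l) powr p / 1 + (l * norm (fourier_int h x)) powr s / 1"
          using p1 s by (intro add_mono divide_left_mono) auto
        also have "\<dots> = l powr (- p) * norm (g x) powr p + l powr s * norm (fourier_int h x) powr s"
          using l by (simp add: powr_divide powr_mult powr_minus_divide)
        finally show ?thesis .
      qed
      have "(\<integral>\<^sup>+x. ennreal (norm (g x * fourier_int h x)) \<partial>lborel)
        \<le> (\<integral>\<^sup>+x. ennreal (l powr (- p)) * ennreal (norm (g x) powr p) + ennreal (l powr s) * ennreal (norm (fourier_int h x) powr s) \<partial>lborel)"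
        by (intro nn_integral_mono) (use pt in \<open>auto intro!: ennreal_leI simp flip: ennreal_mult ennreal_plus\<close>)
      also have "\<dots> = ennreal (l powr (- p)) * (\<integral>\<^sup>+x. ennreal (norm (g x) powr p) \<partial>lborel) + ennreal (l powr s) * (\<integral>\<^sup>+x. ennreal (norm (fourier_int h x) powr s) \<partial>lborel)"
        by (subst nn_integral_add) (auto simp: nn_integral_cmult)
      also have "\<dots> \<le> ennreal (l powr (- p)) * ennreal d + ennreal (l powr s) * ennreal C"
        by (intro add_mono mult_left_mono g C(2)[OF i hm hb]) auto
      also have "\<dots> = ennreal (l powr (- p) * d + l powr s * C)" using d C by (simp flip: ennreal_mult ennreal_plus)
      also have "\<dots> \<le> ennreal e"
      proof (rule ennreal_leI)
        have "l powr (- p) * d = e / 2" using l by (simp add: d_def powr_minus)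
        then show "l powr (- p) * d + l powr s * C \<le> e" using lC by simp
      qed
      finally show "(\<integral>\<^sup>+x. ennreal (norm (g x * fourier_int h x)) \<partial>lborel) \<le> ennreal e" .
    qed
  qed
  then obtain \<delta> where \<delta>: "\<delta> > 0" and *: "\<And>g i N h. g \<in> borel_measurable borel \<Longrightarrow> (\<integral>\<^sup>+x. ennreal (norm (g x) powr p) \<partial>lborel) \<le> ennreal \<delta> \<Longrightarrow>
      i \<in> borel \<rightarrow>\<^sub>M count_space UNIV \<Longrightarrow> (\<forall>x. i x \<le> N) \<Longrightarrow> h \<in> borel_measurable borel \<Longrightarrow>
      (\<forall>y. ennreal (norm (h y)) \<le> circ_kernel i y) \<Longrightarrow>
      (\<integral>\<^sup>+x. ennreal (norm (g x * fourier_int h x)) \<partial>lborel) \<le> ennreal e" by blast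
  show ?thesis
  proof (intro exI[of _ \<delta>] conjI allI impI \<delta>)
    fix F g :: "real^2 \<Rightarrow> complex"
    assume F: "F \<in> borel_measurable borel" "integrable lborel (\<lambda>x. F x * complex_of_real (gauss x))"
      and dual: "\<forall>h c. h \<in> borel_measurable borel \<longrightarrow> (\<forall>x. norm (h x) \<le> c * gauss x) \<longrightarrow>
        (\<integral>\<xi>. F \<xi> * h \<xi> \<partial>lborel) = (\<integral>x. g x * fourier_int h x \<partial>lborel)"
      and g: "g \<in> borel_measurable borel" "(\<integral>\<^sup>+x. ennreal (norm (g x) powr p) \<partial>lborel) \<le> ennreal \<delta>"
    show "(\<integral>\<^sup>+x. dyadic_max F x \<partial>circle_measure) \<le> ennreal e"
    proof (rule dyadic_max_dual[OF F, where g=g])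
      show "(\<integral>\<xi>. F \<xi> * h \<xi> \<partial>lborel) = (\<integral>x. g x * fourier_int h x \<partial>lborel)"
        if "h \<in> borel_measurable borel" "\<And>x. norm (h x) \<le> c * gauss x" for h c
        using dual that by blast
      show "(\<integral>\<^sup>+x. ennreal (norm (g x * fourier_int h x)) \<partial>lborel) \<le> ennreal e"
        if "i \<in> borel \<rightarrow>\<^sub>M count_space UNIV" "\<And>x. i x \<le> N" "h \<in> borel_measurable borel" "\<And>y. ennreal (norm (h y)) \<le> circ_kernel i y" for i N h
        using *[OF g that(1) _ that(3)] that(2,4) by blast
    qed
  qed
qed

section \<open>From disc averages to Lebesgue points\<close>

lemma ball_avg_add:
  assumes [measurable]: "g \<in> borel_measurable borel" "h \<in> borel_measurable borel"
  shows "ball_avg r (\<lambda>y. g y + h y) x = ball_avg r g x + ball_avg r h x"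
  unfolding ball_avg_def by (simp add: distrib_left nn_integral_add)

lemma ball_avg_const: "r > 0 \<Longrightarrow> ball_avg r (\<lambda>y. c) x = c"
  unfolding ball_avg_def by (subst nn_integral_multc) (auto simp: nn_integral_ball_kernel)

lemma ball_avg_le_on_ball:
  assumes r: "r > 0" and le: "\<And>y. dist x y < r \<Longrightarrow> g y \<le> c"
  shows "ball_avg r g x \<le> c"
proof -
  have "ball_avg r g x \<le> ball_avg r (\<lambda>y. c) x"
    unfolding ball_avg_def by (intro nn_integral_mono) (auto simp: ball_kernel_def intro!: mult_left_mono le)
  then show ?thesis using ball_avg_const[OF r] by simp
qed

lemma ball_avg_eq:
  assumes [measurable]: "g \<in> borel_measurable borel" and r: "r > 0"
  shows "ennreal (1 / measure lborel (ball x r)) * (\<integral>\<^sup>+y\<in>ball x r. g y \<partial>lborel) = ball_avg r g x"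
proof -
  have m: "measure lborel (ball x r) = pi * r\<^sup>2"
    using emeasure_ball_vec2[of r x] r by (simp add: measure_def)
  have b: "ball x r \<in> sets borel" by simp
  have "ball_avg r g x = (\<integral>\<^sup>+y. ennreal (1 / (pi * r\<^sup>2)) * (g y * indicator (ball x r) y) \<partial>lborel)"
    unfolding ball_avg_def by (intro nn_integral_cong) (auto simp: ball_kernel_def indicator_def)
  also have "\<dots> = ennreal (1 / (pi * r\<^sup>2)) * (\<integral>\<^sup>+y\<in>ball x r. g y \<partial>lborel)"
    using borel_measurable_times_ennreal[OF assms(1) borel_measurable_indicator[OF b]] by (intro nn_integral_cmult) simp
  finally show ?thesis unfolding m ..
qed

text \<open>The disc lies in one of dyadic radius at most \<open>2 * r\<close>, and 4 bounds the
  ratio of areas.\<close>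

lemma ball_avg_le_dyadic_max:
  assumes [measurable]: "F \<in> borel_measurable borel" and r: "0 < r" "r \<le> 1"
  shows "ball_avg r (\<lambda>y. ennreal (norm (F y))) x \<le> 4 * dyadic_max F x"
proof -
  obtain j where j: "(1/2) ^ Suc j < r" and j2: "r \<le> (1/2) ^ j" using dyadic_bracket[OF r] .
  define q :: real where "q = 1 / 2 ^ j"
  have q: "r \<le> q" "q \<le> 2 * r" using j j2 by (auto simp: q_def power_one_over)
  have "ball_kernel r x y \<le> 4 * ball_kernel q x y" for y
  proof (cases "dist x y < r")
    case True
    have "q\<^sup>2 \<le> (2 * r)\<^sup>2" using q r by (intro power_mono) auto
    then have "1 / (pi * r\<^sup>2) \<le> 4 * (1 / (pi * q\<^sup>2))"
      using r q by (simp add: divide_simps power_mult_distrib)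
    then have "ennreal (1 / (pi * r\<^sup>2)) \<le> ennreal (4 * (1 / (pi * q\<^sup>2)))" by (rule ennreal_leI)
    also have "\<dots> = 4 * ennreal (1 / (pi * q\<^sup>2))" by (subst ennreal_mult') auto
    finally show ?thesis using True q by (simp add: ball_kernel_def)
  qed (simp add: ball_kernel_def)
  then have "ball_avg r (\<lambda>y. ennreal (norm (F y))) x \<le> (\<integral>\<^sup>+y. 4 * ball_kernel q x y * ennreal (norm (F y)) \<partial>lborel)"
    unfolding ball_avg_def by (intro nn_integral_mono mult_right_mono) auto
  also have "\<dots> = (\<integral>\<^sup>+y. 4 * (ball_kernel q x y * ennreal (norm (F y))) \<partial>lborel)" by (simp add: mult.assoc)
  also have "\<dots> = 4 * ball_avg q (\<lambda>y. ennreal (norm (F y))) x"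
    unfolding ball_avg_def by (rule nn_integral_cmult) simp
  also have "\<dots> \<le> 4 * dyadic_max F x"
    unfolding dyadic_max_def q_def by (intro mult_left_mono SUP_upper) auto
  finally show ?thesis .
qed

text \<open>The difference \<open>F y - c\<close> is split as
  \<open>(F y - G y) + (G y - G x) - (c - G x)\<close>. The averages of the first term are
  controlled by the maximal function, the second is small by continuity, and the third is a
  constant. The function \<open>G\<close> may depend on \<open>x\<close> and
  \<open>e\<close>.\<close>

lemma lebesgue_point_valueI:
  fixes F :: "real^2 \<Rightarrow> complex"
  assumes F [measurable]: "F \<in> borel_measurable borel"
    and approx: "\<And>e. e > 0 \<Longrightarrow> \<exists>G. G \<in> borel_measurable borel \<and> isCont G x \<and>
        4 * dyadic_max (\<lambda>y. F y - G y) x + ennreal (norm (c - G x)) < ennreal e"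
  shows "lebesgue_point_value F x c"
  unfolding lebesgue_point_value_def
proof (rule order_tendstoI)
  fix a :: ennreal assume "a < 0"
  then show "\<forall>\<^sub>F r in at_right 0. a < ennreal (1 / measure lborel (ball x r)) * (\<integral>\<^sup>+y\<in>ball x r. ennreal (norm (F y - c)) \<partial>lborel)"
    by simp
next
  fix a :: ennreal assume "0 < a"
  then obtain b where b: "0 < b" "b < a" using dense by blast
  have bt: "b < top" by (rule less_le_trans[OF b(2) top_greatest])
  \<comment> \<open>One half of \<open>b\<close> pays for the oscillation of \<open>G\<close>, the
    other for the error assumed small in \<open>approx\<close>.\<close>
  define e where "e = enn2real b / 2"
  have be: "b = ennreal (2 * e)" unfolding e_def using bt by simp
  have e: "e > 0" using b(1) unfolding be by (simp add: ennreal_less_zero_iff)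
  obtain G where G [measurable]: "G \<in> borel_measurable borel" and cont: "isCont G x"
    and small: "4 * dyadic_max (\<lambda>y. F y - G y) x + ennreal (norm (c - G x)) < ennreal e"
    using approx[OF e] by blast
  obtain d where d: "d > 0" "\<And>y. dist y x < d \<Longrightarrow> dist (G y) (G x) < e"
    using cont e unfolding continuous_at_eps_delta by blast
  show "\<forall>\<^sub>F r in at_right 0. ennreal (1 / measure lborel (ball x r)) * (\<integral>\<^sup>+y\<in>ball x r. ennreal (norm (F y - c)) \<partial>lborel) < a"
    unfolding eventually_at_right_field
  proof (intro exI[of _ "min d 1"] conjI allI impI)
    show "0 < min d 1" using d by simp
    fix r :: real assume r0: "0 < r" and r: "r < min d 1"
    have "ennreal (1 / measure lborel (ball x r)) * (\<integral>\<^sup>+y\<in>ball x r. ennreal (norm (F y - c)) \<partial>lborel)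
      = ball_avg r (\<lambda>y. ennreal (norm (F y - c))) x"
      by (rule ball_avg_eq[OF _ r0]) measurable
    also have "\<dots> \<le> ball_avg r (\<lambda>y. ennreal (norm (F y - G y)) + (ennreal (norm (G y - G x)) + ennreal (norm (c - G x)))) x"
    proof (rule ball_avg_mono)
      fix y
      have "norm (F y - c) = norm ((F y - G y) + (G y - G x) - (c - G x))" by simp
      then have "norm (F y - c) \<le> norm (F y - G y) + (norm (G y - G x) + norm (c - G x))"
        using norm_triangle_ineq4[of "(F y - G y) + (G y - G x)" "c - G x"] norm_triangle_ineq[of "F y - G y" "G y - G x"]
        by linarith
      then show "ennreal (norm (F y - c)) \<le> ennreal (norm (F y - G y)) + (ennreal (norm (G y - G x)) + ennreal (norm (c - G x)))"
        by (simp add: ennreal_leI flip: ennreal_plus)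
    qed
    also have "\<dots> = ball_avg r (\<lambda>y. ennreal (norm (F y - G y))) x + (ball_avg r (\<lambda>y. ennreal (norm (G y - G x))) x + ennreal (norm (c - G x)))"
      by (simp add: ball_avg_add ball_avg_const[OF r0])
    also have "\<dots> \<le> 4 * dyadic_max (\<lambda>y. F y - G y) x + (ennreal e + ennreal (norm (c - G x)))"
    proof (intro add_mono order_refl)
      show "ball_avg r (\<lambda>y. ennreal (norm (F y - G y))) x \<le> 4 * dyadic_max (\<lambda>y. F y - G y) x"
        using r r0 by (intro ball_avg_le_dyadic_max) auto
      show "ball_avg r (\<lambda>y. ennreal (norm (G y - G x))) x \<le> ennreal e"
      proof (rule ball_avg_le_on_ball[OF r0])
        fix y assume "dist x y < r"
        then have "dist y x < d" using r by (simp add: dist_commute)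
        from d(2)[OF this] show "ennreal (norm (G y - G x)) \<le> ennreal e"
          by (intro ennreal_leI) (simp add: dist_norm)
      qed
    qed
    also have "\<dots> = (4 * dyadic_max (\<lambda>y. F y - G y) x + ennreal (norm (c - G x))) + ennreal e"
      by (simp add: add_ac)
    also have "\<dots> \<le> ennreal e + ennreal e" using small by (intro add_right_mono) auto
    also have "\<dots> = b" unfolding be using e by (simp flip: ennreal_plus)
    also have "\<dots> < a" by (rule b)
    finally show "ennreal (1 / measure lborel (ball x r)) * (\<integral>\<^sup>+y\<in>ball x r. ennreal (norm (F y - c)) \<partial>lborel) < a" .
  qed
qed

lemma gauss_schwartz_facts:
  assumes "gauss_schwartz \<phi>"
  shows "schwartz \<phi>" "\<phi> \<in> borel_measurable borel" "integrable lborel \<phi>" "1 \<le> p \<Longrightarrow> in_Lp p \<phi>"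
proof -
  obtain c where c: "\<And>x. norm (\<phi> x) \<le> c * gauss x" and m [measurable]: "\<phi> \<in> borel_measurable borel"
    and s: "schwartz \<phi>" using assms unfolding gauss_schwartz_def by blast
  show "schwartz \<phi>" "\<phi> \<in> borel_measurable borel" by fact+
  show "integrable lborel \<phi>" by (rule gauss_dominated_integrable[OF m AE_I2[OF c]])
  have c0: "c \<ge> 0" using order_trans[OF norm_ge_zero c[of 0]] by (simp add: gauss_def)
  assume p: "1 \<le> p"
  have "integrable lborel (\<lambda>x. norm (\<phi> x) powr p)"
  proof (rule Bochner_Integration.integrable_bound)
    show "integrable lborel (\<lambda>x. c powr p * gauss x)" using integrable_gauss by simp
    have "norm (\<phi> x) powr p \<le> c powr p * gauss x" for x
    proof -
      have "norm (\<phi> x) powr p \<le> (c * gauss x) powr p" using p c by (intro powr_mono2) auto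
      also have "\<dots> = c powr p * gauss x powr p" using c0 by (simp add: powr_mult)
      also have "\<dots> \<le> c powr p * gauss x powr 1"
        using p gauss_le_1[of x] by (intro mult_left_mono powr_mono') auto
      finally show ?thesis by simp
    qed
    then show "AE x in lborel. norm (norm (\<phi> x) powr p) \<le> norm (c powr p * gauss x)" by simp
  qed measurable
  then show "in_Lp p \<phi>" unfolding in_Lp_def by simp
qed

theorem theorem1p2:
  fixes p :: real and f F :: "real^2 \<Rightarrow> complex"
    and R :: "(real^2 \<Rightarrow> complex) \<Rightarrow> (real^2 \<Rightarrow> complex)"
  assumes "1 \<le> p" and "p < 4/3"
    and "in_Lp p f"
    and "is_fourier_transform f F"
    and "restriction_operator p R"
  shows "(AE x in circle_measure. lebesgue_point F x) \<and>
         (AE x in circle_measure. lebesgue_point_value F x (R f x))"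
proof -
  note p = assms(1,2) and f = assms(3) and F = assms(4) and R = assms(5)
  have p2: "p \<le> 2" using p by simp
  have Fm [measurable]: "F \<in> borel_measurable borel" and fm [measurable]: "f \<in> borel_measurable borel"
    using F f by (auto simp: is_fourier_transform_def in_Lp_def)
  obtain C where C: "\<And>f. in_Lp p f \<Longrightarrow> integrable circle_measure (R f)"
      "\<And>f. in_Lp p f \<Longrightarrow> (\<integral>x. norm (R f x) \<partial>circle_measure) \<le> C * Lp_norm p f"
    using R unfolding restriction_operator_def by blast
  have Rlin: "AE x in circle_measure. R (\<lambda>y. a * f y + b * g y) x = a * R f x + b * R g x"
    if "in_Lp p f" "in_Lp p g" for f g a b
    using R that unfolding restriction_operator_def by blast
  have RS: "AE x in circle_measure. R f x = fourier_int f x" if "schwartz f" for f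
    using R that unfolding restriction_operator_def by blast
  have [measurable]: "R f \<in> borel_measurable borel"
    using borel_measurable_integrable[OF C(1)[OF f]] by simp
  have approx: "\<exists>G. G \<in> borel_measurable borel \<and> (\<forall>x. isCont G x) \<and>
     (\<integral>\<^sup>+x. 4 * dyadic_max (\<lambda>y. F y - G y) x + ennreal (norm (R f x - G x)) \<partial>circle_measure) \<le> ennreal e"
    if e: "e > 0" for e :: real
  proof -
    \<comment> \<open>The maximal term carries the factor 4, so \<open>e / 8\<close> for it and
      \<open>e / 2\<close> for the restriction term add up to \<open>e\<close>.\<close>
    have e8: "e / 8 > 0" using e by simp
    obtain \<delta> where \<delta>: "\<delta> > 0" and max: "\<And>F g. F \<in> borel_measurable borel \<Longrightarrow> integrable lborel (\<lambda>x. F x * complex_of_real (gauss x)) \<Longrightarrow>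
      (\<forall>h c. h \<in> borel_measurable borel \<longrightarrow> (\<forall>x. norm (h x) \<le> c * gauss x) \<longrightarrow>
        (\<integral>\<xi>. F \<xi> * h \<xi> \<partial>lborel) = (\<integral>x. g x * fourier_int h x \<partial>lborel)) \<Longrightarrow>
      g \<in> borel_measurable borel \<Longrightarrow> (\<integral>\<^sup>+x. ennreal (norm (g x) powr p) \<partial>lborel) \<le> ennreal \<delta> \<Longrightarrow>
      (\<integral>\<^sup>+x. dyadic_max F x \<partial>circle_measure) \<le> ennreal (e / 8)"
      using dyadic_max_small[OF p e8] by blast
    \<comment> \<open>The first bound serves the maximal estimate, the second the restriction
      operator, whose error is at most \<open>C\<close> times the root of order \<open>p\<close>.
      Since \<open>C\<close> may be 0 or negative, \<open>\<bar>C\<bar> + 1\<close> is used.\<close>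
    define \<eta> where "\<eta> = min \<delta> ((e / (2 * (\<bar>C\<bar> + 1))) powr p)"
    have eta: "\<eta> > 0" "\<eta> \<le> \<delta>" "\<eta> \<le> (e / (2 * (\<bar>C\<bar> + 1))) powr p"
      using \<delta> e unfolding \<eta>_def by auto
    obtain \<phi> where \<phi>: "gauss_schwartz \<phi>" and close: "(\<integral>\<^sup>+x. ennreal (norm (f x - \<phi> x) powr p) \<partial>lborel) \<le> ennreal \<eta>"
      using schwartz_approx_Lp[OF p(1) f] eta(1) unfolding schwartz_approx_def by blast
    note \<phi>' = gauss_schwartz_facts[OF \<phi>]
    note [measurable] = \<phi>'(2)
    define G where "G = fourier_int \<phi>"
    have Gm [measurable]: "G \<in> borel_measurable borel" unfolding G_def by measurable
    have cont: "isCont G x" for x unfolding G_def by (rule continuous_fourier_int[OF \<phi>'(3)])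
    define g where "g x = f x - \<phi> x" for x
    have gm [measurable]: "g \<in> borel_measurable borel" unfolding g_def[abs_def] by measurable
    have gint: "integrable lborel (\<lambda>x. norm (g x) powr p)"
      by (rule integrableI_bounded) (use close in \<open>auto simp: g_def intro: le_less_trans\<close>)
    have gLp: "in_Lp p g" unfolding in_Lp_def using gint by simp
    have Gb: "norm (G x) \<le> (\<integral>y. norm (\<phi> y) \<partial>lborel)" for x unfolding G_def by (rule norm_fourier_int_le)
    have Gh: "integrable lborel (\<lambda>x. G x * h x)" if "integrable lborel h" for h :: "real^2 \<Rightarrow> complex"
    proof (rule Bochner_Integration.integrable_bound)
      show "integrable lborel (\<lambda>x. complex_of_real (\<integral>y. norm (\<phi> y) \<partial>lborel) * h x)" using that by simp
      show "(\<lambda>x. G x * h x) \<in> borel_measurable lborel" using that by auto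
      show "AE x in lborel. norm (G x * h x) \<le> norm (complex_of_real (\<integral>y. norm (\<phi> y) \<partial>lborel) * h x)"
        by (intro AE_I2) (auto simp: norm_mult intro!: mult_right_mono order_trans[OF Gb])
    qed
    have gaussi: "integrable lborel (\<lambda>x. complex_of_real (gauss x))"
      using integrable_gauss by simp
    have FG: "integrable lborel (\<lambda>x. F x * complex_of_real (gauss x))" by (rule fourier_transform_gauss_integrable[OF F])
    have M: "(\<integral>\<^sup>+x. dyadic_max (\<lambda>y. F y - G y) x \<partial>circle_measure) \<le> ennreal (e / 8)"
    proof (rule max[of _ g])
      show "(\<lambda>y. F y - G y) \<in> borel_measurable borel" by measurable
      show "integrable lborel (\<lambda>x. (F x - G x) * complex_of_real (gauss x))"
        using FG Gh[OF gaussi] by (simp add: left_diff_distrib)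
      show "g \<in> borel_measurable borel" by fact
      have "(\<integral>\<^sup>+x. ennreal (norm (g x) powr p) \<partial>lborel) \<le> ennreal \<eta>" using close by (simp add: g_def)
      also have "\<dots> \<le> ennreal \<delta>" using eta by (intro ennreal_leI)
      finally show "(\<integral>\<^sup>+x. ennreal (norm (g x) powr p) \<partial>lborel) \<le> ennreal \<delta>" .
      \<comment> \<open>The function \<open>F - G\<close> is a weak transform of \<open>g\<close>:
        the part with \<open>F\<close> is \<open>fourier_transform_dual\<close>, the part with
        \<open>G\<close> is the multiplication formula for the integrable function
        \<open>\<phi>\<close>.\<close>
      show "\<forall>h c. h \<in> borel_measurable borel \<longrightarrow> (\<forall>x. norm (h x) \<le> c * gauss x) \<longrightarrow>
        (\<integral>\<xi>. (F \<xi> - G \<xi>) * h \<xi> \<partial>lborel) = (\<integral>x. g x * fourier_int h x \<partial>lborel)"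
      proof (intro allI impI)
        fix h :: "real^2 \<Rightarrow> complex" and c
        assume h [measurable]: "h \<in> borel_measurable borel" and hb: "\<forall>x. norm (h x) \<le> c * gauss x"
        have hb': "AE x in lborel. norm (h x) \<le> c * gauss x" using hb by simp
        have hi: "integrable lborel h" "integrable lborel (\<lambda>x. (norm (h x))\<^sup>2)"
          using gauss_dominated_integrable[OF h hb'] by auto
        have Fh: "integrable lborel (\<lambda>x. F x * h x)"
          by (rule integrable_mult_gauss_dominated[OF Fm h FG hb'])
        have "(\<integral>\<xi>. (F \<xi> - G \<xi>) * h \<xi> \<partial>lborel) = (\<integral>\<xi>. F \<xi> * h \<xi> \<partial>lborel) - (\<integral>\<xi>. G \<xi> * h \<xi> \<partial>lborel)"
          using Fh Gh[OF hi(1)] by (simp add: left_diff_distrib)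
        also have "\<dots> = (\<integral>x. f x * fourier_int h x \<partial>lborel) - (\<integral>x. \<phi> x * fourier_int h x \<partial>lborel)"
          using fourier_transform_dual[OF p(1) p2 f F h hb[rule_format]]
            fourier_int_multiplication[OF \<phi>'(3) hi(1)] by (simp add: G_def)
        also have "\<dots> = (\<integral>x. g x * fourier_int h x \<partial>lborel)"
          using Lp_fourier_pairing_integrable[OF p(1) p2 f hi] Lp_fourier_pairing_integrable[OF p(1) p2 \<phi>'(4)[OF p(1)] hi]
          by (simp add: g_def left_diff_distrib)
        finally show "(\<integral>\<xi>. (F \<xi> - G \<xi>) * h \<xi> \<partial>lborel) = (\<integral>x. g x * fourier_int h x \<partial>lborel)" .
      qed
    qed
    have RR: "(\<integral>\<^sup>+x. ennreal (norm (R f x - G x)) \<partial>circle_measure) \<le> ennreal (e / 2)"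
    proof -
      \<comment> \<open>Linearity of \<open>R\<close> and its agreement with the transform on
        \<open>\<phi>\<close> hold almost everywhere, which is enough under the integral.\<close>
      have "AE x in circle_measure. R g x = R f x - G x"
      proof -
        have "g = (\<lambda>y. 1 * f y + (-1) * \<phi> y)" by (simp add: g_def fun_eq_iff)
        then have "AE x in circle_measure. R g x = 1 * R f x + (-1) * R \<phi> x"
          using Rlin[OF f \<phi>'(4)[OF p(1)], of 1 "-1"] by simp
        then show ?thesis using RS[OF \<phi>'(1)] by eventually_elim (simp add: G_def)
      qed
      then have "(\<integral>\<^sup>+x. ennreal (norm (R f x - G x)) \<partial>circle_measure) = (\<integral>\<^sup>+x. ennreal (norm (R g x)) \<partial>circle_measure)"
        by (intro nn_integral_cong_AE) (auto elim: eventually_mono)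
      also have "\<dots> = ennreal (\<integral>x. norm (R g x) \<partial>circle_measure)"
        using C(1)[OF gLp] by (intro nn_integral_eq_integral) auto
      also have "\<dots> \<le> ennreal (e / 2)"
      proof (rule ennreal_leI)
        have "ennreal (\<integral>x. norm (g x) powr p \<partial>lborel) \<le> ennreal \<eta>"
          using close nn_integral_eq_integral[OF gint] by (simp add: g_def)
        then have "(\<integral>x. norm (g x) powr p \<partial>lborel) \<le> \<eta>" using eta by (simp add: ennreal_le_iff)
        then have "(\<integral>x. norm (g x) powr p \<partial>lborel) \<le> (e / (2 * (\<bar>C\<bar> + 1))) powr p" using eta by linarith
        then have "Lp_norm p g \<le> ((e / (2 * (\<bar>C\<bar> + 1))) powr p) powr (1 / p)"
          unfolding Lp_norm_def using p by (intro powr_mono2) auto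
        also have "\<dots> = e / (2 * (\<bar>C\<bar> + 1))" using p e by (simp add: powr_powr)
        finally have L: "Lp_norm p g \<le> e / (2 * (\<bar>C\<bar> + 1))" .
        have "(\<integral>x. norm (R g x) \<partial>circle_measure) \<le> C * Lp_norm p g" by (rule C(2)[OF gLp])
        also have "\<dots> \<le> (\<bar>C\<bar> + 1) * Lp_norm p g" by (intro mult_right_mono) (auto simp: Lp_norm_def)
        also have "\<dots> \<le> (\<bar>C\<bar> + 1) * (e / (2 * (\<bar>C\<bar> + 1)))" by (intro mult_left_mono L) auto
        also have "\<dots> = e / 2"
        proof -
          have *: "k * (e / (2 * k)) = e / 2" if "k > 0" for k :: real using that by simp
          show ?thesis by (rule *) (simp add: add_nonneg_pos)
        qed
        finally show "(\<integral>x. norm (R g x) \<partial>circle_measure) \<le> e / 2" .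
      qed
      finally show ?thesis .
    qed
    have "(\<integral>\<^sup>+x. 4 * dyadic_max (\<lambda>y. F y - G y) x + ennreal (norm (R f x - G x)) \<partial>circle_measure)
      = 4 * (\<integral>\<^sup>+x. dyadic_max (\<lambda>y. F y - G y) x \<partial>circle_measure) + (\<integral>\<^sup>+x. ennreal (norm (R f x - G x)) \<partial>circle_measure)"
      by (subst nn_integral_add) (auto simp: nn_integral_cmult)
    also have "\<dots> \<le> 4 * ennreal (e / 8) + ennreal (e / 2)" by (intro add_mono mult_left_mono M RR) auto
    also have "\<dots> = ennreal e" using e by (simp flip: ennreal_numeral ennreal_mult ennreal_plus)
    finally show ?thesis using Gm cont by blast
  qed
  have "\<forall>n. \<exists>G. G \<in> borel_measurable borel \<and> (\<forall>x. isCont G x) \<and>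
     (\<integral>\<^sup>+x. 4 * dyadic_max (\<lambda>y. F y - G y) x + ennreal (norm (R f x - G x)) \<partial>circle_measure) \<le> ennreal (1 / real (Suc n))"
    using approx by simp
  from choice[OF this] obtain G where G0: "\<forall>n. G n \<in> borel_measurable borel \<and> (\<forall>x. isCont (G n) x) \<and>
     (\<integral>\<^sup>+x. 4 * dyadic_max (\<lambda>y. F y - G n y) x + ennreal (norm (R f x - G n x)) \<partial>circle_measure) \<le> ennreal (1 / real (Suc n))" ..
  have G: "\<And>n. G n \<in> borel_measurable borel" "\<And>n x. isCont (G n) x"
     "\<And>n. (\<integral>\<^sup>+x. 4 * dyadic_max (\<lambda>y. F y - G n y) x + ennreal (norm (R f x - G n x)) \<partial>circle_measure) \<le> ennreal (1 / real (Suc n))"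
    using G0 by blast+
  note [measurable] = G(1)
  \<comment> \<open>Convergence of the integrals to 0 does not make \<open>u n\<close> converge
    pointwise. The infimum over \<open>n\<close> has integral 0 and thus vanishes almost everywhere,
    and \<open>lebesgue_point_valueI\<close> needs only one good \<open>n\<close> for each
    \<open>e\<close>.\<close>
  define u where "u n x = 4 * dyadic_max (\<lambda>y. F y - G n y) x + ennreal (norm (R f x - G n x))" for n x
  have [measurable]: "u n \<in> borel_measurable borel" for n unfolding u_def[abs_def] by measurable
  have "(\<integral>\<^sup>+x. (INF n. u n x) \<partial>circle_measure) \<le> 0 + ennreal e" if e: "e > 0" for e :: real
  proof -
    obtain n where "1 / real (Suc n) < e" using e reals_Archimedean[of e] by (auto simp: inverse_eq_divide)
    have "(\<integral>\<^sup>+x. (INF n. u n x) \<partial>circle_measure) \<le> (\<integral>\<^sup>+x. u n x \<partial>circle_measure)"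
      by (intro nn_integral_mono INF_lower) auto
    also have "\<dots> \<le> ennreal (1 / real (Suc n))" unfolding u_def by (rule G)
    also have "\<dots> \<le> ennreal e" using \<open>1 / real (Suc n) < e\<close> by (intro ennreal_leI) simp
    finally show ?thesis by simp
  qed
  then have "(\<integral>\<^sup>+x. (INF n. u n x) \<partial>circle_measure) \<le> 0"
    by (rule ennreal_le_epsilon)
  then have "AE x in circle_measure. (INF n. u n x) = 0"
    by (subst (asm) le_zero_eq, subst (asm) nn_integral_0_iff_AE) auto
  then have val: "AE x in circle_measure. lebesgue_point_value F x (R f x)"
  proof eventually_elim
    case (elim x)
    show ?case
    proof (rule lebesgue_point_valueI[OF Fm])
      fix e :: real assume "e > 0"
      then have "(INF n. u n x) < ennreal e" using elim by simp
      then obtain n where "u n x < ennreal e" unfolding INF_less_iff by blast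
      then show "\<exists>G. G \<in> borel_measurable borel \<and> isCont G x \<and> 4 * dyadic_max (\<lambda>y. F y - G y) x + ennreal (norm (R f x - G x)) < ennreal e"
        unfolding u_def using G by blast
    qed
  qed
  then have "AE x in circle_measure. lebesgue_point F x"
    by eventually_elim (auto simp: lebesgue_point_def)
  with val show ?thesis by blast
qed

end
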